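(* Every triangle-free graph that has exactly one cycle (as a subgraph) is deletion-normal.
   Context: All graphs are finite, without loops or parallel edges. A graph $G$ is $H$-free if it has no induced subgraph isomorphic to $H$. A graph $G$ is $H$-deletion-saturated if $G$ is $H$-free, $E(G)\neq\varnothing$, and for every edge $e\in E(G)$ the graph $G-e$ is not $H$-free. A graph $H$ is deletion-normal if there exists a (finite) $H$-deletion-saturated graph. *)

theory Defs
  imports Main
begin

record 'a graph =
  verts :: "'a set"
  edges :: "'a set set"

definition simple_graph :: "'a graph \<Rightarrow> bool" where
  "simple_graph G \<longleftrightarrow> finite (verts G) \<and> (\<forall>e\<in>edges G. e \<subseteq> verts G \<and> card e = 2)"

definition subgraph :: "'a graph \<Rightarrow> 'a graph \<Rightarrow> bool" where
  "subgraph C G \<longleftrightarrow> simple_graph C \<and> verts C \<subseteq> verts G \<and> edges C \<subseteq> edges G"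

definition induced :: "'a graph \<Rightarrow> 'a set \<Rightarrow> 'a graph" where
  "induced G S = \<lparr>verts = S, edges = {e \<in> edges G. e \<subseteq> S}\<rparr>"

definition isomorphic :: "'a graph \<Rightarrow> 'b graph \<Rightarrow> bool" where
  "isomorphic G H \<longleftrightarrow> (\<exists>f. bij_betw f (verts G) (verts H) \<and>
     (\<forall>u\<in>verts G. \<forall>v\<in>verts G. {u, v} \<in> edges G \<longleftrightarrow> {f u, f v} \<in> edges H))"

definition free :: "'a graph \<Rightarrow> 'b graph \<Rightarrow> bool" where
  "free H G \<longleftrightarrow> \<not> (\<exists>S \<subseteq> verts G. isomorphic H (induced G S))"

definition delete_edge :: "'a graph \<Rightarrow> 'a set \<Rightarrow> 'a graph" where
  "delete_edge G e = \<lparr>verts = verts G, edges = edges G - {e}\<rparr>"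

definition deletion_saturated :: "'a graph \<Rightarrow> 'b graph \<Rightarrow> bool" where
  "deletion_saturated H G \<longleftrightarrow> simple_graph G \<and> free H G \<and> edges G \<noteq> {} \<and>
     (\<forall>e\<in>edges G. \<not> free H (delete_edge G e))"

(* All the notions above are invariant under isomorphism and every finite graph has an
   isomorphic copy on natural numbers, so fixing the vertex type nat loses nothing. *)
definition deletion_normal :: "'a graph \<Rightarrow> bool" where
  "deletion_normal H \<longleftrightarrow> (\<exists>G :: nat graph. deletion_saturated H G)"

(* This is a simple graph, the cycle of length n, only for n \<ge> 3. *)
definition cycle_graph :: "nat \<Rightarrow> nat graph" where
  "cycle_graph n = \<lparr>verts = {..<n}, edges = {{i, Suc i mod n} | i. i < n}\<rparr>"

definition is_cycle :: "'a graph \<Rightarrow> bool" where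
  "is_cycle C \<longleftrightarrow> (\<exists>n\<ge>3. isomorphic C (cycle_graph n))"

definition triangle_free :: "'a graph \<Rightarrow> bool" where
  "triangle_free G \<longleftrightarrow> free (cycle_graph 3) G"

end

theory Submission
  imports Defs "HOL-Combinatorics.Permutations"
begin

text \<open>
  Let \<open>C\<close> be the only cycle of \<open>H\<close> and \<open>k\<close> its length, so \<open>k \<ge> 4\<close>. A chord of \<open>C\<close> would close a
  second cycle, so \<open>C\<close> is induced, and \<open>H\<close> arises from \<open>C\<close> by adding vertices one at a time, each
  joined to at most one earlier vertex (\<open>leaf_exists\<close>). Therefore only the cycle is a genuine
  obstruction: if a graph \<open>G\<close> has no induced \<open>C\<^sub>k\<close>, then it has no induced \<open>H\<close>; and if deleting an
  edge creates an induced \<open>C\<^sub>k\<close>, this cycle can be grown to an induced \<open>H\<close> greedily, provided that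
  every vertex of \<open>G\<close> has, for each small set \<open>A\<close> of other vertices, a neighbour outside \<open>A\<close>
  without neighbours in \<open>A\<close> (\<open>extendable\<close>).

  Any \<open>C\<^sub>k\<close>-deletion-saturated graph \<open>F\<close> can be turned into one with this extension property
  (\<open>deletion_normal_of_cycle_saturated\<close>). Many copies of \<open>F\<close> are glued together at vertices, so
  that each vertex lies in many copies and the pattern of copies looks like a tree in every ball
  of radius about \<open>k\<close>. Then a cycle of length \<open>k\<close> stays within one copy, so no induced \<open>C\<^sub>k\<close>
  arises, and the deletion of an edge still creates one inside the copy that contains it. The
  gluing pattern comes from involutions on a finite set that satisfy no short relation
  (\<open>large_girth_action\<close>).

  Below, a hole is an induced cycle of length at least 4. It remains to give one
  \<open>C\<^sub>k\<close>-deletion-saturated graph for every \<open>k \<ge> 4\<close>.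

    \<^item> For odd \<open>k = 2s + 1\<close> the rook graph on a square board of side \<open>s + 1\<close> will do: the edges of
      an induced cycle of length at least 4 alternate between rows and columns, so its length is
      even; but a staircase whose chord is deleted is an induced odd cycle.
    \<^item> For \<open>k = 4\<close> and \<open>k = 6\<close> there are circulant graphs on 19 and 13 vertices.
    \<^item> For even \<open>k = 2l - 2 \<ge> 8\<close> a ring of \<open>l\<close> layers of four vertices each will do. An induced
      \<open>C\<^sub>k\<close> has at most two vertices in every layer, so it is short of two vertices per layer by
      exactly two in total. Following the few possible sequences of full layers from a deficient
      one shows that the sequence cannot close up around the ring (\<open>no_closed_layer_sequence\<close>). Up
      to symmetry there are eight kinds of edges, and the deletion of each creates an explicit
      hole.
\<close>

section \<open>Induced embeddings\<close>

definition embeds :: "('a \<Rightarrow> 'b) \<Rightarrow> 'a graph \<Rightarrow> 'b graph \<Rightarrow> bool" where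
  "embeds f H G \<longleftrightarrow> inj_on f (verts H) \<and> f ` verts H \<subseteq> verts G \<and>
     (\<forall>u\<in>verts H. \<forall>v\<in>verts H. {u, v} \<in> edges H \<longleftrightarrow> {f u, f v} \<in> edges G)"

lemma not_free_iff_embeds: "\<not> free H G \<longleftrightarrow> (\<exists>f. embeds f H G)"
proof
  assume "\<not> free H G"
  then obtain S where S: "S \<subseteq> verts G" and "isomorphic H (induced G S)"
    unfolding free_def by blast
  then obtain f where f: "bij_betw f (verts H) S"
    and e: "\<forall>u\<in>verts H. \<forall>v\<in>verts H. {u, v} \<in> edges H \<longleftrightarrow> {f u, f v} \<in> edges (induced G S)"
    unfolding isomorphic_def by (auto simp: induced_def)
  have "embeds f H G"
    unfolding embeds_def using S f e by (auto simp: bij_betw_def induced_def)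
  then show "\<exists>f. embeds f H G" by blast
next
  assume "\<exists>f. embeds f H G"
  then obtain f where f: "embeds f H G" ..
  have "isomorphic H (induced G (f ` verts H))"
    unfolding isomorphic_def induced_def using f
    by (intro exI[of _ f]) (auto simp: embeds_def bij_betw_def)
  then show "\<not> free H G"
    using f unfolding free_def embeds_def by blast
qed

lemma embeds_trans:
  assumes "embeds f H G" "embeds g G K"
  shows "embeds (g \<circ> f) H K"
  using assms unfolding embeds_def
  by (auto simp: image_subset_iff intro!: comp_inj_on intro: inj_on_subset)

definition consecutive :: "nat \<Rightarrow> nat \<Rightarrow> nat \<Rightarrow> bool" where
  "consecutive k i j \<longleftrightarrow> j = Suc i mod k \<or> i = Suc j mod k"

lemma verts_cycle_graph [simp]: "verts (cycle_graph k) = {..<k}"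
  by (simp add: cycle_graph_def)

lemma edges_cycle_graph_iff:
  "i < k \<Longrightarrow> j < k \<Longrightarrow> {i, j} \<in> edges (cycle_graph k) \<longleftrightarrow> consecutive k i j"
  by (auto simp: cycle_graph_def consecutive_def doubleton_eq_iff)

lemma embeds_cycle_iff:
  "embeds f (cycle_graph k) G \<longleftrightarrow> inj_on f {..<k} \<and> f ` {..<k} \<subseteq> verts G \<and>
     (\<forall>i<k. \<forall>j<k. {f i, f j} \<in> edges G \<longleftrightarrow> consecutive k i j)"
  by (auto simp: embeds_def edges_cycle_graph_iff)

lemma deletion_saturated_iff:
  "deletion_saturated H G \<longleftrightarrow> simple_graph G \<and> (\<nexists>f. embeds f H G) \<and> edges G \<noteq> {} \<and>
     (\<forall>e\<in>edges G. \<exists>f. embeds f H (delete_edge G e))"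
  using not_free_iff_embeds unfolding deletion_saturated_def by blast

lemma simple_graph_edgeD:
  assumes "simple_graph G" "{x, y} \<in> edges G"
  shows "x \<in> verts G" "y \<in> verts G" "x \<noteq> y"
  using assms by (auto simp: simple_graph_def card_insert_if)

lemma simple_graph_edgeE:
  assumes "simple_graph G" "e \<in> edges G"
  obtains x y where "e = {x, y}" "x \<noteq> y" "x \<in> verts G" "y \<in> verts G"
  using assms unfolding simple_graph_def by (metis card_2_iff insert_subset)

lemma verts_delete_edge [simp]: "verts (delete_edge G e) = verts G"
  and edges_delete_edge [simp]: "edges (delete_edge G e) = edges G - {e}"
  by (simp_all add: delete_edge_def)

text \<open>A bijection between the vertices and an initial segment of the natural numbers carries a
  saturated graph over any vertex type to a saturated graph over \<open>nat\<close>.\<close>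
lemma deletion_normal_of_saturated:
  fixes G :: "'b graph"
  assumes sat: "deletion_saturated H G"
  shows "deletion_normal H"
proof -
  have G: "simple_graph G" using sat by (simp add: deletion_saturated_iff)
  then have "finite (verts G)" by (simp add: simple_graph_def)
  then obtain h :: "'b \<Rightarrow> nat" where h: "inj_on h (verts G)"
    using finite_imp_inj_to_nat_seg by metis
  define G' where "G' = \<lparr>verts = h ` verts G, edges = (`) h ` edges G\<rparr>"
  have sub: "e \<subseteq> verts G" if "e \<in> edges G" for e using that G by (simp add: simple_graph_def)
  have img: "h ` A \<in> (`) h ` E \<longleftrightarrow> A \<in> E" if "A \<subseteq> verts G" "E \<subseteq> edges G" for A E
    using that sub h by (auto simp: image_iff inj_on_image_eq_iff)
  have iso: "embeds h \<lparr>verts = verts G, edges = E\<rparr> \<lparr>verts = h ` verts G, edges = (`) h ` E\<rparr>"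
    if "E \<subseteq> edges G" for E
    unfolding embeds_def using h img[OF _ that, of "{_, _}"] by auto
  have iso': "embeds (inv_into (verts G) h) \<lparr>verts = h ` verts G, edges = (`) h ` E\<rparr> \<lparr>verts = verts G, edges = E\<rparr>"
    if "E \<subseteq> edges G" for E
    unfolding embeds_def using h img[OF _ that, of "{_, _}"]
    by (auto simp: inj_on_inv_into)
  have "simple_graph G'"
    using G h by (auto simp: simple_graph_def G'_def card_image inj_on_subset)
  moreover have "\<nexists>f. embeds f H G'"
  proof
    assume "\<exists>f. embeds f H G'"
    then obtain f where f: "embeds f H G'" ..
    have "embeds (inv_into (verts G) h \<circ> f) H G"
      using embeds_trans[OF f[unfolded G'_def] iso'] by (cases G) simp
    then show False using sat by (auto simp: deletion_saturated_iff)
  qed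
  moreover have "\<exists>f. embeds f H (delete_edge G' e')" if e': "e' \<in> edges G'" for e'
  proof -
    obtain e where e: "e \<in> edges G" "e' = h ` e" using e' by (auto simp: G'_def)
    obtain f where f: "embeds f H (delete_edge G e)" using sat e by (auto simp: deletion_saturated_iff)
    have "(`) h ` edges G - {e'} = (`) h ` (edges G - {e})"
      using e sub h by (auto simp: inj_on_image_eq_iff)
    then have "delete_edge G' e' = \<lparr>verts = h ` verts G, edges = (`) h ` (edges G - {e})\<rparr>"
      by (simp add: delete_edge_def G'_def)
    then show ?thesis
      using embeds_trans[OF f[unfolded delete_edge_def] iso[of "edges G - {e}"]] by auto
  qed
  moreover have "edges G' \<noteq> {}" using sat by (simp add: G'_def deletion_saturated_iff)
  ultimately have "deletion_saturated H G'" by (auto simp: deletion_saturated_iff)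
  then show ?thesis by (auto simp: deletion_normal_def)
qed

section \<open>Graphs with exactly one cycle\<close>

locale unicyclic =
  fixes H :: "'a graph" and C :: "'a graph"
  assumes simple: "simple_graph H"
    and sub: "subgraph C H" and cyc: "is_cycle C"
    and uniq: "\<And>D. subgraph D H \<Longrightarrow> is_cycle D \<Longrightarrow> D = C"
begin

lemma finite_verts: "finite (verts H)"
  using simple by (simp add: simple_graph_def)

text \<open>The indices trace a cycle of \<open>H\<close> as a subgraph, chords being allowed, and \<open>C\<close> is the only
  such cycle. Every contradiction below comes from a cycle with a vertex set other than that of
  \<open>C\<close>.\<close>
lemma cycle_verts_fun:
  assumes inj: "inj_on x {..<m}" and m: "3 \<le> m"
    and edge: "\<And>i. i < m \<Longrightarrow> {x i, x (Suc i mod m)} \<in> edges H"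
  shows "x ` {..<m} = verts C"
proof -
  define D where "D = \<lparr>verts = x ` {..<m}, edges = {{x i, x (Suc i mod m)} | i. i < m}\<rparr>"
  have "edges (cycle_graph m) = (\<lambda>i. {i, Suc i mod m}) ` {..<m}"
    by (auto simp: cycle_graph_def)
  then have D_edges: "edges D = (`) x ` edges (cycle_graph m)"
    by (auto simp: D_def image_image)
  have sub_cyc: "e \<subseteq> {..<m}" if "e \<in> edges (cycle_graph m)" for e
    using that m by (auto simp: cycle_graph_def)
  have "embeds x (cycle_graph m) D"
    unfolding embeds_def
  proof (intro conjI ballI)
    fix u v assume uv: "u \<in> verts (cycle_graph m)" "v \<in> verts (cycle_graph m)"
    have "{x u, x v} = x ` {u, v}" by simp
    then show "{u, v} \<in> edges (cycle_graph m) \<longleftrightarrow> {x u, x v} \<in> edges D"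
      unfolding D_edges using inj_on_image_eq_iff[OF inj, of "{u, v}"] sub_cyc uv
      by (auto simp: image_iff)
  qed (use inj in \<open>auto simp: D_def\<close>)
  moreover define y where "y = inv_into {..<m} x"
  ultimately have "isomorphic D (cycle_graph m)"
    unfolding isomorphic_def using inj
    by (intro exI[of _ y])
      (auto simp: embeds_def D_def y_def intro!: inj_on_imp_bij_betw bij_betw_inv_into)
  then have "is_cycle D" using m by (auto simp: is_cycle_def)
  moreover have "x ` {..<m} \<subseteq> verts H"
    using simple_graph_edgeD(1)[OF simple edge] by auto
  then have "subgraph D H"
    using simple edge m by (auto simp: subgraph_def D_def simple_graph_def)
  ultimately have "D = C" using uniq by blast
  then show ?thesis by (auto simp: D_def)
qed

lemma cycle_verts:
  assumes "distinct xs" "3 \<le> length xs" "successively (\<lambda>u v. {u, v} \<in> edges H) xs"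
    and "{last xs, hd xs} \<in> edges H"
  shows "set xs = verts C"
proof -
  have "{xs ! i, xs ! (Suc i mod length xs)} \<in> edges H" if "i < length xs" for i
  proof (cases "Suc i = length xs")
    case True
    then show ?thesis using assms by (metis One_nat_def diff_Suc_Suc diff_zero hd_conv_nth
      last_conv_nth length_0_conv mod_self nat.simps(3))
  next
    case False
    then show ?thesis using assms(3) that by (simp add: successively_conv_nth)
  qed
  moreover have "inj_on ((!) xs) {..<length xs}" using assms(1) by (simp add: inj_on_nth)
  ultimately have "(!) xs ` {..<length xs} = verts C"
    using assms(2) by (intro cycle_verts_fun)
  then show ?thesis by (auto simp: set_conv_nth)
qed

text \<open>A chord \<open>{c i, c j}\<close> would form a cycle with the arc from \<open>c i\<close> to \<open>c j\<close>. That cycle has to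
  contain all vertices of \<open>C\<close>, so the arc is all of \<open>C\<close> and the chord is one of its edges.\<close>
lemma obtain_cycle:
  obtains k c where "3 \<le> k" "embeds c (cycle_graph k) H" "c ` {..<k} = verts C"
proof -
  obtain n g where n: "3 \<le> n" and g: "bij_betw g (verts C) {..<n}"
    and ge: "\<And>u v. u \<in> verts C \<Longrightarrow> v \<in> verts C \<Longrightarrow>
        {u, v} \<in> edges C \<longleftrightarrow> {g u, g v} \<in> edges (cycle_graph n)"
    using cyc by (auto simp: is_cycle_def isomorphic_def)
  define c where "c = inv_into (verts C) g"
  have c: "bij_betw c {..<n} (verts C)" unfolding c_def using g by (rule bij_betw_inv_into)
  then have inj: "inj_on c {..<n}" and im: "c ` {..<n} = verts C" by (auto simp: bij_betw_def)
  have gc: "g (c i) = i" if "i < n" for i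
    unfolding c_def using bij_betw_inv_into_right[OF g] that by auto
  have cE: "{c i, c j} \<in> edges C \<longleftrightarrow> consecutive n i j" if "i < n" "j < n" for i j
    using ge[of "c i" "c j"] im that gc by (auto simp: edges_cycle_graph_iff)
  have EC: "edges C \<subseteq> edges H" and VC: "verts C \<subseteq> verts H" using sub by (auto simp: subgraph_def)
  have chord: "consecutive n i j" if "i < j" "j < n" "{c i, c j} \<in> edges H" for i j
  proof (rule ccontr)
    assume non: "\<not> consecutive n i j"
    let ?xs = "map c [i..<Suc j]"
    have "j \<noteq> Suc i" using non that by (auto simp: consecutive_def)
    then have len: "3 \<le> length ?xs" using that by simp
    have "inj_on c {i..<Suc j}" using that by (intro inj_on_subset[OF inj]) auto
    then have "distinct ?xs" by (simp add: distinct_map del: upt_Suc)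
    moreover have "successively (\<lambda>u v. {u, v} \<in> edges H) ?xs"
      unfolding successively_conv_nth using that EC cE
      by (auto simp: consecutive_def simp del: upt_Suc)
    moreover have "{last ?xs, hd ?xs} \<in> edges H"
      using that by (simp add: last_map hd_map insert_commute del: upt_Suc)
    ultimately have "set ?xs = verts C" using len by (intro cycle_verts)
    then have "c ` {i..j} = c ` {..<n}" using im by (simp add: atLeastLessThanSuc_atLeastAtMost del: upt_Suc)
    then have "{i..j} = {..<n}" using inj that
      by (subst (asm) inj_on_image_eq_iff[OF inj]) auto
    then have "card {i..j} = n" by simp
    then have "i = 0" "Suc j = n" using that by auto
    then show False using non n by (auto simp: consecutive_def)
  qed
  have "{c i, c j} \<in> edges H \<longleftrightarrow> consecutive n i j" if "i < n" "j < n" for i j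
  proof
    assume e: "{c i, c j} \<in> edges H"
    have "c i \<noteq> c j" using simple_graph_edgeD[OF simple e] by simp
    then consider "i < j" | "j < i" by fastforce
    then show "consecutive n i j"
      using chord[of i j] chord[of j i] e that by cases (auto simp: insert_commute consecutive_def)
  next
    assume "consecutive n i j"
    then show "{c i, c j} \<in> edges H" using cE that EC by blast
  qed
  then have "embeds c (cycle_graph n) H"
    using inj im VC by (auto simp: embeds_cycle_iff)
  then show ?thesis using that n im by blast
qed

text \<open>Consider a longest path \<open>p\<close> in \<open>W\<close> outside the cycle. A neighbour in \<open>W\<close> of an end of \<open>p\<close> is
  the next vertex of \<open>p\<close> or lies on \<open>C\<close>: otherwise the path could be prolonged, or a part of it
  would close to a cycle that avoids \<open>C\<close>. If all vertices of \<open>W\<close> outside \<open>C\<close> had two neighbours in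
  \<open>W\<close>, both ends of \<open>p\<close> would have neighbours on \<open>C\<close>, and \<open>p\<close> together with an arc of \<open>C\<close> would be
  a second cycle.\<close>
lemma leaf_exists:
  assumes W: "W \<subseteq> verts H" and CW: "verts C \<subseteq> W" "W \<noteq> verts C"
  obtains w where "w \<in> W - verts C" "\<And>u v. u \<in> W \<Longrightarrow> v \<in> W \<Longrightarrow>
    {u, w} \<in> edges H \<Longrightarrow> {v, w} \<in> edges H \<Longrightarrow> u = v"
proof (rule ccontr)
  assume "\<not> thesis"
  with that have two: "\<exists>u\<in>W. \<exists>v\<in>W. {u, w} \<in> edges H \<and> {v, w} \<in> edges H \<and> u \<noteq> v"
    if "w \<in> W - verts C" for w using that by blast
  let ?E = "\<lambda>u v. {u, v} \<in> edges H"
  let ?U = "W - verts C"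
  have symE: "?E u v \<longleftrightarrow> ?E v u" for u v by (simp add: insert_commute)
  define paths where "paths = {p. p \<noteq> [] \<and> distinct p \<and> set p \<subseteq> ?U \<and> successively ?E p}"
  have finU: "finite ?U" using W finite_verts finite_subset by blast
  obtain w where "w \<in> ?U" using CW by blast
  then have "[w] \<in> paths" by (simp add: paths_def)
  moreover have "length p \<le> card ?U" if "p \<in> paths" for p
    using that finU by (auto simp: paths_def distinct_card[symmetric] intro: card_mono)
  ultimately obtain p where p: "p \<in> paths" and max: "\<And>q. q \<in> paths \<Longrightarrow> length q \<le> length p"
    using ex_has_greatest_nat[of "\<lambda>p. p \<in> paths" "[w]" length "Suc (card ?U)"]
    by (auto simp: less_Suc_eq_le)
  \<comment> \<open>Both ends of a path are treated by one argument, applied to the path and to its reversal.\<close>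
  have rev: "rev q \<in> paths" if "q \<in> paths" for q
    using that symE by (auto simp: paths_def successively_rev)
  have end_nbr: "u \<in> verts C \<or> (length q \<ge> 2 \<and> u = q ! (length q - 2))"
    if q: "q \<in> paths" and mq: "length q = length p" and u: "u \<in> W" "?E u (last q)" for q u
  proof (rule ccontr)
    assume neg: "\<not> ?thesis"
    have qn: "q \<noteq> []" "distinct q" "successively ?E q" "set q \<subseteq> ?U" using q by (auto simp: paths_def)
    have "u \<in> set q"
    proof (rule ccontr)
      assume "u \<notin> set q"
      then have "q @ [u] \<in> paths" using qn neg u symE
        by (auto simp: paths_def successively_append_iff)
      then show False using max mq by fastforce
    qed
    then obtain t where t: "t < length q" "u = q ! t" by (auto simp: in_set_conv_nth)
    have "u \<noteq> last q" using simple_graph_edgeD[OF simple u(2)] by simp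
    then have "t \<noteq> length q - 1" using t qn by (auto simp: last_conv_nth)
    moreover have "t \<noteq> length q - 2" using neg t calculation by fastforce
    ultimately have t3: "t + 3 \<le> length q" using t by linarith
    let ?r = "drop t q"
    have "successively ?E ?r" using qn(3) by (metis append_take_drop_id successively_append_iff)
    moreover have "last ?r = last q" using t by simp
    moreover have "hd ?r = u" using t by (simp add: hd_drop_conv_nth)
    ultimately have "set ?r = verts C"
      using qn t3 u symE by (intro cycle_verts) auto
    moreover have "set ?r \<subseteq> ?U" using qn set_drop_subset by fastforce
    moreover have "?r \<noteq> []" using t by simp
    ultimately show False by (metis Diff_iff last_in_set subsetD)
  qed
  have pn: "p \<noteq> []" "distinct p" "successively ?E p" "set p \<subseteq> ?U" using p by (auto simp: paths_def)
  have endC: "\<exists>a\<in>verts C. ?E a (last q)" if "q \<in> paths" "length q = length p" for q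
  proof -
    have "last q \<in> set q" "set q \<subseteq> ?U" using that by (auto simp: paths_def)
    then have "last q \<in> ?U" by blast
    then obtain u v where "u \<in> W" "v \<in> W" "?E u (last q)" "?E v (last q)" "u \<noteq> v"
      using two by blast
    then show ?thesis using end_nbr[OF that] by blast
  qed
  \<comment> \<open>For a path with a single vertex, its two ends are the same, and two distinct
    neighbours on \<open>C\<close> are needed to obtain a cycle of length at least 3.\<close>
  obtain a b where ab: "a \<in> verts C" "b \<in> verts C" "?E a (last p)" "?E b (hd p)"
    and ne: "a \<noteq> b \<or> 2 \<le> length p"
  proof (cases "2 \<le> length p")
    case True
    then show ?thesis using that endC[OF p] endC[OF rev[OF p]] by (auto simp: last_rev)
  next
    case False
    moreover have "length p > 0" using pn by simp
    ultimately have "length p = 1" by linarith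
    then have hl: "hd p = last p" using pn by (cases p) auto
    have "last p \<in> set p" using pn by simp
    then have "last p \<in> ?U" using pn by blast
    then obtain u v where "u \<in> W" "v \<in> W" "?E u (last p)" "?E v (last p)" "u \<noteq> v"
      using two by blast
    then have "u \<in> verts C" "v \<in> verts C" using end_nbr[OF p refl] False by blast+
    then show ?thesis
      using that[of u v] hl \<open>u \<noteq> v\<close> \<open>{u, last p} \<in> edges H\<close> \<open>{v, last p} \<in> edges H\<close> by simp
  qed
  have close: False if "arc \<noteq> []" "distinct arc" "set arc \<subseteq> verts C" "successively ?E arc"
     "?E (last q) (hd arc)" "?E (last arc) (hd q)" "3 \<le> length q + length arc" "q \<in> paths" for arc q
  proof -
    have "set (q @ arc) = verts C"
      using that symE by (intro cycle_verts) (auto simp: paths_def successively_append_iff)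
    then show False using that by (auto simp: paths_def dest: hd_in_set)
  qed
  obtain k c where k: "3 \<le> k" and c: "embeds c (cycle_graph k) H" "c ` {..<k} = verts C"
    by (rule obtain_cycle)
  have arc: "distinct (map c [i..<Suc j])" "set (map c [i..<Suc j]) \<subseteq> verts C"
    "successively ?E (map c [i..<Suc j])" "hd (map c [i..<Suc j]) = c i" "last (map c [i..<Suc j]) = c j"
    if "i \<le> j" "j < k" for i j
  proof -
    have inj: "inj_on c {..<k}" using c by (simp add: embeds_def)
    have "inj_on c {i..<Suc j}" using that by (intro inj_on_subset[OF inj]) auto
    then show "distinct (map c [i..<Suc j])" by (simp add: distinct_map del: upt_Suc)
    show "set (map c [i..<Suc j]) \<subseteq> verts C" using that c by auto
    show "successively ?E (map c [i..<Suc j])"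
      unfolding successively_conv_nth using that c(1)
      by (auto simp: consecutive_def embeds_cycle_iff simp del: upt_Suc)
  qed (use that in \<open>auto simp: hd_map hd_append\<close>)
  obtain i j where ij: "i < k" "j < k" "a = c i" "b = c j" using ab c by (metis imageE lessThan_iff)
  have lp: "length p \<ge> 1" using pn by (cases p) auto
  consider "i < j" | "j < i" | "i = j" by linarith
  then show False
  proof cases
    case 1
    then have "3 \<le> length p + length (map c [i..<Suc j])" using lp 1 by simp
    then show False using 1 close[of "map c [i..<Suc j]" p] arc[of i j] ab ij p lp symE
      by (simp del: upt_Suc)
  next
    case 2
    then have "3 \<le> length (rev p) + length (map c [j..<Suc i])" using lp 2 by simp
    then show False using 2 close[of "map c [j..<Suc i]" "rev p"] arc[of j i] ab ij rev[OF p] lp symE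
      by (simp add: hd_rev last_rev del: upt_Suc)
  next
    case 3
    then show False using close[of "[a]" p] ab ij p ne symE by simp
  qed
qed

end

section \<open>Growing trees on an induced cycle\<close>

text \<open>Applied with \<open>A\<close> the image of a partial embedding apart from \<open>p\<close>, this allows one to attach
  a pendant vertex at \<open>p\<close>.\<close>
definition extendable :: "nat \<Rightarrow> 'a graph \<Rightarrow> bool" where
  "extendable N G \<longleftrightarrow> (\<forall>p\<in>verts G. \<forall>A. finite A \<longrightarrow> card A \<le> N \<longrightarrow> p \<notin> A \<longrightarrow>
     (\<exists>y\<in>verts G. y \<notin> A \<and> {p, y} \<in> edges G \<and> (\<forall>a\<in>A. {a, y} \<notin> edges G)))"

lemma embeds_extend:
  assumes G: "simple_graph G" and H: "simple_graph H" and w: "w \<notin> W"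
    and \<phi>: "inj_on \<phi> W" "\<phi> ` W \<subseteq> verts G"
    and \<phi>E: "\<And>u v. u \<in> W \<Longrightarrow> v \<in> W \<Longrightarrow> {u, v} \<in> edges H \<longleftrightarrow> {\<phi> u, \<phi> v} \<in> edges G"
    and y: "y \<in> verts G" "y \<notin> \<phi> ` W"
    and yE: "\<And>u. u \<in> W \<Longrightarrow> {u, w} \<in> edges H \<longleftrightarrow> {\<phi> u, y} \<in> edges G"
  shows "inj_on (\<phi>(w := y)) (insert w W)" "(\<phi>(w := y)) ` insert w W \<subseteq> verts G"
    "\<And>u v. u \<in> insert w W \<Longrightarrow> v \<in> insert w W \<Longrightarrow>
       {u, v} \<in> edges H \<longleftrightarrow> {(\<phi>(w := y)) u, (\<phi>(w := y)) v} \<in> edges G"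
proof -
  show "inj_on (\<phi>(w := y)) (insert w W)"
    using \<phi> y w by (auto simp: inj_on_def)
  show "(\<phi>(w := y)) ` insert w W \<subseteq> verts G"
    using \<phi> y w by auto
  have loop: "{y, y} \<notin> edges G" "{w, w} \<notin> edges H"
    using simple_graph_edgeD(3)[OF G] simple_graph_edgeD(3)[OF H] by blast+
  fix u v assume "u \<in> insert w W" "v \<in> insert w W"
  then show "{u, v} \<in> edges H \<longleftrightarrow> {(\<phi>(w := y)) u, (\<phi>(w := y)) v} \<in> edges G"
    using \<phi>E[of u v] yE[of u] yE[of v] w loop by (auto simp: insert_commute)
qed

text \<open>Induction on the number of vertices already embedded, using \<open>leaf_exists\<close>. The two ends of
  \<open>e\<close> are put into the forbidden set as well, which explains the bound \<open>card (verts H) + 2\<close>: new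
  vertices avoid \<open>e\<close>, so that their edges are the same in \<open>G\<close> as in \<open>G\<close> without \<open>e\<close>.\<close>
lemma (in unicyclic) embeds_from_cycle:
  assumes G: "simple_graph G" and e: "e \<in> edges G"
    and c: "embeds c (cycle_graph k) H" "c ` {..<k} = verts C"
    and f: "embeds f (cycle_graph k) (delete_edge G e)"
    and ext: "extendable (card (verts H) + 2) G"
  shows "\<exists>\<phi>. embeds \<phi> H (delete_edge G e)"
proof -
  let ?G = "delete_edge G e"
  have G': "simple_graph ?G" using G by (simp add: simple_graph_def)
  have e2: "e \<subseteq> verts G" "card e = 2" using G e by (auto simp: simple_graph_def)
  have fin_e: "finite e" using e2(2) by (auto intro: card_ge_0_finite)
  have "\<exists>\<phi>. inj_on \<phi> W \<and> \<phi> ` W \<subseteq> verts ?G \<and>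
      (\<forall>u\<in>W. \<forall>v\<in>W. {u, v} \<in> edges H \<longleftrightarrow> {\<phi> u, \<phi> v} \<in> edges ?G)"
    if "verts C \<subseteq> W" "W \<subseteq> verts H" for W
    using that
  proof (induction "card W" arbitrary: W rule: less_induct)
    case less
    show ?case
    proof (cases "W = verts C")
      case True
      define c' where "c' = inv_into {..<k} c"
      have inj: "inj_on c {..<k}" using c by (simp add: embeds_def)
      have cc: "c' (c i) = i" if "i < k" for i
        using inj that by (simp add: c'_def)
      have W: "W = c ` {..<k}" using True c by simp
      have injf: "inj_on f {..<k}" and imf: "f ` {..<k} \<subseteq> verts ?G" using f by (simp_all add: embeds_def)
      have inj': "inj_on (f \<circ> c') W"
        unfolding W using injf cc by (auto simp: inj_on_def)
      have im': "(f \<circ> c') ` W \<subseteq> verts ?G"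
        unfolding W using imf cc by (auto simp: image_subset_iff)
      have "{u, v} \<in> edges H \<longleftrightarrow> {(f \<circ> c') u, (f \<circ> c') v} \<in> edges ?G" if "u \<in> W" "v \<in> W" for u v
      proof -
        obtain i j where ij: "i < k" "j < k" "u = c i" "v = c j"
          using \<open>u \<in> W\<close> \<open>v \<in> W\<close> W by blast
        have "{c i, c j} \<in> edges H \<longleftrightarrow> {f i, f j} \<in> edges ?G"
          using c(1) f ij unfolding embeds_cycle_iff by blast
        then show ?thesis using ij cc by simp
      qed
      then show ?thesis using inj' im' by blast
    next
      case False
      obtain w where w: "w \<in> W - verts C"
        and leaf: "\<And>u v. u \<in> W \<Longrightarrow> v \<in> W \<Longrightarrow> {u, w} \<in> edges H \<Longrightarrow> {v, w} \<in> edges H \<Longrightarrow> u = v"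
        by (rule leaf_exists[OF less.prems(2,1) False]) (rule that)
      let ?W = "W - {w}"
      have finW: "finite W" using less.prems finite_verts finite_subset by blast
      have smaller: "card ?W < card W" using w finW by (intro psubset_card_mono) auto
      have W': "verts C \<subseteq> ?W" "?W \<subseteq> verts H" using less.prems w by blast+
      obtain \<phi> where \<phi>: "inj_on \<phi> ?W" "\<phi> ` ?W \<subseteq> verts ?G"
        and \<phi>E: "\<And>u v. u \<in> ?W \<Longrightarrow> v \<in> ?W \<Longrightarrow> {u, v} \<in> edges H \<longleftrightarrow> {\<phi> u, \<phi> v} \<in> edges ?G"
        using less.hyps[OF smaller W'] by (elim exE conjE) (rule that, auto)
      let ?A = "\<phi> ` ?W \<union> e"
      have finA: "finite ?A" using finW fin_e by simp
      have "card (\<phi> ` ?W) \<le> card ?W" using finW by (intro card_image_le) simp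
      moreover have "card ?W \<le> card (verts H)" using less.prems by (intro card_mono finite_verts) blast
      ultimately have cardA: "card ?A \<le> card (verts H) + 2"
        using card_Un_le[of "\<phi> ` ?W" e] e2 by linarith
      have ext': "\<exists>y\<in>verts G. y \<notin> ?A - {p} \<and> {p, y} \<in> edges G \<and> (\<forall>a\<in>?A - {p}. {a, y} \<notin> edges G)"
        if "p \<in> verts G" for p
      proof -
        have "card (?A - {p}) \<le> card (verts H) + 2"
          using cardA card_mono[OF finA, of "?A - {p}"] by (meson Diff_subset order_trans)
        then show ?thesis
          using that finA by (intro ext[unfolded extendable_def, rule_format]) auto
      qed
      have "\<exists>y\<in>verts G. y \<notin> \<phi> ` ?W \<and> (\<forall>u\<in>?W. {u, w} \<in> edges H \<longleftrightarrow> {\<phi> u, y} \<in> edges ?G)"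
      proof (cases "\<exists>u\<in>?W. {u, w} \<in> edges H")
        case True
        then obtain u where u: "u \<in> ?W" "{u, w} \<in> edges H" by blast
        then have pu: "\<phi> u \<in> verts G" using \<phi> by auto
        obtain y where y: "y \<in> verts G" "y \<notin> ?A - {\<phi> u}" "{\<phi> u, y} \<in> edges G"
          "\<And>a. a \<in> ?A - {\<phi> u} \<Longrightarrow> {a, y} \<notin> edges G"
          using ext'[OF pu] by blast
        have "y \<noteq> \<phi> u" using simple_graph_edgeD(3)[OF G y(3)] by simp
        then have "y \<notin> ?A" using y by blast
        moreover have "{v, w} \<in> edges H \<longleftrightarrow> {\<phi> v, y} \<in> edges ?G" if "v \<in> ?W" for v
        proof (cases "v = u")
          case True
          then show ?thesis using u y calculation by auto
        next
          case False
          then have "{v, w} \<notin> edges H" using leaf u that by blast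
          moreover have "\<phi> v \<noteq> \<phi> u" using False that u \<phi> by (auto simp: inj_on_def)
          ultimately show ?thesis using y(4)[of "\<phi> v"] that by auto
        qed
        ultimately show ?thesis using y by blast
      next
        case False
        \<comment> \<open>Here \<open>w\<close> starts a new component. A vertex far from the image is found in two steps:
          the first one leaves the image, and the second one then avoids all neighbours of the image.\<close>
        obtain q where q: "q \<in> verts G" using e2 by fastforce
        obtain y1 where y1: "y1 \<in> verts G" "y1 \<notin> ?A - {q}" "{q, y1} \<in> edges G"
          using ext'[OF q] by blast
        obtain y where y: "y \<in> verts G" "y \<notin> ?A - {y1}" "{y1, y} \<in> edges G"
          "\<And>a. a \<in> ?A - {y1} \<Longrightarrow> {a, y} \<notin> edges G"
          using ext'[OF y1(1)] by blast
        have "y1 \<noteq> q" using simple_graph_edgeD(3)[OF G y1(3)] by simp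
        then have "y1 \<notin> ?A" using y1 by blast
        moreover have "y \<noteq> y1" using simple_graph_edgeD(3)[OF G y(3)] by simp
        ultimately have "y \<notin> ?A" "\<And>a. a \<in> ?A \<Longrightarrow> {a, y} \<notin> edges G" using y by blast+
        then show ?thesis using y(1) False by auto
      qed
      then obtain y where y: "y \<in> verts ?G" "y \<notin> \<phi> ` ?W"
        "\<And>u. u \<in> ?W \<Longrightarrow> {u, w} \<in> edges H \<longleftrightarrow> {\<phi> u, y} \<in> edges ?G" by auto
      have ins: "insert w ?W = W" and "w \<notin> ?W" using w by blast+
      have new: "inj_on (\<phi>(w := y)) (insert w ?W)" "(\<phi>(w := y)) ` insert w ?W \<subseteq> verts ?G"
        "\<And>u v. u \<in> insert w ?W \<Longrightarrow> v \<in> insert w ?W \<Longrightarrow>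
           {u, v} \<in> edges H \<longleftrightarrow> {(\<phi>(w := y)) u, (\<phi>(w := y)) v} \<in> edges ?G"
        by (rule embeds_extend[OF G' simple \<open>w \<notin> ?W\<close> \<phi> \<phi>E y]; assumption)+
      show ?thesis
        by (intro exI[of _ "\<phi>(w := y)"] conjI ballI) (use new[unfolded ins] in blast)+
    qed
  qed
  from this[of "verts H"] show ?thesis
    using sub by (auto simp: embeds_def subgraph_def)
qed

lemma (in unicyclic) deletion_saturated_of_extendable:
  assumes c: "embeds c (cycle_graph k) H" "c ` {..<k} = verts C"
    and sat: "deletion_saturated (cycle_graph k) G"
    and ext: "extendable (card (verts H) + 2) G"
  shows "deletion_saturated H G"
proof -
  have "\<nexists>f. embeds f H G"
    using embeds_trans[OF c(1)] sat by (auto simp: deletion_saturated_iff)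
  then show ?thesis
    using embeds_from_cycle[OF _ _ c _ ext] sat by (auto simp: deletion_saturated_iff)
qed

section \<open>Involutions without short relations\<close>

fun reduced :: "'i list \<Rightarrow> bool" where
  "reduced (i # j # w) \<longleftrightarrow> i \<noteq> j \<and> reduced (j # w)"
| "reduced _ \<longleftrightarrow> True"

lemma reduced_ConsD: "reduced (i # w) \<Longrightarrow> reduced w"
  by (cases w) auto

lemma reduced_Cons_iff: "reduced (i # w) \<longleftrightarrow> reduced w \<and> (w = [] \<or> hd w \<noteq> i)"
  by (cases w) auto

text \<open>This is Biggs's construction of graphs of large girth. The letter \<open>i\<close> acts on reduced words
  of length at most \<open>L\<close> by the involution that removes \<open>i\<close> from the front if it stands there, and
  otherwise puts it there if there is room. A short nonempty reduced word sends the empty word to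
  itself, read as a list of letters, and so moves it. Other words may be fixed; but when the
  letters act by composition on the permutations of the set of words, each permutation attains the
  empty word somewhere, so that no permutation is fixed.\<close>
lemma large_girth_action:
  fixes I :: "'i set"
  assumes "finite I"
  obtains X :: "('i list \<Rightarrow> 'i list) set" and t where
    "finite X" "X \<noteq> {}" "\<And>i x. i \<in> I \<Longrightarrow> x \<in> X \<Longrightarrow> t i x \<in> X" "\<And>i x. i \<in> I \<Longrightarrow> x \<in> X \<Longrightarrow> t i (t i x) = x"
    "\<And>w x. reduced w \<Longrightarrow> set w \<subseteq> I \<Longrightarrow> w \<noteq> [] \<Longrightarrow> length w \<le> L \<Longrightarrow> x \<in> X \<Longrightarrow> foldr t w x \<noteq> x"
proof -
  define Y :: "'i list set" where "Y = {w. set w \<subseteq> I \<and> length w \<le> L \<and> reduced w}"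
  have finY: "finite Y" unfolding Y_def
    by (rule finite_subset[OF _ finite_lists_length_le[OF assms, of L]]) auto
  define \<tau> where "\<tau> i w = (if w \<notin> Y then w else if w \<noteq> [] \<and> hd w = i then tl w
      else if length w < L then i # w else w)" for i and w :: "'i list"
  have tauY: "\<tau> i w \<in> Y" if "i \<in> I" "w \<in> Y" for i w
    using that by (cases w) (auto simp: \<tau>_def Y_def reduced_Cons_iff)
  have tau2: "\<tau> i (\<tau> i w) = w" if "i \<in> I" for i w
  proof (cases "w \<in> Y")
    case True
    then show ?thesis using tauY[OF that True] that
      by (cases w) (auto simp: \<tau>_def Y_def reduced_Cons_iff split: if_splits)
  qed (simp add: \<tau>_def)
  have perm: "\<tau> i permutes Y" if "i \<in> I" for i
    unfolding permutes_def
  proof (intro conjI allI impI)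
    show "\<tau> i w = w" if "w \<notin> Y" for w using that by (simp add: \<tau>_def)
    show "\<exists>!w. \<tau> i w = v" for v
      by (rule ex1I[of _ "\<tau> i v"]) (use tau2[OF \<open>i \<in> I\<close>] in auto)
  qed
  define t where "t i x = \<tau> i \<circ> x" for i and x :: "'i list \<Rightarrow> 'i list"
  define X where "X = {x. x permutes Y}"
  have word: "foldr t w x = foldr \<tau> w \<circ> x" for w x
    by (induction w) (auto simp: t_def)
  have grow: "foldr \<tau> w [] = w" if "reduced w" "set w \<subseteq> I" "length w \<le> L" for w
    using that
  proof (induction w)
    case (Cons i w)
    then have IH: "foldr \<tau> w [] = w" using reduced_ConsD[of i w] by auto
    have "\<tau> i w = i # w" using Cons.prems by (auto simp: \<tau>_def Y_def reduced_Cons_iff)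
    then show ?case using IH by simp
  qed simp
  have nofix: "foldr t w x \<noteq> x"
    if "reduced w" "set w \<subseteq> I" "w \<noteq> []" "length w \<le> L" "x \<in> X" for w x
  proof
    assume eq: "foldr t w x = x"
    have "surj x" using \<open>x \<in> X\<close> unfolding X_def by (simp add: permutes_surj)
    then obtain z where "x z = []" by (metis surjD)
    then have "foldr \<tau> w [] = []" using fun_cong[OF eq[unfolded word], of z] by simp
    then show False using grow that by simp
  qed
  show ?thesis
  proof (rule that[of X t])
    show "finite X" unfolding X_def using finY by (rule finite_permutations)
    show "X \<noteq> {}" using permutes_id unfolding X_def by blast
    show "t i x \<in> X" if "i \<in> I" "x \<in> X" for i x
      using that perm by (auto simp: X_def t_def intro: permutes_compose)
    show "t i (t i x) = x" if "i \<in> I" "x \<in> X" for i x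
      using tau2[OF that(1)] by (auto simp: t_def)
  qed (use nofix in blast)
qed

section \<open>Gluing copies of a graph in a tree-like pattern\<close>

text \<open>There is an involution \<open>t (v, c)\<close> for every vertex \<open>v\<close> of \<open>F\<close> and every colour \<open>c\<close> in \<open>Cl\<close>.
  Points are pairs of a vertex of \<open>F\<close> and an element of \<open>X\<close>. For every colour \<open>c\<close> and \<open>b \<in> X\<close>
  there is a block, which consists of the points \<open>(v, t (v, c) b)\<close>, one for each \<open>v\<close>; it carries a
  copy of \<open>F\<close>. So each point lies in exactly one block of each colour.\<close>
locale assembly =
  fixes F :: "'v graph" and Cl :: "nat set" and X :: "'x set"
    and t :: "'v \<times> nat \<Rightarrow> 'x \<Rightarrow> 'x" and L :: nat
  assumes F: "simple_graph F" and finCl: "finite Cl" and finX: "finite X"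
    and tX: "\<And>v c x. v \<in> verts F \<Longrightarrow> c \<in> Cl \<Longrightarrow> x \<in> X \<Longrightarrow> t (v, c) x \<in> X"
    and tt: "\<And>v c x. v \<in> verts F \<Longrightarrow> c \<in> Cl \<Longrightarrow> x \<in> X \<Longrightarrow> t (v, c) (t (v, c) x) = x"
    and nofix: "\<And>w x. reduced w \<Longrightarrow> set w \<subseteq> verts F \<times> Cl \<Longrightarrow> w \<noteq> [] \<Longrightarrow> length w \<le> 2 * L \<Longrightarrow>
      x \<in> X \<Longrightarrow> foldr t w x \<noteq> x"
begin

text \<open>Isolated vertices of \<open>F\<close> are left out, as the extension property needs a neighbour of every
  point.\<close>
definition points :: "('v \<times> 'x) set" where
  "points = \<Union> (edges F) \<times> X"

definition block :: "nat \<Rightarrow> 'v \<times> 'x \<Rightarrow> 'x" where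
  "block c p = t (fst p, c) (snd p)"

definition point :: "nat \<Rightarrow> 'x \<Rightarrow> 'v \<Rightarrow> 'v \<times> 'x" where
  "point c b v = (v, t (v, c) b)"

definition near :: "nat \<Rightarrow> 'v \<times> 'x \<Rightarrow> 'v \<times> 'x \<Rightarrow> bool" where
  "near c p q \<longleftrightarrow> c \<in> Cl \<and> p \<in> points \<and> q \<in> points \<and> p \<noteq> q \<and> block c p = block c q"

definition G :: "('v \<times> 'x) graph" where
  "G = \<lparr>verts = points, edges = {{p, q} | p q c. near c p q \<and> {fst p, fst q} \<in> edges F}\<rparr>"

lemma pointsD: "p \<in> points \<Longrightarrow> fst p \<in> verts F \<and> snd p \<in> X"
  using F by (fastforce simp: points_def simple_graph_def)

lemma block_point: "v \<in> verts F \<Longrightarrow> c \<in> Cl \<Longrightarrow> b \<in> X \<Longrightarrow> block c (point c b v) = b"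
  by (simp add: block_def point_def tt)

lemma point_block: "p \<in> points \<Longrightarrow> c \<in> Cl \<Longrightarrow> point c (block c p) (fst p) = p"
  using pointsD[of p] by (simp add: block_def point_def tt)

lemma near_fst: "near c p q \<Longrightarrow> fst p \<noteq> fst q"
  unfolding near_def using point_block[of p c] point_block[of q c] by metis

lemma near_sym: "near c p q \<longleftrightarrow> near c q p"
  by (auto simp: near_def)

lemma near_trans: "near c p q \<Longrightarrow> near c q r \<Longrightarrow> p \<noteq> r \<Longrightarrow> near c p r"
  by (auto simp: near_def)

text \<open>A path of blocks: consecutive steps stay in blocks of different colours. The last step has
  colour \<open>c\<close>.\<close>
inductive bpath :: "'v \<times> 'x \<Rightarrow> nat \<Rightarrow> 'v \<times> 'x \<Rightarrow> nat \<Rightarrow> bool" for p where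
  one: "near c p q \<Longrightarrow> bpath p c q 1"
| step: "bpath p c q n \<Longrightarrow> near c' q r \<Longrightarrow> c' \<noteq> c \<Longrightarrow> bpath p c' r (Suc n)"

text \<open>A step within a block of colour \<open>c\<close> from \<open>p\<close> to \<open>q\<close> leads from the point \<open>p\<close> to its block by
  the letter \<open>(fst p, c)\<close> and back to a point by \<open>(fst q, c)\<close>. These letters differ in the vertex,
  and letters of successive steps differ in the colour, so the word is reduced. By the choice of
  the action, a short path of blocks therefore never returns to its start.\<close>
lemma bpath_word:
  assumes "bpath p c q n"
  shows "\<exists>w. reduced w \<and> w \<noteq> [] \<and> hd w = (fst q, c) \<and> length w = 2 * n \<and> set w \<subseteq> verts F \<times> Cl \<and>
    snd q = foldr t w (snd p)"
  using assms
proof induction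
  case (one c q)
  have "snd q = t (fst q, c) (t (fst p, c) (snd p))"
    using one pointsD[of q] tt by (auto simp: near_def block_def)
  then show ?case using one near_fst[OF one] pointsD
    by (intro exI[of _ "[(fst q, c), (fst p, c)]"]) (auto simp: near_def)
next
  case (step c q n c' r)
  then obtain w where w: "reduced w" "w \<noteq> []" "hd w = (fst q, c)" "length w = 2 * n"
    "set w \<subseteq> verts F \<times> Cl" "snd q = foldr t w (snd p)" by blast
  have "snd r = t (fst r, c') (t (fst q, c') (snd q))"
    using step pointsD[of r] tt by (auto simp: near_def block_def)
  then show ?case using w step near_fst[OF step.hyps(2)] pointsD
    by (intro exI[of _ "(fst r, c') # (fst q, c') # w"]) (auto simp: near_def reduced_Cons_iff)
qed

lemma bpath_neq:
  assumes "bpath p c q n" "n \<le> L"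
  shows "p \<noteq> q"
proof -
  have "p \<in> points" using assms(1) by induction (auto simp: near_def)
  then show ?thesis
    using bpath_word[OF assms(1)] nofix pointsD[of p] assms(2) by (metis mult_le_mono2)
qed

text \<open>Two blocks share at most one point, as otherwise two steps would lead back to the start.\<close>
lemma near_unique:
  assumes "near c p q" "near c' p q" "2 \<le> L"
  shows "c = c'"
proof (rule ccontr)
  assume "c \<noteq> c'"
  then have "bpath p c' p (Suc 1)"
    using assms by (intro bpath.step[OF bpath.one[OF assms(1)]]) (auto simp: near_sym)
  then show False using bpath_neq assms by fastforce
qed

lemma edge_G_iff: "{p, q} \<in> edges G \<longleftrightarrow> (\<exists>c. near c p q) \<and> {fst p, fst q} \<in> edges F"
proof
  assume "{p, q} \<in> edges G"
  then obtain p' q' c where "{p, q} = {p', q'}" "near c p' q'" "{fst p', fst q'} \<in> edges F"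
    by (auto simp: G_def)
  then show "(\<exists>c. near c p q) \<and> {fst p, fst q} \<in> edges F"
    by (auto simp: doubleton_eq_iff near_sym insert_commute)
next
  assume "(\<exists>c. near c p q) \<and> {fst p, fst q} \<in> edges F"
  then show "{p, q} \<in> edges G" unfolding G_def graph.select_convs by blast
qed

lemma simple_G: "simple_graph G"
proof -
  have "finite (\<Union> (edges F))" using F finite_subset[of "\<Union> (edges F)" "verts F"]
    by (auto simp: simple_graph_def)
  then show ?thesis
    using finX by (auto simp: simple_graph_def G_def points_def near_def)
qed

text \<open>A walk without repeated points splits into maximal runs within single blocks, and
  contracting each run to one step gives a path of blocks. Here \<open>j\<close> is the start of the last run,
  and only what is needed to close the walk is recorded: the whole walk is one run, or a path of
  blocks ends at \<open>f j\<close> with a colour other than that of the last run.\<close>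
lemma walk_last_run:
  assumes "\<And>i. i < m \<Longrightarrow> near (c i) (f i) (f (Suc i))" "inj_on f {..m}" "0 < m"
  shows "\<exists>j<m. (\<forall>i. j \<le> i \<longrightarrow> i \<le> m \<longrightarrow> block (c (m - 1)) (f i) = block (c (m - 1)) (f j)) \<and>
     (j = 0 \<or> (\<exists>c' n. c' \<noteq> c (m - 1) \<and> bpath (f 0) c' (f j) n \<and> n < m))"
  using assms
proof (induction m)
  case (Suc m)
  show ?case
  proof (cases "m = 0")
    case True
    then show ?thesis using Suc.prems(1)[of 0]
      by (auto simp: near_def le_Suc_eq intro!: exI[of _ 0])
  next
    case False
    then have inj: "inj_on f {..m}" using Suc.prems by (auto intro: inj_on_subset)
    have "near (c i) (f i) (f (Suc i))" if "i < m" for i using Suc.prems(1) that by simp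
    from Suc.IH[OF this inj] False
    obtain j where j: "j < m" "\<And>i. j \<le> i \<Longrightarrow> i \<le> m \<Longrightarrow> block (c (m - 1)) (f i) = block (c (m - 1)) (f j)"
      "j = 0 \<or> (\<exists>c' n. c' \<noteq> c (m - 1) \<and> bpath (f 0) c' (f j) n \<and> n < m)"
      by auto
    have last: "near (c m) (f m) (f (Suc m))" using Suc.prems by blast
    show ?thesis
    \<comment> \<open>The new step prolongs the last run if it has the same colour; otherwise that run
      becomes a step of the path of blocks, and a new run starts at \<open>f m\<close>.\<close>
    proof (cases "c m = c (m - 1)")
      case True
      have jm: "block (c m) (f m) = block (c m) (f j)" using j(2)[of m] j(1) True by simp
      have lm: "block (c m) (f (Suc m)) = block (c m) (f m)" using last by (simp add: near_def)
      have B: "\<forall>i. j \<le> i \<longrightarrow> i \<le> Suc m \<longrightarrow> block (c m) (f i) = block (c m) (f j)"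
      proof (intro allI impI)
        fix i assume i: "j \<le> i" "i \<le> Suc m"
        show "block (c m) (f i) = block (c m) (f j)"
        proof (cases "i = Suc m")
          case True
          then show ?thesis using lm jm by simp
        next
          case False
          then have "i \<le> m" using i by simp
          then show ?thesis unfolding \<open>c m = c (m - 1)\<close> by (rule j(2)[OF i(1)])
        qed
      qed
      have C: "j = 0 \<or> (\<exists>c' n. c' \<noteq> c m \<and> bpath (f 0) c' (f j) n \<and> n < Suc m)"
      proof (cases "j = 0")
        case False
        then obtain c' n where "c' \<noteq> c m" "bpath (f 0) c' (f j) n" "n < Suc m"
          using j(3) \<open>c m = c (m - 1)\<close> less_SucI by (elim disjE exE conjE) auto
        then show ?thesis by blast
      qed simp
      have "j < Suc m" using j(1) by simp
      with B C show ?thesis unfolding diff_Suc_1 by (intro exI[of _ j] conjI)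
    next
      case neq: False
      have "f j \<noteq> f m" using inj j(1) by (auto simp: inj_on_def)
      moreover have "near (c (m - 1)) (f (m - 1)) (f m)" using Suc.prems(1)[of "m - 1"] False by simp
      moreover have "f j \<in> points" using Suc.prems(1)[of j] j(1) by (simp add: near_def)
      ultimately have run: "near (c (m - 1)) (f j) (f m)"
        using j(2)[of m] j(1) by (auto simp: near_def)
      have "\<exists>n. bpath (f 0) (c (m - 1)) (f m) n \<and> n < Suc m"
        using j(3)
      proof
        assume "j = 0"
        then have "bpath (f 0) (c (m - 1)) (f m) 1" using bpath.one run by simp
        then show ?thesis using False by (intro exI[of _ 1]) simp
      next
        assume "\<exists>c' n. c' \<noteq> c (m - 1) \<and> bpath (f 0) c' (f j) n \<and> n < m"
        then obtain c' n where "c' \<noteq> c (m - 1)" "bpath (f 0) c' (f j) n" "n < m" by blast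
        then have "bpath (f 0) (c (m - 1)) (f m) (Suc n)" using bpath.step[OF _ run] by simp
        then show ?thesis using \<open>n < m\<close> by (intro exI[of _ "Suc n"]) simp
      qed
      then obtain n where "bpath (f 0) (c (m - 1)) (f m) n" "n < Suc m" by blast
      with neq have C: "m = 0 \<or> (\<exists>c' n. c' \<noteq> c m \<and> bpath (f 0) c' (f m) n \<and> n < Suc m)"
        by (intro disjI2 exI[of _ "c (m - 1)"] exI[of _ n]) simp
      have B: "\<forall>i. m \<le> i \<longrightarrow> i \<le> Suc m \<longrightarrow> block (c m) (f i) = block (c m) (f m)"
        using last by (auto simp: near_def le_Suc_eq)
      show ?thesis unfolding diff_Suc_1 using B C by (intro exI[of _ m] conjI) simp
    qed
  qed
qed simp

text \<open>If a short closed walk had more than one run, then the path of blocks from its start to its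
  last run, followed by this run and the closing edge, would return to the start. The closing edge
  may belong to the block of the last run, in which case both make up a single step.\<close>
lemma closed_walk_in_block:
  assumes near: "\<And>i. i < k \<Longrightarrow> near (c i) (f i) (f (Suc i mod k))" and inj: "inj_on f {..<k}"
    and k: "3 \<le> k" "k \<le> L"
  obtains b d where "d \<in> Cl" "\<And>i. i < k \<Longrightarrow> block d (f i) = b"
proof -
  define m where "m = k - 1"
  have m: "k = Suc m" "0 < m" using k by (auto simp: m_def)
  have inj': "inj_on f {..m}" using inj m by (simp add: lessThan_Suc_atMost)
  have near': "near (c i) (f i) (f (Suc i))" if "i < m" for i
    using near[of i] that m by simp
  let ?d = "c (m - 1)"
  obtain j where j: "j < m" "\<And>i. j \<le> i \<Longrightarrow> i \<le> m \<Longrightarrow> block ?d (f i) = block ?d (f j)"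
    "j = 0 \<or> (\<exists>c' n. c' \<noteq> ?d \<and> bpath (f 0) c' (f j) n \<and> n < m)"
    using walk_last_run[of m c f, OF near' inj' m(2)] by auto
  have close: "near (c m) (f m) (f 0)" using near[of m] m by simp
  have d: "near ?d (f (m - 1)) (f m)" using near'[of "m - 1"] m by simp
  have "f j \<noteq> f m" using inj' j(1) by (auto simp: inj_on_def)
  moreover have fj: "f j \<in> points" using near'[of j] j(1) by (simp add: near_def)
  ultimately have run: "near ?d (f j) (f m)"
    using j(2)[of m] j(1) d by (auto simp: near_def)
  have mL: "m < L" "2 \<le> L" using m k by auto
  have "j = 0"
  proof (rule ccontr)
    assume "j \<noteq> 0"
    then obtain c' n where n: "c' \<noteq> ?d" "bpath (f 0) c' (f j) n" "n < m" using j(3) by blast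
    have "f j \<noteq> f 0" using inj' j(1) \<open>j \<noteq> 0\<close> by (auto simp: inj_on_def)
    show False
    proof (cases "c m = ?d")
      case True
      then have "near ?d (f j) (f 0)" using run close near_trans \<open>f j \<noteq> f 0\<close> by metis
      then have "bpath (f 0) ?d (f 0) (Suc n)" using n bpath.step by metis
      then show False using bpath_neq n mL by fastforce
    next
      case False
      have "bpath (f 0) ?d (f m) (Suc n)" using n run bpath.step by metis
      then have "bpath (f 0) (c m) (f 0) (Suc (Suc n))" using close False bpath.step by metis
      then show False using bpath_neq n mL by fastforce
    qed
  qed
  then have "block ?d (f i) = block ?d (f 0)" if "i < k" for i
    using j(2)[of i] that m by simp
  moreover have "?d \<in> Cl" using d by (simp add: near_def)
  ultimately show ?thesis using that by blast
qed

lemma cycle_in_block: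
  assumes f: "embeds f (cycle_graph k) G" and k: "3 \<le> k" "k \<le> L"
  shows "embeds (fst \<circ> f) (cycle_graph k) F"
proof -
  have f: "inj_on f {..<k}" "f ` {..<k} \<subseteq> points"
    "\<And>i j. i < k \<Longrightarrow> j < k \<Longrightarrow> {f i, f j} \<in> edges G \<longleftrightarrow> consecutive k i j"
    using f by (auto simp: embeds_cycle_iff G_def)
  have "\<exists>c. near c (f i) (f (Suc i mod k))" if "i < k" for i
  proof -
    have "Suc i mod k < k" "consecutive k i (Suc i mod k)" using k by (auto simp: consecutive_def)
    then show ?thesis using f(3)[OF that] by (auto simp: edge_G_iff)
  qed
  then obtain c where "\<And>i. i < k \<Longrightarrow> near (c i) (f i) (f (Suc i mod k))" by metis
  then obtain d b where d: "d \<in> Cl" "\<And>i. i < k \<Longrightarrow> block d (f i) = b"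
    using closed_walk_in_block f(1) k by metis
  have near: "near d (f i) (f j)" if "i < k" "j < k" "i \<noteq> j" for i j
    using that f d by (auto simp: near_def inj_on_def image_subset_iff)
  have "{fst (f i), fst (f j)} \<in> edges F \<longleftrightarrow> consecutive k i j" if "i < k" "j < k" for i j
  proof (cases "i = j")
    case True
    have "{f i, f j} \<notin> edges G" using simple_graph_edgeD(3)[OF simple_G] True by blast
    moreover have "{fst (f i), fst (f j)} \<notin> edges F" using simple_graph_edgeD(3)[OF F] True by blast
    ultimately show ?thesis using f(3) that by blast
  next
    case False
    then have "\<exists>c. near c (f i) (f j)" using near that by blast
    then show ?thesis using f(3)[OF that] by (simp add: edge_G_iff)
  qed
  moreover have "inj_on (fst \<circ> f) {..<k}"
    unfolding inj_on_def using near near_fst by (metis comp_apply lessThan_iff)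
  moreover have "(fst \<circ> f) ` {..<k} \<subseteq> verts F"
    using f(2) pointsD by (auto simp del: split_paired_All simp: image_subset_iff)
  ultimately show ?thesis by (simp add: embeds_cycle_iff)
qed

text \<open>A hole of \<open>F\<close> without an edge is copied into the block that contains the deleted edge of
  \<open>G\<close>. Each of its vertices has an edge of the hole, so it is not isolated in \<open>F\<close> and the copy
  consists of points.\<close>
lemma saturated_G:
  assumes sat: "deletion_saturated (cycle_graph k) F" and k: "3 \<le> k" "k \<le> L"
    and ne: "X \<noteq> {}" "Cl \<noteq> {}"
  shows "deletion_saturated (cycle_graph k) G"
proof -
  have "\<nexists>f. embeds f (cycle_graph k) G"
    using cycle_in_block k sat by (auto simp: deletion_saturated_iff)
  moreover have "edges G \<noteq> {}"
  proof -
    obtain e where "e \<in> edges F" using sat by (auto simp: deletion_saturated_iff)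
    then obtain u v where uv: "{u, v} \<in> edges F" "u \<noteq> v" "u \<in> verts F" "v \<in> verts F"
      using simple_graph_edgeE[OF F] by metis
    obtain x c where xc: "x \<in> X" "c \<in> Cl" using ne by blast
    have "near c (point c x u) (point c x v)"
      using uv xc block_point by (auto simp: near_def points_def point_def tX block_def tt)
    then have "{point c x u, point c x v} \<in> edges G"
      using uv by (auto simp: edge_G_iff point_def)
    then show ?thesis by blast
  qed
  moreover have "\<exists>f. embeds f (cycle_graph k) (delete_edge G e)" if e: "e \<in> edges G" for e
  proof -
    obtain p q c where pq: "e = {p, q}" "near c p q" "{fst p, fst q} \<in> edges F"
      using e by (auto simp: G_def)
    let ?a = "{fst p, fst q}" and ?b = "block c p"
    have c: "c \<in> Cl" "p \<in> points" "q \<in> points" "block c q = ?b" using pq by (auto simp: near_def)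
    have b: "?b \<in> X" using c pointsD[of p] tX by (simp add: block_def)
    obtain f where f: "embeds f (cycle_graph k) (delete_edge F ?a)"
      using sat pq(3) by (auto simp: deletion_saturated_iff)
    then have f: "inj_on f {..<k}" "f ` {..<k} \<subseteq> verts F"
      "\<And>i j. i < k \<Longrightarrow> j < k \<Longrightarrow> ({f i, f j} \<in> edges F \<and> {f i, f j} \<noteq> ?a) \<longleftrightarrow> consecutive k i j"
      by (auto simp: embeds_cycle_iff)
    let ?g = "\<lambda>i. point c ?b (f i)"
    have fv: "f i \<in> verts F" if "i < k" for i using f that by auto
    have "f i \<in> \<Union> (edges F)" if "i < k" for i
    proof -
      have "Suc i mod k < k" "consecutive k i (Suc i mod k)" using k by (auto simp: consecutive_def)
      then have "{f i, f (Suc i mod k)} \<in> edges F" using f(3)[OF that, of "Suc i mod k"] by blast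
      then show ?thesis by blast
    qed
    then have gp: "?g i \<in> points" if "i < k" for i
      using that b c fv tX by (auto simp: points_def point_def)
    have gb: "block c (?g i) = ?b" if "i < k" for i using block_point fv that b c by simp
    have inj: "inj_on ?g {..<k}" using f(1) by (auto simp: inj_on_def point_def)
    have pb: "p = point c ?b (fst p)" "q = point c ?b (fst q)"
      using point_block[of p c] point_block[of q c] c by simp_all
    have "{?g i, ?g j} \<in> edges (delete_edge G e) \<longleftrightarrow> consecutive k i j" if ij: "i < k" "j < k" for i j
    proof -
      have "{?g i, ?g j} \<in> edges G \<longleftrightarrow> {f i, f j} \<in> edges F"
      proof (cases "i = j")
        case True
        then show ?thesis using simple_graph_edgeD(3)[OF simple_G] simple_graph_edgeD(3)[OF F] by blast
      next
        case False
        then have "?g i \<noteq> ?g j" using inj ij by (auto simp: inj_on_def)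
        then have "near c (?g i) (?g j)" using c gp gb ij by (simp add: near_def)
        then show ?thesis by (auto simp: edge_G_iff point_def)
      qed
      moreover have "{?g i, ?g j} = e \<longleftrightarrow> {f i, f j} = ?a"
        unfolding pq(1) doubleton_eq_iff using pb by (metis fst_conv point_def)
      ultimately show ?thesis using f(3)[OF ij] by auto
    qed
    then have "embeds ?g (cycle_graph k) (delete_edge G e)"
      using inj gp by (auto simp: embeds_cycle_iff G_def)
    then show ?thesis by blast
  qed
  ultimately show ?thesis using simple_G by (auto simp: deletion_saturated_iff)
qed

text \<open>Fix a neighbour \<open>v\<close> of \<open>fst p\<close> in \<open>F\<close>. Then \<open>p\<close> has a neighbour \<open>y c\<close> over \<open>v\<close> in its block
  of every colour \<open>c\<close>. A point \<open>a\<close> spoils at most two colours. It can lie in the same block as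
  \<open>p\<close>, which happens for at most one colour; or it is adjacent to \<open>y c\<close> through a block of another
  colour, and doing this for two colours \<open>c\<close> and \<open>d\<close> would give a closed path of blocks through
  \<open>a\<close>, \<open>y c\<close>, \<open>p\<close>, \<open>y d\<close>. So more than \<open>2 * N\<close> colours suffice.\<close>
lemma extendable_G:
  assumes L: "4 \<le> L" and N: "2 * N < card Cl"
  shows "extendable N G"
  unfolding extendable_def
proof (intro ballI allI impI)
  fix p and A :: "('v \<times> 'x) set"
  assume p: "p \<in> verts G" and A: "finite A" "card A \<le> N" "p \<notin> A"
  have pp: "p \<in> points" using p by (simp add: G_def)
  then obtain e where e: "e \<in> edges F" "fst p \<in> e" by (auto simp: points_def)
  obtain u w where uw: "e = {u, w}" using simple_graph_edgeE[OF F e(1)] by blast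
  then obtain v where v: "{fst p, v} \<in> edges F" using e by (auto simp: insert_commute)
  note v = v simple_graph_edgeD(2,3)[OF F v]
  define y where "y c = point c (block c p) v" for c
  have py: "near c p (y c)" if "c \<in> Cl" for c
  proof -
    have "block c p \<in> X" using pp that pointsD[of p] tX by (simp add: block_def)
    then show ?thesis using v that pp tX block_point[OF v(2) that]
      by (auto simp: near_def y_def points_def point_def)
  qed
  have L2: "2 \<le> L" using L by simp
  define bad where "bad a = {c\<in>Cl. y c = a \<or> {a, y c} \<in> edges G}" for a
  have bad: "card (bad a) \<le> 2" if "a \<in> A" for a
  proof -
    have ap: "a \<noteq> p" using that A by blast
    define B1 where "B1 = {c\<in>Cl. near c p a}"
    define B2 where "B2 = {c\<in>Cl. \<exists>c'. c' \<noteq> c \<and> near c' (y c) a}"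
    have "bad a \<subseteq> B1 \<union> B2"
    proof
      fix c assume "c \<in> bad a"
      then have c: "c \<in> Cl" "y c = a \<or> (\<exists>c'. near c' (y c) a)"
        by (auto simp: bad_def edge_G_iff near_sym)
      show "c \<in> B1 \<union> B2"
      proof (cases "near c p a")
        case True
        then show ?thesis using c by (simp add: B1_def)
      next
        case False
        then obtain c' where "near c' (y c) a" using c(2) py[OF c(1)] by blast
        moreover from this have "c' \<noteq> c" using near_trans[OF py[OF c(1)]] ap False by blast
        ultimately show ?thesis using c(1) unfolding B2_def by blast
      qed
    qed
    moreover have "c = d" if "c \<in> B1" "d \<in> B1" for c d
      using that near_unique[OF _ _ L2] unfolding B1_def by blast
    then have "card B1 \<le> 1" using finCl by (auto simp: card_le_Suc0_iff_eq B1_def)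
    moreover have "c = d" if B2: "c \<in> B2" "d \<in> B2" for c d
    proof (rule ccontr)
      assume ne: "c \<noteq> d"
      obtain c' d' where cd: "c \<in> Cl" "d \<in> Cl" "c' \<noteq> c" "d' \<noteq> d" "near c' (y c) a" "near d' (y d) a"
        using B2 unfolding B2_def by blast
      have "bpath a c' (y c) 1" using cd(5) by (intro bpath.one) (simp add: near_sym)
      moreover have "near c (y c) p" using py[OF cd(1)] by (simp add: near_sym)
      ultimately have "bpath a c p (Suc 1)" using bpath.step cd(3) by metis
      from bpath.step[OF this py[OF cd(2)]] have "bpath a d (y d) (Suc (Suc 1))" using ne by simp
      from bpath.step[OF this cd(6)] have "bpath a d' a (Suc (Suc (Suc 1)))" using cd(4) by simp
      then show False using bpath_neq L by fastforce
    qed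
    then have "card B2 \<le> 1" using finCl by (auto simp: card_le_Suc0_iff_eq B2_def)
    moreover have "finite (B1 \<union> B2)" using finCl by (auto simp: B1_def B2_def)
    ultimately show ?thesis using card_mono[of "B1 \<union> B2" "bad a"] card_Un_le[of B1 B2] by linarith
  qed
  have "card (\<Union>a\<in>A. bad a) \<le> (\<Sum>a\<in>A. card (bad a))" using A(1) by (rule card_UN_le)
  also have "\<dots> \<le> (\<Sum>a\<in>A. 2)" using bad by (rule sum_mono)
  also have "\<dots> < card Cl" using A N by simp
  finally have "\<not> Cl \<subseteq> (\<Union>a\<in>A. bad a)"
    using card_mono[of "\<Union>a\<in>A. bad a" Cl] A finCl by (fastforce simp: bad_def)
  then obtain c where c: "c \<in> Cl" "\<And>a. a \<in> A \<Longrightarrow> c \<notin> bad a" by blast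
  then have "y c \<notin> A" "\<forall>a\<in>A. {a, y c} \<notin> edges G"
    unfolding bad_def by blast+
  moreover have pyc: "{p, y c} \<in> edges G" using py[OF c(1)] v by (auto simp: edge_G_iff y_def point_def)
  moreover have "y c \<in> verts G" using simple_graph_edgeD(2)[OF simple_G pyc] .
  ultimately show "\<exists>y\<in>verts G. y \<notin> A \<and> {p, y} \<in> edges G \<and> (\<forall>a\<in>A. {a, y} \<notin> edges G)"
    by (intro bexI[of _ "y c"] conjI)
qed

end

text \<open>Girth is needed up to \<open>k\<close> for the holes and up to 4 for the extension property, whence
  \<open>L = k + 4\<close>; there are \<open>2 * N + 1\<close> colours, and each step of a path of blocks costs two letters.\<close>
lemma deletion_normal_of_cycle_saturated:
  fixes F :: "'v graph"
  assumes "unicyclic H C"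
    and c: "embeds c (cycle_graph k) H" "c ` {..<k} = verts C" and k: "3 \<le> k"
    and sat: "deletion_saturated (cycle_graph k) F"
  shows "deletion_normal H"
proof -
  interpret unicyclic H C by fact
  define N where "N = card (verts H) + 2"
  define L where "L = k + 4"
  define Cl where "Cl = {..2 * N}"
  have F: "simple_graph F" using sat by (simp add: deletion_saturated_iff)
  then have "finite (verts F \<times> Cl)" by (simp add: simple_graph_def Cl_def)
  from large_girth_action[OF this, of "2 * L"] obtain X :: "(('v \<times> nat) list \<Rightarrow> ('v \<times> nat) list) set" and t where
    X: "finite X" "X \<noteq> {}"
    "\<And>i x. i \<in> verts F \<times> Cl \<Longrightarrow> x \<in> X \<Longrightarrow> t i x \<in> X"
    "\<And>i x. i \<in> verts F \<times> Cl \<Longrightarrow> x \<in> X \<Longrightarrow> t i (t i x) = x"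
    "\<And>w x. reduced w \<Longrightarrow> set w \<subseteq> verts F \<times> Cl \<Longrightarrow> w \<noteq> [] \<Longrightarrow> length w \<le> 2 * L \<Longrightarrow> x \<in> X \<Longrightarrow>
       foldr t w x \<noteq> x"
    by blast
  interpret assembly F Cl X t L
    using F X by unfold_locales (auto simp: Cl_def)
  have "deletion_saturated (cycle_graph k) G"
    using saturated_G[OF sat k] X(2) by (auto simp: L_def Cl_def)
  moreover have "extendable (card (verts H) + 2) G"
    using extendable_G[of N] by (simp add: L_def Cl_def N_def)
  ultimately show ?thesis
    using deletion_saturated_of_extendable[OF c] deletion_normal_of_saturated by blast
qed

section \<open>Graphs given by an adjacency relation\<close>

definition graph_on :: "'a set \<Rightarrow> ('a \<Rightarrow> 'a \<Rightarrow> bool) \<Rightarrow> 'a graph" where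
  "graph_on V R = \<lparr>verts = V, edges = {{x, y} | x y. x \<in> V \<and> y \<in> V \<and> x \<noteq> y \<and> R x y}\<rparr>"

lemma verts_graph_on [simp]: "verts (graph_on V R) = V"
  by (simp add: graph_on_def)

lemma edges_graph_on_iff:
  assumes "symp R"
  shows "{x, y} \<in> edges (graph_on V R) \<longleftrightarrow> x \<in> V \<and> y \<in> V \<and> x \<noteq> y \<and> R x y"
  using sympD[OF assms] by (auto simp: graph_on_def doubleton_eq_iff)

lemma simple_graph_on: "finite V \<Longrightarrow> simple_graph (graph_on V R)"
  by (auto simp: simple_graph_def graph_on_def)

lemma edges_graph_onE:
  assumes "e \<in> edges (graph_on V R)"
  obtains x y where "e = {x, y}" "x \<in> V" "y \<in> V" "x \<noteq> y" "R x y"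
  using assms by (auto simp: graph_on_def)

lemma embeds_delete_edge:
  assumes "embeds h G G'" "e \<subseteq> verts G"
  shows "embeds h (delete_edge G e) (delete_edge G' (h ` e))"
proof -
  have inj: "inj_on h (verts G)" using assms by (simp add: embeds_def)
  have "h ` {u, v} = h ` e \<longleftrightarrow> {u, v} = e" if "u \<in> verts G" "v \<in> verts G" for u v
    using inj_on_image_eq_iff[OF inj, of "{u, v}" e] that assms by simp
  then show ?thesis using assms(1) by (auto simp: embeds_def)
qed

text \<open>This spreads a hole created by the deletion of one edge over the whole orbit of that edge
  under automorphisms.\<close>
lemma embeds_delete_edge_image:
  assumes "embeds f H (delete_edge G e)" "embeds h G G'" "e \<subseteq> verts G" "e' = h ` e"
  shows "\<exists>f. embeds f H (delete_edge G' e')"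
  using embeds_trans[OF assms(1) embeds_delete_edge[OF assms(2,3)]] assms(4) by blast

lemma embeds_cycleI:
  assumes "simple_graph G" "inj_on f {..<k}" "f ` {..<k} \<subseteq> verts G" "2 \<le> k"
    and less: "\<And>i j. i < j \<Longrightarrow> j < k \<Longrightarrow> {f i, f j} \<in> edges G \<longleftrightarrow> j = Suc i \<or> (i = 0 \<and> Suc j = k)"
  shows "embeds f (cycle_graph k) G"
  unfolding embeds_cycle_iff
proof (intro conjI allI impI assms)
  fix i j assume ij: "i < k" "j < k"
  have cons: "consecutive k a b \<longleftrightarrow> b = Suc a \<or> (a = 0 \<and> Suc b = k)" if "a < b" "b < k" for a b
    using that by (auto simp: consecutive_def mod_Suc split: if_splits)
  have "\<not> consecutive k i i" using ij assms(4) by (auto simp: consecutive_def mod_Suc split: if_splits)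
  moreover have "{f i, f i} \<notin> edges G" using simple_graph_edgeD(3)[OF assms(1)] by blast
  moreover have "consecutive k i j \<longleftrightarrow> consecutive k j i" by (auto simp: consecutive_def)
  ultimately show "{f i, f j} \<in> edges G \<longleftrightarrow> consecutive k i j"
    using less[of i j] less[of j i] cons[of i j] cons[of j i] ij
    by (cases i j rule: linorder_cases) (auto simp: insert_commute)
qed

lemma simple_delete_edge: "simple_graph G \<Longrightarrow> simple_graph (delete_edge G e)"
  by (simp add: simple_graph_def)

section \<open>Odd cycles: rook graphs\<close>

definition rook :: "nat \<Rightarrow> (nat \<times> nat) graph" where
  "rook m = graph_on ({..<m} \<times> {..<m}) (\<lambda>p q. fst p = fst q \<or> snd p = snd q)"

lemma rook_edge_iff:
  "{p, q} \<in> edges (rook m) \<longleftrightarrow> p \<in> {..<m} \<times> {..<m} \<and> q \<in> {..<m} \<times> {..<m} \<and> p \<noteq> q \<and>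
     (fst p = fst q \<or> snd p = snd q)"
  unfolding rook_def by (subst edges_graph_on_iff) (auto simp: symp_def)

text \<open>Two successive edges of a hole cannot lie in the same row, or in the same column, for then
  their outer ends would be adjacent. So rows and columns alternate along the hole.\<close>
lemma rook_no_odd_hole:
  assumes k: "odd k" "5 \<le> k"
  shows "\<not> embeds f (cycle_graph k) (rook m)"
proof
  assume "embeds f (cycle_graph k) (rook m)"
  then have inj: "inj_on f {..<k}" and im: "f ` {..<k} \<subseteq> {..<m} \<times> {..<m}"
    and e: "\<And>i j. i < k \<Longrightarrow> j < k \<Longrightarrow> {f i, f j} \<in> edges (rook m) \<longleftrightarrow> consecutive k i j"
    by (auto simp: embeds_cycle_iff rook_def)
  define s where "s i = Suc i mod k" for i
  define r where "r i \<longleftrightarrow> fst (f i) = fst (f (s i))" for i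
  have sk: "s i < k" for i using k by (simp add: s_def)
  have flip: "r (s i) \<noteq> r i" if i: "i < k" for i
  proof -
    have adj: "fst (f j) = fst (f (s j)) \<or> snd (f j) = snd (f (s j))" if "j < k" for j
      using e[OF that sk] by (auto simp: rook_edge_iff consecutive_def s_def)
    have "i \<noteq> s (s i)" "\<not> consecutive k i (s (s i))"
      using i k by (auto simp: s_def consecutive_def mod_Suc split: if_splits)
    moreover have "f i \<noteq> f (s (s i))" using inj i sk calculation(1) by (auto simp: inj_on_def)
    ultimately have "fst (f i) \<noteq> fst (f (s (s i)))" "snd (f i) \<noteq> snd (f (s (s i)))"
      using e[OF i sk, of "s i"] im i sk by (auto simp: rook_edge_iff image_subset_iff)
    then show ?thesis using adj[OF i] adj[OF sk, of i] by (auto simp: r_def)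
  qed
  have alt: "r i \<longleftrightarrow> (r 0 \<longleftrightarrow> even i)" if "i < k" for i
    using that
  proof (induction i)
    case (Suc i)
    then have "s i = Suc i" by (simp add: s_def)
    then show ?case using flip[of i] Suc by simp
  qed simp
  have "s (k - 1) = 0" using k by (simp add: s_def)
  then show False using flip[of "k - 1"] alt[of "k - 1"] k by simp
qed

lemma half_cases:
  fixes i :: nat
  obtains a where "i = 2 * a" "i div 2 = a" "(i + 1) div 2 = a"
  | a where "i = 2 * a + 1" "i div 2 = a" "(i + 1) div 2 = a + 1"
  by (cases "even i") (auto elim!: evenE oddE)

text \<open>The staircase \<open>(0, 0), (0, 1), (1, 1), (1, 2), \<dots>, (s - 1, s), (0, s)\<close>. Three of its vertices
  have first coordinate 0, and the deleted edge is the only chord between them.\<close>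
lemma rook_hole:
  assumes s: "2 \<le> s"
  shows "embeds (\<lambda>j. (j div 2 mod s, (j + 1) div 2)) (cycle_graph (2 * s + 1))
    (delete_edge (rook (s + 1)) {(0, 1), (0, s)})"
proof -
  let ?f = "\<lambda>j. (j div 2 mod s, (j + 1) div 2)" and ?k = "2 * s + 1"
  have row: "j div 2 mod s = (if j = 2 * s then 0 else j div 2)" if "j < ?k" for j
    using that s by (auto simp: less_Suc_eq)
  have inj: "inj_on ?f {..<?k}"
  proof (rule inj_onI)
    fix i j assume ij: "i \<in> {..<?k}" "j \<in> {..<?k}" "?f i = ?f j"
    then have "(if i = 2 * s then 0 else i div 2) = (if j = 2 * s then 0 else j div 2)"
      using row[of i] row[of j] by simp
    moreover have "(i + 1) div 2 = (j + 1) div 2" "i < ?k" "j < ?k" using ij by simp_all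
    ultimately show "i = j" using s
      by (cases i rule: half_cases; cases j rule: half_cases) (auto split: if_splits)
  qed
  show ?thesis
  proof (rule embeds_cycleI)
    show "simple_graph (delete_edge (rook (s + 1)) {(0, 1), (0, s)})"
      by (simp add: simple_delete_edge rook_def simple_graph_on)
    have mem: "?f l \<in> {..<s + 1} \<times> {..<s + 1}" if "l < ?k" for l
      using that s row[OF that] by (auto split: if_splits)
    then show "?f ` {..<?k} \<subseteq> verts (delete_edge (rook (s + 1)) {(0, 1), (0, s)})"
      by (auto simp: rook_def)
    fix i j assume ij: "i < j" "j < ?k"
    have ne: "?f i \<noteq> ?f j" using inj_onD[OF inj, of i j] ij by fastforce
    have "{?f i, ?f j} = {(0, 1), (0, s)} \<longleftrightarrow> i = 1 \<and> j = 2 * s"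
    proof -
      have "{?f i, ?f j} = {(0, 1), (0, s)} \<longleftrightarrow>
          (if i = 2 * s then 0 else i div 2) = 0 \<and> (if j = 2 * s then 0 else j div 2) = 0 \<and>
          ((i + 1) div 2 = 1 \<and> (j + 1) div 2 = s \<or> (i + 1) div 2 = s \<and> (j + 1) div 2 = 1)"
        unfolding doubleton_eq_iff using row[of i] row[of j] ij by auto
      also have "\<dots> \<longleftrightarrow> i = 1 \<and> j = 2 * s" using ij s
        by (cases i rule: half_cases; cases j rule: half_cases) auto
      finally show ?thesis .
    qed
    moreover have "(i div 2 mod s = j div 2 mod s \<or> (i + 1) div 2 = (j + 1) div 2) \<longleftrightarrow>
        j = Suc i \<or> (i = 0 \<and> j = 2 * s) \<or> (i = 1 \<and> j = 2 * s)"
    proof -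
      have "(i div 2 mod s = j div 2 mod s \<or> (i + 1) div 2 = (j + 1) div 2) \<longleftrightarrow>
          (if i = 2 * s then 0 else i div 2) = (if j = 2 * s then 0 else j div 2) \<or>
          (i + 1) div 2 = (j + 1) div 2"
        using row[of i] row[of j] ij by simp
      also have "\<dots> \<longleftrightarrow> j = Suc i \<or> (i = 0 \<and> j = 2 * s) \<or> (i = 1 \<and> j = 2 * s)"
        using ij s
        by (cases i rule: half_cases; cases j rule: half_cases) auto
      finally show ?thesis .
    qed
    moreover have "{?f i, ?f j} \<in> edges (rook (s + 1)) \<longleftrightarrow>
        i div 2 mod s = j div 2 mod s \<or> (i + 1) div 2 = (j + 1) div 2"
      unfolding rook_edge_iff fst_conv snd_conv using ne mem[of i] mem[of j] ij by simp
    ultimately have "{?f i, ?f j} \<in> edges (delete_edge (rook (s + 1)) {(0, 1), (0, s)}) \<longleftrightarrow>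
        (j = Suc i \<or> (i = 0 \<and> j = 2 * s) \<or> (i = 1 \<and> j = 2 * s)) \<and> \<not> (i = 1 \<and> j = 2 * s)"
      by (simp only: edges_delete_edge Diff_iff singleton_iff)
    also have "\<dots> \<longleftrightarrow> j = Suc i \<or> i = 0 \<and> Suc j = ?k" using s by auto
    finally show "{?f i, ?f j} \<in> edges (delete_edge (rook (s + 1)) {(0, 1), (0, s)}) \<longleftrightarrow>
        j = Suc i \<or> i = 0 \<and> Suc j = ?k" .
  qed (use inj s in auto)
qed

lemma permutes_two_points:
  assumes "a \<in> S" "b \<in> S" "c \<in> S" "d \<in> S" "a \<noteq> b" "c \<noteq> d"
  obtains p where "p permutes S" "p a = c" "p b = d"
proof -
  let ?t = "Transposition.transpose a c"
  let ?p = "Transposition.transpose (?t b) d \<circ> ?t"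
  have t: "?t permutes S" using assms by (simp add: permutes_swap_id)
  then have "?t b \<in> S" using assms(2) by (simp add: permutes_in_image)
  then have "?p permutes S" using t assms by (intro permutes_compose) (simp_all add: permutes_swap_id)
  moreover have "?t b \<noteq> c" using assms(5) by (auto simp: Transposition.transpose_def)
  then have "?p a = c" "?p b = d" using assms(6) by (simp_all add: Transposition.transpose_def)
  ultimately show ?thesis using that by blast
qed

lemma embeds_rook_permutes:
  assumes "p permutes {..<m}" "q permutes {..<m}"
  shows "embeds (map_prod p q) (rook m) (rook m)"
proof -
  have inj: "inj p" "inj q" using assms permutes_inj by blast+
  have mem: "p a < m \<longleftrightarrow> a < m" "q a < m \<longleftrightarrow> a < m" for a
    using permutes_in_image[OF assms(1), of a] permutes_in_image[OF assms(2), of a] by simp_all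
  have "{map_prod p q u, map_prod p q v} \<in> edges (rook m) \<longleftrightarrow> {u, v} \<in> edges (rook m)" for u v
    by (cases u; cases v) (simp add: rook_edge_iff mem inj_eq[OF inj(1)] inj_eq[OF inj(2)])
  moreover have "inj (map_prod p q)" using inj by (simp add: prod.inj_map)
  then have "inj_on (map_prod p q) (verts (rook m))" by (rule inj_on_subset) simp
  moreover have "map_prod p q ` verts (rook m) \<subseteq> verts (rook m)"
    by (auto simp: rook_def mem)
  ultimately show ?thesis by (simp add: embeds_def)
qed

lemma embeds_rook_swap: "embeds prod.swap (rook m) (rook m)"
proof -
  have "{prod.swap u, prod.swap v} \<in> edges (rook m) \<longleftrightarrow> {u, v} \<in> edges (rook m)" for u v
    by (cases u; cases v) (auto simp: rook_edge_iff)
  moreover have "inj_on prod.swap (verts (rook m))" by (auto simp: inj_on_def)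
  moreover have "prod.swap ` verts (rook m) \<subseteq> verts (rook m)" by (auto simp: rook_def)
  ultimately show ?thesis by (simp add: embeds_def)
qed

text \<open>The automorphisms of the rook graph act transitively on its edges, so one hole suffices.\<close>
lemma rook_saturated:
  assumes s: "2 \<le> s"
  shows "deletion_saturated (cycle_graph (2 * s + 1)) (rook (s + 1))"
  unfolding deletion_saturated_iff
proof (intro conjI ballI)
  show "simple_graph (rook (s + 1))" by (simp add: rook_def simple_graph_on)
  show "\<nexists>f. embeds f (cycle_graph (2 * s + 1)) (rook (s + 1))"
    using rook_no_odd_hole s by simp
  have "{(0, 0), (0, 1)} \<in> edges (rook (s + 1))" using s by (simp add: rook_edge_iff)
  then show "edges (rook (s + 1)) \<noteq> {}" by blast
  fix e assume e: "e \<in> edges (rook (s + 1))"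
  let ?V = "{..<s + 1}"
  obtain x y where xy: "e = {x, y}" "x \<in> ?V \<times> ?V" "y \<in> ?V \<times> ?V" "x \<noteq> y" "fst x = fst y \<or> snd x = snd y"
    using e unfolding rook_def by (rule edges_graph_onE)
  have V: "fst x \<in> ?V" "snd x \<in> ?V" "fst y \<in> ?V" "snd y \<in> ?V" using xy by (auto simp: mem_Times_iff)
  have e0: "{(0, 1), (0, s)} \<subseteq> verts (rook (s + 1))" using s by (simp add: rook_def)
  have p01: "1 \<in> ?V" "s \<in> ?V" "1 \<noteq> s" "0 \<in> ?V" "0 \<noteq> s" using s by auto
  show "\<exists>f. embeds f (cycle_graph (2 * s + 1)) (delete_edge (rook (s + 1)) e)"
  proof (cases "fst x = fst y")
    case True
    then have ne: "snd x \<noteq> snd y" using xy by (auto simp: prod_eq_iff)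
    obtain q where q: "q permutes ?V" "q 1 = snd x" "q s = snd y"
      using permutes_two_points[OF p01(1,2) V(2,4) p01(3) ne] by blast
    obtain p where p: "p permutes ?V" "p 0 = fst x"
      using permutes_swap_id[OF p01(4) V(1)] by (rule that) simp
    have "e = map_prod p q ` {(0, 1), (0, s)}" using xy True p q by (auto simp: prod_eq_iff)
    then show ?thesis using embeds_delete_edge_image[OF rook_hole[OF s] embeds_rook_permutes[OF p(1) q(1)] e0] by blast
  next
    case False
    then have eq: "snd x = snd y" using xy by auto
    obtain q where q: "q permutes ?V" "q 1 = fst x" "q s = fst y"
      using permutes_two_points[OF p01(1,2) V(1,3) p01(3) False] by blast
    obtain p where p: "p permutes ?V" "p 0 = snd x"
      using permutes_swap_id[OF p01(4) V(2)] by (rule that) simp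
    have "e = (prod.swap \<circ> map_prod p q) ` {(0, 1), (0, s)}" using xy eq p q by (auto simp: prod_eq_iff)
    then show ?thesis using embeds_delete_edge_image[OF rook_hole[OF s] embeds_trans[OF embeds_rook_permutes[OF p(1) q(1)] embeds_rook_swap] e0] by blast
  qed
qed

section \<open>Cycles of length 4 and 6: circulant graphs\<close>

definition circ_adj :: "nat \<Rightarrow> int set \<Rightarrow> nat \<Rightarrow> nat \<Rightarrow> bool" where
  "circ_adj n D x y \<longleftrightarrow> (int x - int y) mod int n \<in> D"

definition circulant :: "nat \<Rightarrow> int set \<Rightarrow> nat graph" where
  "circulant n D = graph_on {..<n} (circ_adj n D)"

lemma symp_circ_adj:
  assumes D_sym: "\<And>d. d \<in> D \<Longrightarrow> - d mod int n \<in> D"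
  shows "symp (circ_adj n D)"
proof (rule sympI)
  fix x y assume "circ_adj n D x y"
  then have "- ((int x - int y) mod int n) mod int n \<in> D" unfolding circ_adj_def by (rule D_sym)
  then show "circ_adj n D y x" by (simp add: circ_adj_def mod_minus_eq)
qed

text \<open>Rotations are automorphisms, so only holes through 0 have to be excluded, and only edges at
  0 have to be deleted. Both are finite checks for a concrete graph.\<close>
locale circulant_hole_free =
  fixes n k :: nat and D :: "int set"
  assumes D_sym: "\<And>d. d \<in> D \<Longrightarrow> - d mod int n \<in> D"
    and D_range: "D \<noteq> {}" "D \<subseteq> {0<..<int n}" and k: "0 < k"
    and no_hole: "\<And>f. embeds f (cycle_graph k) (circulant n D) \<Longrightarrow> f 0 \<noteq> 0"
    and holes: "\<And>d. d \<in> D \<Longrightarrow> \<exists>f. embeds f (cycle_graph k) (delete_edge (circulant n D) {0, nat d})"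
begin

lemma symp: "symp (circ_adj n D)"
  using D_sym by (rule symp_circ_adj)

lemma edge_iff: "{x, y} \<in> edges (circulant n D) \<longleftrightarrow> x < n \<and> y < n \<and> x \<noteq> y \<and> circ_adj n D x y"
  unfolding circulant_def by (subst edges_graph_on_iff[OF symp]) simp

lemma embeds_rotate: "embeds (\<lambda>x. (x + a) mod n) (circulant n D) (circulant n D)"
proof -
  have n: "0 < n" using D_range by auto
  have diff: "(int ((x + a) mod n) - int ((y + a) mod n)) mod int n = (int x - int y) mod int n" for x y
    by (simp add: of_nat_mod mod_diff_eq)
  have "inj_on (\<lambda>x. (x + a) mod n) {..<n}"
  proof (rule inj_onI)
    fix x y assume xy: "x \<in> {..<n}" "y \<in> {..<n}" "(x + a) mod n = (y + a) mod n"
    then have "(int x - int y) mod int n = 0" using diff[of x y] by simp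
    then have "int x mod int n = int y mod int n" by (simp add: mod_eq_dvd_iff mod_0_imp_dvd)
    then show "x = y" using xy by simp
  qed
  then show ?thesis
    unfolding embeds_def edge_iff using n
    by (auto simp: circulant_def circ_adj_def diff dest: inj_onD)
qed

lemma saturated: "deletion_saturated (cycle_graph k) (circulant n D)"
  unfolding deletion_saturated_iff
proof (intro conjI ballI)
  have n: "0 < n" using D_range by auto
  show "simple_graph (circulant n D)" by (simp add: circulant_def simple_graph_on)
  show "\<nexists>f. embeds f (cycle_graph k) (circulant n D)"
  proof
    assume "\<exists>f. embeds f (cycle_graph k) (circulant n D)"
    then obtain f where f: "embeds f (cycle_graph k) (circulant n D)" ..
    have "f 0 < n" using f k by (auto simp: embeds_cycle_iff circulant_def)
    then have "((\<lambda>x. (x + (n - f 0)) mod n) \<circ> f) 0 = 0" by simp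
    then show False using no_hole[OF embeds_trans[OF f embeds_rotate]] by blast
  qed
  obtain d where d: "d \<in> D" using D_range by auto
  then have "0 < d" "d < int n" using D_range by auto
  then have "int (nat d) = d" "nat d < n" "0 < nat d" "d mod int n = d" by (auto simp: nat_less_iff)
  then have zero_d: "{nat d, 0} \<in> edges (circulant n D)" using d by (simp add: edge_iff circ_adj_def)
  then show "edges (circulant n D) \<noteq> {}" by blast
  fix e assume e: "e \<in> edges (circulant n D)"
  obtain x y where xy: "e = {x, y}" "x < n" "y < n" "x \<noteq> y" "circ_adj n D x y"
    using e unfolding circulant_def by (auto elim: edges_graph_onE)
  let ?d = "(int x - int y) mod int n"
  have dD: "?d \<in> D" using xy by (simp add: circ_adj_def)
  have "0 \<le> ?d" using n by simp
  then have d: "int (nat ?d) = ?d" "nat ?d < n" using n by (auto simp: nat_less_iff)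
  have "int ((nat ?d + y) mod n) = (?d + int y) mod int n"
    unfolding of_nat_mod of_nat_add d ..
  also have "\<dots> = int x mod int n" by (simp add: mod_add_left_eq)
  finally have "int ((nat ?d + y) mod n) = int x mod int n" .
  then have "(nat ?d + y) mod n = x" using xy by (metis mod_less of_nat_eq_iff of_nat_mod)
  then have "e = (\<lambda>x. (x + y) mod n) ` {0, nat ?d}" using xy by auto
  moreover have "{0, nat ?d} \<subseteq> verts (circulant n D)" using d n by (simp add: circulant_def)
  moreover obtain f where "embeds f (cycle_graph k) (delete_edge (circulant n D) {0, nat ?d})"
    using holes[OF dD] by blast
  ultimately show "\<exists>f. embeds f (cycle_graph k) (delete_edge (circulant n D) e)"
    using embeds_delete_edge_image[OF _ embeds_rotate] by blast
qed

end

text \<open>All index bounds are given by lists, so that instances can be decided by computation.\<close>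
definition hole_list :: "nat \<Rightarrow> int set \<Rightarrow> nat \<Rightarrow> nat list \<Rightarrow> bool" where
  "hole_list n D d xs \<longleftrightarrow> distinct xs \<and> (\<forall>x\<in>set xs. x < n) \<and> (\<forall>j\<in>set [0..<length xs]. \<forall>i\<in>set [0..<j].
     (circ_adj n D (xs ! i) (xs ! j) \<and> {xs ! i, xs ! j} \<noteq> {0, d}) = (j = Suc i \<or> i = 0 \<and> Suc j = length xs))"

lemma embeds_hole_list:
  assumes "hole_list n D d xs" "symp (circ_adj n D)" "2 \<le> length xs"
  shows "embeds ((!) xs) (cycle_graph (length xs)) (delete_edge (circulant n D) {0, d})"
proof (rule embeds_cycleI)
  show "simple_graph (delete_edge (circulant n D) {0, d})"
    by (simp add: circulant_def simple_graph_on simple_delete_edge)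
  show "inj_on ((!) xs) {..<length xs}" using assms(1) by (simp add: hole_list_def inj_on_nth)
  show "(!) xs ` {..<length xs} \<subseteq> verts (delete_edge (circulant n D) {0, d})"
    using assms(1) by (auto simp: hole_list_def circulant_def)
  fix i j assume "i < j" "j < length xs"
  then show "{xs ! i, xs ! j} \<in> edges (delete_edge (circulant n D) {0, d}) \<longleftrightarrow>
      j = Suc i \<or> i = 0 \<and> Suc j = length xs"
    using assms(1) by (auto simp: hole_list_def circulant_def edges_graph_on_iff[OF assms(2)] nth_eq_iff_index_eq)
qed (fact assms)

text \<open>These are \<open>\<plusminus>2, \<plusminus>3, \<plusminus>5\<close> modulo 19 and, below, \<open>\<plusminus>1, \<plusminus>2, \<plusminus>4\<close> modulo 13.\<close>
definition D4 :: "int set" where "D4 = {2, 3, 5, 14, 16, 17}"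

definition D6 :: "int set" where "D6 = {1, 2, 4, 9, 11, 12}"

text \<open>A search for holes \<open>0, a, b, c\<close> that prunes after every vertex; the next lemma does the same
  for six vertices.\<close>
lemma no_hole_4:
  "\<forall>a\<in>set (filter (circ_adj 19 D4 0) [0..<19]).
   \<forall>b\<in>set (filter (\<lambda>b. circ_adj 19 D4 a b \<and> \<not> circ_adj 19 D4 0 b \<and> b \<noteq> 0) [0..<19]).
     filter (\<lambda>c. circ_adj 19 D4 b c \<and> circ_adj 19 D4 0 c \<and> \<not> circ_adj 19 D4 a c \<and> c \<noteq> a) [0..<19] = []"
  by code_simp

lemma no_hole_6:
  "\<forall>a\<in>set (filter (circ_adj 13 D6 0) [0..<13]).
   \<forall>b\<in>set (filter (\<lambda>b. circ_adj 13 D6 a b \<and> \<not> circ_adj 13 D6 0 b \<and> b \<noteq> 0) [0..<13]).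
   \<forall>c\<in>set (filter (\<lambda>c. circ_adj 13 D6 b c \<and> \<not> circ_adj 13 D6 0 c \<and> \<not> circ_adj 13 D6 a c \<and> c \<noteq> a \<and> c \<noteq> 0) [0..<13]).
   \<forall>d\<in>set (filter (\<lambda>d. circ_adj 13 D6 c d \<and> \<not> circ_adj 13 D6 0 d \<and> \<not> circ_adj 13 D6 a d \<and> \<not> circ_adj 13 D6 b d
        \<and> d \<noteq> b \<and> d \<noteq> a \<and> d \<noteq> 0) [0..<13]).
     filter (\<lambda>e. circ_adj 13 D6 d e \<and> circ_adj 13 D6 0 e \<and> \<not> circ_adj 13 D6 a e \<and> \<not> circ_adj 13 D6 b e
       \<and> \<not> circ_adj 13 D6 c e \<and> e \<noteq> a) [0..<13] = []"
  by code_simp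

lemma holes_4: "\<forall>(d, xs)\<in>set [(2, [0, 5, 2, 16]), (3, [0, 5, 3, 17]), (5, [0, 2, 5, 3]),
   (14, [0, 16, 14, 17]), (16, [0, 2, 16, 14]), (17, [0, 3, 17, 14])]. hole_list 19 D4 d xs \<and> length xs = 4"
  by code_simp

lemma holes_6: "\<forall>(d, xs)\<in>set [(1, [0, 4, 3, 1, 10, 9]), (2, [0, 1, 2, 6, 7, 9]), (4, [0, 1, 3, 4, 8, 9]),
   (9, [0, 4, 5, 9, 10, 12]), (11, [0, 4, 5, 7, 11, 12]), (12, [0, 2, 3, 12, 8, 9])].
   hole_list 13 D6 d xs \<and> length xs = 6"
  by code_simp

lemma C4_saturated: "deletion_saturated (cycle_graph 4) (circulant 19 D4)"
proof -
  have sym: "- d mod int 19 \<in> D4" if "d \<in> D4" for d using that by (auto simp: D4_def)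
  have sp: "symp (circ_adj 19 D4)" using sym by (rule symp_circ_adj)
  interpret circulant_hole_free 19 4 D4
  proof
    fix f assume f: "embeds f (cycle_graph 4) (circulant 19 D4)"
    have adj: "circ_adj 19 D4 (f i) (f j) \<longleftrightarrow> consecutive 4 i j" and lt: "f i < 19" and ne: "f i \<noteq> f j"
      if "i < 4" "j < 4" "i \<noteq> j" for i j
      using f that inj_onD[of f "{..<4}" i j]
      by (auto simp: embeds_cycle_iff circulant_def edges_graph_on_iff[OF sp] image_subset_iff)
    show "f 0 \<noteq> 0"
    proof
      assume 0: "f 0 = 0"
      note facts = adj[of 0 1] adj[of 1 2] adj[of 0 2] adj[of 2 3] adj[of 0 3] adj[of 1 3]
        ne[of 2 0] ne[of 3 1] lt[of 1 0] lt[of 2 0] lt[of 3 0]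
      have a: "f 1 \<in> set (filter (circ_adj 19 D4 0) [0..<19])"
        and b: "f 2 \<in> set (filter (\<lambda>b. circ_adj 19 D4 (f 1) b \<and> \<not> circ_adj 19 D4 0 b \<and> b \<noteq> 0) [0..<19])"
        and c: "f 3 \<in> set (filter (\<lambda>c. circ_adj 19 D4 (f 2) c \<and> circ_adj 19 D4 0 c \<and> \<not> circ_adj 19 D4 (f 1) c
          \<and> c \<noteq> f 1) [0..<19])"
        using facts 0 unfolding set_filter set_upt by (simp_all add: consecutive_def)
      show False using bspec[OF bspec[OF no_hole_4 a] b] c by (metis empty_iff list.set(1))
    qed
  next
    fix d assume "d \<in> D4"
    then obtain xs where "hole_list 19 D4 (nat d) xs" "length xs = 4"
      using holes_4 by (auto simp: D4_def)
    then show "\<exists>f. embeds f (cycle_graph 4) (delete_edge (circulant 19 D4) {0, nat d})"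
      using embeds_hole_list[OF _ sp, of "nat d" xs] by auto
  qed (use sym in \<open>auto simp: D4_def\<close>)
  show ?thesis by (rule saturated)
qed

lemma C6_saturated: "deletion_saturated (cycle_graph 6) (circulant 13 D6)"
proof -
  have sym: "- d mod int 13 \<in> D6" if "d \<in> D6" for d using that by (auto simp: D6_def)
  have sp: "symp (circ_adj 13 D6)" using sym by (rule symp_circ_adj)
  interpret circulant_hole_free 13 6 D6
  proof
    fix f assume f: "embeds f (cycle_graph 6) (circulant 13 D6)"
    have adj: "circ_adj 13 D6 (f i) (f j) \<longleftrightarrow> consecutive 6 i j" and lt: "f i < 13" and ne: "f i \<noteq> f j"
      if "i < 6" "j < 6" "i \<noteq> j" for i j
      using f that inj_onD[of f "{..<6}" i j]
      by (auto simp: embeds_cycle_iff circulant_def edges_graph_on_iff[OF sp] image_subset_iff)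
    show "f 0 \<noteq> 0"
    proof
      assume 0: "f 0 = 0"
      note facts = adj[of 0 1] adj[of 0 2] adj[of 0 3] adj[of 0 4] adj[of 0 5] adj[of 1 2] adj[of 1 3]
        adj[of 1 4] adj[of 1 5] adj[of 2 3] adj[of 2 4] adj[of 2 5] adj[of 3 4] adj[of 3 5] adj[of 4 5]
        ne[of 2 0] ne[of 3 1] ne[of 3 0] ne[of 4 2] ne[of 4 1] ne[of 4 0] ne[of 5 1]
        lt[of 1 0] lt[of 2 0] lt[of 3 0] lt[of 4 0] lt[of 5 0]
      have a: "f 1 \<in> set (filter (circ_adj 13 D6 0) [0..<13])"
        and b: "f 2 \<in> set (filter (\<lambda>b. circ_adj 13 D6 (f 1) b \<and> \<not> circ_adj 13 D6 0 b \<and> b \<noteq> 0) [0..<13])"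
        and c: "f 3 \<in> set (filter (\<lambda>c. circ_adj 13 D6 (f 2) c \<and> \<not> circ_adj 13 D6 0 c
          \<and> \<not> circ_adj 13 D6 (f 1) c \<and> c \<noteq> f 1 \<and> c \<noteq> 0) [0..<13])"
        and d: "f 4 \<in> set (filter (\<lambda>d. circ_adj 13 D6 (f 3) d \<and> \<not> circ_adj 13 D6 0 d
          \<and> \<not> circ_adj 13 D6 (f 1) d \<and> \<not> circ_adj 13 D6 (f 2) d \<and> d \<noteq> f 2 \<and> d \<noteq> f 1 \<and> d \<noteq> 0) [0..<13])"
        and e: "f 5 \<in> set (filter (\<lambda>e. circ_adj 13 D6 (f 4) e \<and> circ_adj 13 D6 0 e
          \<and> \<not> circ_adj 13 D6 (f 1) e \<and> \<not> circ_adj 13 D6 (f 2) e \<and> \<not> circ_adj 13 D6 (f 3) e \<and> e \<noteq> f 1) [0..<13])"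
        using facts 0 unfolding set_filter set_upt by (simp_all add: consecutive_def)
      show False
        using bspec[OF bspec[OF bspec[OF bspec[OF no_hole_6 a] b] c] d] e by (metis empty_iff list.set(1))
    qed
  next
    fix d assume "d \<in> D6"
    then obtain xs where "hole_list 13 D6 (nat d) xs" "length xs = 6"
      using holes_6 by (auto simp: D6_def)
    then show "\<exists>f. embeds f (cycle_graph 6) (delete_edge (circulant 13 D6) {0, nat d})"
      using embeds_hole_list[OF _ sp, of "nat d" xs] by auto
  qed (use sym in \<open>auto simp: D6_def\<close>)
  show ?thesis by (rule saturated)
qed

section \<open>Sequences of layers\<close>

text \<open>In the ring considered in the next section, each layer consists of four vertices with labels
  0 to 3. A value of this type records which of them belong to a given hole.\<close>
type_synonym layer = "bool \<times> bool \<times> bool \<times> bool"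

fun size_layer :: "layer \<Rightarrow> nat" where
  "size_layer (a0, a1, a2, a3) = of_bool a0 + of_bool a1 + of_bool a2 + of_bool a3"

text \<open>Necessary conditions on three successive layers \<open>a\<close>, \<open>b\<close>, \<open>c\<close> of a hole with at least five
  vertices. The first four lines say that each vertex in the middle layer has exactly two
  neighbours in the hole, written out for the adjacencies of the ring. The last line excludes the
  triangles \<open>b0 b1 b2\<close> and \<open>b0 b1 b3\<close> and the 4-cycles \<open>b0 b2 c0 b3\<close> and \<open>b1 b2 c1 b3\<close>.\<close>
fun fits :: "layer \<Rightarrow> layer \<Rightarrow> layer \<Rightarrow> bool" where
  "fits (a0, a1, a2, a3) (b0, b1, b2, b3) (c0, c1, c2, c3) \<longleftrightarrow>
     (b0 \<longrightarrow> of_bool a1 + of_bool a2 + of_bool a3 + of_bool b1 + of_bool b2 + of_bool b3 + of_bool c1 + of_bool c3 = (2::nat)) \<and>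
     (b1 \<longrightarrow> of_bool a0 + of_bool a2 + of_bool a3 + of_bool b0 + of_bool b2 + of_bool b3 + of_bool c0 + of_bool c2 = (2::nat)) \<and>
     (b2 \<longrightarrow> of_bool a1 + of_bool a3 + of_bool b0 + of_bool b1 + of_bool c0 + of_bool c1 + of_bool c3 = (2::nat)) \<and>
     (b3 \<longrightarrow> of_bool a0 + of_bool a2 + of_bool b0 + of_bool b1 + of_bool c0 + of_bool c1 + of_bool c2 = (2::nat)) \<and>
     \<not> (b0 \<and> b1 \<and> b2) \<and> \<not> (b0 \<and> b1 \<and> b3) \<and> \<not> (b0 \<and> b2 \<and> b3 \<and> c0) \<and> \<not> (b1 \<and> b2 \<and> b3 \<and> c1)"

definition layers :: "nat \<Rightarrow> layer list" where
  "layers n = filter (\<lambda>A. size_layer A = n) Enum.enum"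

lemma in_layers: "A \<in> set (layers n) \<longleftrightarrow> size_layer A = n"
  by (simp add: layers_def enum_UNIV)

abbreviation "L0 \<equiv> (True, False, False, False)"
abbreviation "L1 \<equiv> (False, True, False, False)"
abbreviation "L2 \<equiv> (False, False, True, False)"
abbreviation "L3 \<equiv> (False, False, False, True)"
abbreviation "L02 \<equiv> (True, False, True, False)"
abbreviation "L13 \<equiv> (False, True, False, True)"
abbreviation "L23 \<equiv> (False, False, True, True)"

lemma layer_at_most_2:
  "\<forall>B\<in>set (layers 3 @ layers 4). \<forall>A\<in>set (concat (map layers [0..<5])). \<forall>C\<in>set (concat (map layers [0..<5])). \<not> fits A B C"
  by code_simp

text \<open>Of two-element layers following an empty one, the second and the third are \<open>{2, 3}\<close>, and
  then, by the next lemma, so are all further two-element layers, and no empty layer follows: the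
  strands through 2 and 3 alternate for ever.\<close>
lemma layers_after_empty:
  "\<forall>A\<in>set (layers 0). \<forall>B\<in>set (layers 2). \<forall>C\<in>set (filter (fits A B) (layers 2)).
   \<forall>D\<in>set (filter (fits B C) (layers 2)). C = L23 \<and> D = L23"
  by code_simp

lemma layer_23_persists: "\<forall>E\<in>set (filter (fits L23 L23) (layers 0 @ layers 2)). E = L23"
  by code_simp

text \<open>Two full layers after a one-element layer and before a layer of one or two elements leave only one
  pattern up to the symmetry that exchanges 0 with 1 and 2 with 3.\<close>
lemma layers_after_single:
  "\<forall>A\<in>set (layers 1). \<forall>B\<in>set (layers 2). \<forall>C\<in>set (filter (fits A B) (layers 2)).
   \<forall>D\<in>set (filter (fits B C) (layers 1 @ layers 2)). (A, B, C) \<in> {(L2, L02, L02), (L3, L13, L13)}"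
  by code_simp

text \<open>With \<open>X, Y\<close> as found before, full layers after \<open>X\<close> repeat \<open>Y\<close>, and a one-element layer that
  ends this run is \<open>Z\<close>. From \<open>Z\<close> there is no way back to \<open>X\<close>: not at once, not after one full
  layer, and after two full layers no layer of one or two elements fits any more.\<close>
lemma layers_of_run:
  "\<forall>(X, Y, Z)\<in>set [(L2, L02, L0), (L3, L13, L1)].
     (\<forall>E\<in>set (filter (fits Y Y) (layers 2)). E = Y) \<and> (\<forall>E\<in>set (filter (fits Y Y) (layers 1)). E = Z) \<and>
     \<not> fits Y Z X \<and>
     (\<forall>E\<in>set (filter (fits Y Z) (layers 2)). \<not> fits Z E X \<and>
        (\<forall>F\<in>set (filter (fits Z E) (layers 2)). filter (fits E F) (layers 1 @ layers 2) = []))"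
  by code_simp

lemma sum_eq_2_cases:
  fixes d :: "nat \<Rightarrow> nat"
  assumes "sum d {..<l} = 2"
  obtains s where "s < l" "d s = 2" "\<And>i. i < l \<Longrightarrow> i \<noteq> s \<Longrightarrow> d i = 0"
  | s t where "s < t" "t < l" "d s = 1" "d t = 1" "\<And>i. i < l \<Longrightarrow> i \<noteq> s \<Longrightarrow> i \<noteq> t \<Longrightarrow> d i = 0"
proof -
  obtain s where s: "s < l" "d s \<noteq> 0" using assms by (metis lessThan_iff sum.neutral zero_neq_numeral)
  have split: "d s + sum d ({..<l} - {s}) = 2" using assms s by (simp add: sum.remove)
  then consider "d s = 2" "sum d ({..<l} - {s}) = 0" | "d s = 1" "sum d ({..<l} - {s}) = 1"
    using s by linarith
  then show ?thesis
  proof cases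
    case 1
    then show ?thesis using that(1)[of s] s by simp
  next
    case 2
    then obtain t where t: "t \<in> {..<l} - {s}" "d t = 1" "\<And>b. b \<in> {..<l} - {s} \<Longrightarrow> t \<noteq> b \<Longrightarrow> d b = 0"
      using sum_eq_1_iff[of "{..<l} - {s}" d] by auto
    show ?thesis
    proof (cases "s < t")
      case True
      then show ?thesis using that(2)[of s t] t s 2 by auto
    next
      case False
      then show ?thesis using that(2)[of t s] t s 2 by auto
    qed
  qed
qed

text \<open>Every layer has at most two elements, so the deficits \<open>d i = 2 - size\<close> sum to 2. Either one
  layer is empty, and then following the layers around the ring shows that it is \<open>{2, 3}\<close>. Or two
  layers have one element. Since \<open>l \<ge> 5\<close>, at least two full layers lie between them on one side;
  following that side gives \<open>X, Y, \<dots>, Y, Z\<close>, and the other side cannot lead from \<open>Z\<close> back to \<open>X\<close>.\<close>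
lemma no_closed_layer_sequence:
  fixes S :: "nat \<Rightarrow> layer"
  assumes l: "5 \<le> l" and per: "\<And>i. S i = S (i mod l)"
    and fit: "\<And>i. fits (S i) (S (Suc i)) (S (Suc (Suc i)))"
    and sum: "(\<Sum>i<l. size_layer (S i)) = 2 * l - 2"
  shows False
proof -
  have le2: "size_layer (S i) \<le> 2" for i
  proof (rule ccontr)
    have any: "A \<in> set (concat (map layers [0..<5]))" for A :: layer
      by (cases A) (auto simp: in_layers)
    \<comment> \<open>The index is shifted by \<open>l\<close> so that the layer has a predecessor.\<close>
    have per1: "S (i + l) = S i" using per[of "i + l"] per[of i] by simp
    assume "\<not> ?thesis"
    moreover have "size_layer A \<le> 4" for A :: layer by (cases A) auto
    from this[of "S i"] calculation have "size_layer (S i) = 3 \<or> size_layer (S i) = 4" by linarith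
    then have "S (i + l) \<in> set (layers 3 @ layers 4)" unfolding per1 by (auto simp: in_layers)
    moreover have "fits (S (i + l - 1)) (S (i + l)) (S (Suc (i + l)))"
      using fit[of "i + l - 1"] l by simp
    ultimately show False using bspec[OF bspec[OF bspec[OF layer_at_most_2] any] any] by blast
  qed
  define d where "d i = 2 - size_layer (S i)" for i
  have dper: "d i = d (i mod l)" for i unfolding d_def by (subst per) (rule refl)
  have "sum d {..<l} + (\<Sum>i<l. size_layer (S i)) = (\<Sum>i<l. 2)"
    unfolding d_def sum.distrib[symmetric] using le2 by (intro sum.cong) auto
  then have "sum d {..<l} = 2" using sum l by simp
  note sum_d = this
  have empty: False if a: "s < l" "d s = 2" "\<And>i. i < l \<Longrightarrow> i \<noteq> s \<Longrightarrow> d i = 0" for s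
  proof -
    have two: "size_layer (S (s + i)) = 2" if "0 < i" "i < l" for i
    proof -
      have "(s + i) mod l \<noteq> s" using that a(1) by (cases "s + i < l") (auto simp: mod_if)
      then have "d (s + i) = 0" using a(3)[of "(s + i) mod l"] l dper[of "s + i"] by simp
      then show ?thesis using le2[of "s + i"] by (simp add: d_def)
    qed
    have zero: "size_layer (S s) = 0" using a(2) le2[of s] by (simp add: d_def)
    have start: "S (s + 2) = L23 \<and> S (s + 3) = L23"
    proof -
      have "S s \<in> set (layers 0)" "S (s + 1) \<in> set (layers 2)"
        "S (s + 2) \<in> set (filter (fits (S s) (S (s + 1))) (layers 2))"
        "S (s + 3) \<in> set (filter (fits (S (s + 1)) (S (s + 2))) (layers 2))"
        using zero two[of 1] two[of 2] two[of 3] l fit[of s] fit[of "s + 1"]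
        by (simp_all add: in_layers eval_nat_numeral)
      then show ?thesis using layers_after_empty by blast
    qed
    have run: "S (s + (i + 2)) = L23 \<and> S (s + (i + 3)) = L23" if "i + 3 \<le> l" for i
      using that
    proof (induction i)
      case 0
      then show ?case using start by simp
    next
      case (Suc i)
      then have IH: "S (s + (i + 2)) = L23" "S (s + (i + 3)) = L23" by auto
      have "size_layer (S (s + (i + 4))) \<in> {0, 2}"
      proof (cases "i + 4 = l")
        case True
        have "S (s + l) = S s" using per[of "s + l"] per[of s] by simp
        then show ?thesis using True zero by simp
      next
        case False
        then show ?thesis using two[of "i + 4"] Suc.prems by simp
      qed
      then have "S (s + (i + 4)) \<in> set (filter (fits L23 L23) (layers 0 @ layers 2))"
        using fit[of "s + (i + 2)"] IH by (auto simp: in_layers eval_nat_numeral)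
      then have "S (s + (i + 4)) = L23" using layer_23_persists by blast
      then show ?case using IH by (simp add: eval_nat_numeral)
    qed
    have "S (s + l) = S s" using per[of "s + l"] per[of s] by simp
    moreover have "S (s + l) = L23" using run[of "l - 3"] l by simp
    ultimately have "size_layer L23 = 0" using zero by metis
    then show False by simp
  qed
  have single: False
    if b: "3 \<le> p" "p < l" "d s = 1" "d (s + p) = 1" "\<And>i. 0 < i \<Longrightarrow> i < l \<Longrightarrow> i \<noteq> p \<Longrightarrow> d (s + i) = 0"
    for s p
  proof -
    have two: "size_layer (S (s + i)) = 2" if "0 < i" "i < l" "i \<noteq> p" for i
      using b(5)[OF that] le2[of "s + i"] by (simp add: d_def)
    have one: "size_layer (S s) = 1" "size_layer (S (s + p)) = 1"
      using b(3,4) le2[of s] le2[of "s + p"] by (simp_all add: d_def)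
    have "S s \<in> set (layers 1)" "S (s + 1) \<in> set (layers 2)"
      "S (s + 2) \<in> set (filter (fits (S s) (S (s + 1))) (layers 2))"
      using one two[of 1] two[of 2] b(1,2) fit[of s] by (simp_all add: in_layers)
    moreover have "size_layer (S (s + 3)) = 1 \<or> size_layer (S (s + 3)) = 2"
      using one(2) two[of 3] b(1) l by (cases "p = 3") auto
    then have "S (s + 3) \<in> set (filter (fits (S (s + 1)) (S (s + 2))) (layers 1 @ layers 2))"
      using fit[of "s + 1"] by (auto simp: in_layers eval_nat_numeral)
    ultimately have "(S s, S (s + 1), S (s + 2)) \<in> {(L2, L02, L02), (L3, L13, L13)}"
      using layers_after_single by blast
    then have "\<exists>X Y Z. (X, Y, Z) \<in> set [(L2, L02, L0), (L3, L13, L1)] \<and>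
      S s = X \<and> S (s + 1) = Y \<and> S (s + 2) = Y"
      by (elim insertE emptyE Pair_inject) (metis list.set_intros)+
    then obtain X Y Z where XYZ: "(X, Y, Z) \<in> set [(L2, L02, L0), (L3, L13, L1)]"
      "S s = X" "S (s + 1) = Y" "S (s + 2) = Y" by blast
    have run': "(\<forall>E\<in>set (filter (fits Y Y) (layers 2)). E = Y) \<and> (\<forall>E\<in>set (filter (fits Y Y) (layers 1)). E = Z) \<and>
     \<not> fits Y Z X \<and> (\<forall>E\<in>set (filter (fits Y Z) (layers 2)). \<not> fits Z E X \<and>
        (\<forall>F\<in>set (filter (fits Z E) (layers 2)). filter (fits E F) (layers 1 @ layers 2) = []))"
      using bspec[OF layers_of_run XYZ(1)] by simp
    have run: "S (s + (i + 1)) = Y \<and> S (s + (i + 2)) = Y" if "i + 2 < p" for i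
      using that
    proof (induction i)
      case 0
      then show ?case using XYZ by simp
    next
      case (Suc i)
      then have IH: "S (s + (i + 1)) = Y" "S (s + (i + 2)) = Y" by auto
      have "S (s + (i + 3)) \<in> set (filter (fits Y Y) (layers 2))"
        using fit[of "s + (i + 1)"] IH two[of "i + 3"] Suc.prems b(2)
        by (auto simp: in_layers eval_nat_numeral)
      then have "S (s + (i + 3)) = Y" using run' by blast
      then show ?case using IH by (simp add: eval_nat_numeral)
    qed
    obtain q where q: "p = q + 3" using b(1) by (metis add.commute le_Suc_ex)
    have Y: "S (s + (q + 1)) = Y" "S (s + (q + 2)) = Y" using run[of q] q by simp_all
    have "S (s + p) \<in> set (filter (fits Y Y) (layers 1))"
      using fit[of "s + (q + 1)"] Y one(2) q by (simp add: in_layers eval_nat_numeral)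
    then have Z: "S (s + p) = Z" using run' by blast
    have fY: "fits Y Z (S (s + (p + 1)))"
      using fit[of "s + (q + 2)"] Y Z q by (simp add: eval_nat_numeral)
    have fZ: "fits Z (S (s + (p + 1))) (S (s + (p + 2)))"
      using fit[of "s + p"] Z by (simp add: eval_nat_numeral)
    have sl: "S (s + l) = X" using per[of "s + l"] per[of s] XYZ(2) by simp
    have "p + 1 \<noteq> l" using fY sl run' by auto
    then have E: "S (s + (p + 1)) \<in> set (filter (fits Y Z) (layers 2))"
      using two[of "p + 1"] b(2) fY by (simp add: in_layers)
    have "p + 2 \<noteq> l"
    proof
      assume "p + 2 = l"
      then have "fits Z (S (s + (p + 1))) X" using fZ sl by simp
      then show False using bspec[OF conjunct2[OF conjunct2[OF conjunct2[OF run']]] E] by blast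
    qed
    then have F: "S (s + (p + 2)) \<in> set (filter (fits Z (S (s + (p + 1)))) (layers 2))"
      using two[of "p + 2"] b(2) fZ \<open>p + 1 \<noteq> l\<close> by (simp add: in_layers)
    have "size_layer (S (s + (p + 3))) = 1 \<or> size_layer (S (s + (p + 3))) = 2"
    proof (cases "p + 3 = l")
      case True
      then show ?thesis using sl XYZ(2) one(1) by simp
    next
      case False
      then show ?thesis using two[of "p + 3"] b(2) \<open>p + 1 \<noteq> l\<close> \<open>p + 2 \<noteq> l\<close> by simp
    qed
    then have H: "S (s + (p + 3)) \<in> set (filter (fits (S (s + (p + 1))) (S (s + (p + 2)))) (layers 1 @ layers 2))"
      using fit[of "s + (p + 1)"] by (auto simp: in_layers eval_nat_numeral)
    have "filter (fits (S (s + (p + 1))) (S (s + (p + 2)))) (layers 1 @ layers 2) = []"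
      using bspec[OF conjunct2[OF conjunct2[OF conjunct2[OF run']]] E] F by blast
    with H show False by (metis empty_iff list.set(1))
  qed
  have pair: False
    if c: "s < t" "t < l" "d s = 1" "d t = 1" "\<And>i. i < l \<Longrightarrow> i \<noteq> s \<Longrightarrow> i \<noteq> t \<Longrightarrow> d i = 0" for s t
  proof (cases "3 \<le> t - s")
    case True
    have "d (s + i) = 0" if i: "0 < i" "i < l" "i \<noteq> t - s" for i
    proof -
      have "(s + i) mod l < l" "(s + i) mod l \<noteq> s" "(s + i) mod l \<noteq> t"
        using i c(1,2) by (auto simp: mod_if)
      then show ?thesis using c(5) dper[of "s + i"] by simp
    qed
    moreover have "d (s + (t - s)) = 1" "t - s < l" using c by simp_all
    ultimately show ?thesis using single[of "t - s" s] True c(3) by blast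
  next
    case False
    obtain r where r: "t + r = s + l" "3 \<le> r" "r < l"
      using False l c by (intro that[of "l - (t - s)"]) auto
    have "d (t + i) = 0" if i: "0 < i" "i < l" "i \<noteq> r" for i
    proof -
      have "(t + i) mod l < l" "(t + i) mod l \<noteq> s" "(t + i) mod l \<noteq> t"
        using i r c(1,2) by (auto simp: mod_if)
      then show ?thesis using c(5) dper[of "t + i"] by simp
    qed
    moreover have "d (t + r) = 1" unfolding r(1) using c(3) dper[of "s + l"] c(1,2) by simp
    ultimately show ?thesis using single[OF r(2,3) c(4)] by blast
  qed
  show False
  proof (rule sum_eq_2_cases[OF sum_d])
    fix s assume "s < l" "d s = 2" "\<And>i. i < l \<Longrightarrow> i \<noteq> s \<Longrightarrow> d i = 0"
    then show False by (rule empty)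
  next
    fix s t assume "s < t" "t < l" "d s = 1" "d t = 1" "\<And>i. i < l \<Longrightarrow> i \<noteq> s \<Longrightarrow> i \<noteq> t \<Longrightarrow> d i = 0"
    then show False by (rule pair)
  qed
qed

section \<open>Rings without holes of a given even length\<close>

text \<open>Within a layer, all pairs of labels but \<open>{2, 3}\<close> are adjacent. Label \<open>a\<close> in one layer is
  adjacent to label \<open>b\<close> in the next one if \<open>up a b\<close>, that is, unless \<open>a = b\<close> or \<open>(a, b)\<close> is
  \<open>(0, 2)\<close> or \<open>(1, 3)\<close>.\<close>
definition inner :: "nat \<Rightarrow> nat \<Rightarrow> bool" where
  "inner a b \<longleftrightarrow> a \<noteq> b \<and> (a < 2 \<or> b < 2)"

definition up :: "nat \<Rightarrow> nat \<Rightarrow> bool" where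
  "up a b \<longleftrightarrow> a \<noteq> b \<and> \<not> (a < 2 \<and> b = a + 2)"

definition ring_adj :: "nat \<Rightarrow> nat \<times> nat \<Rightarrow> nat \<times> nat \<Rightarrow> bool" where
  "ring_adj l p q \<longleftrightarrow> fst p = fst q \<and> inner (snd p) (snd q)
     \<or> fst q = Suc (fst p) mod l \<and> up (snd p) (snd q)
     \<or> fst p = Suc (fst q) mod l \<and> up (snd q) (snd p)"

definition ring_graph :: "nat \<Rightarrow> (nat \<times> nat) graph" where
  "ring_graph l = graph_on ({..<l} \<times> {..<4}) (ring_adj l)"

lemma symp_ring_adj: "symp (ring_adj l)"
  by (auto simp: symp_def ring_adj_def inner_def)

lemma ring_edge_iff:
  "{p, q} \<in> edges (ring_graph l) \<longleftrightarrow> p \<in> {..<l} \<times> {..<4} \<and> q \<in> {..<l} \<times> {..<4} \<and> p \<noteq> q \<and> ring_adj l p q"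
  unfolding ring_graph_def by (rule edges_graph_on_iff[OF symp_ring_adj])

lemma verts_ring: "verts (ring_graph l) = {..<l} \<times> {..<4}"
  by (simp add: ring_graph_def)

lemma simple_ring: "simple_graph (ring_graph l)"
  by (simp add: ring_graph_def simple_graph_on)

lemma cycle_neighbours:
  assumes f: "embeds f (cycle_graph k) G" and k: "3 \<le> k" and v: "v \<in> f ` {..<k}"
  shows "card {w \<in> f ` {..<k}. {v, w} \<in> edges G} = 2"
proof -
  have f: "inj_on f {..<k}" "\<And>i j. i < k \<Longrightarrow> j < k \<Longrightarrow> {f i, f j} \<in> edges G \<longleftrightarrow> consecutive k i j"
    using f by (auto simp: embeds_cycle_iff)
  obtain i where i: "i < k" "v = f i" using v by blast
  define a b where "a = Suc i mod k" and "b = (if i = 0 then k - 1 else i - 1)"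
  have "consecutive k i j \<longleftrightarrow> j \<in> {a, b}" if "j < k" for j
    using that i(1) k by (auto simp: consecutive_def a_def b_def mod_Suc split: if_splits)
  then have "{w \<in> f ` {..<k}. {v, w} \<in> edges G} = f ` {a, b}"
    using i f(2)[OF i(1)] k by (auto simp: a_def b_def)
  moreover have "a \<noteq> b" "a < k" "b < k"
    using i(1) k by (auto simp: a_def b_def mod_Suc split: if_splits)
  ultimately show ?thesis using f(1) by (simp add: card_insert_if inj_on_eq_iff)
qed

lemma consecutive_cases:
  assumes "i < k" "j < k" "2 \<le> k"
  shows "consecutive k i j \<longleftrightarrow> j = Suc i \<or> i = Suc j \<or> (i = 0 \<and> Suc j = k) \<or> (j = 0 \<and> Suc i = k)"
  using assms by (auto simp: consecutive_def mod_Suc split: if_splits)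

lemma cycle_no_triangle:
  assumes f: "embeds f (cycle_graph k) G" and k: "4 \<le> k" and "x \<in> f ` {..<k}" "y \<in> f ` {..<k}" "z \<in> f ` {..<k}"
    and "{x, y} \<in> edges G" "{y, z} \<in> edges G" "{x, z} \<in> edges G"
  shows False
proof -
  obtain a b c where abc: "a < k" "b < k" "c < k" "x = f a" "y = f b" "z = f c" using assms by blast
  then have "consecutive k a b" "consecutive k b c" "consecutive k a c"
    using f assms by (auto simp: embeds_cycle_iff)
  then show False using abc k by (simp add: consecutive_cases) linarith
qed

lemma cycle_no_square:
  assumes f: "embeds f (cycle_graph k) G" and k: "5 \<le> k"
    and mem: "w \<in> f ` {..<k}" "x \<in> f ` {..<k}" "y \<in> f ` {..<k}" "z \<in> f ` {..<k}"
    and "{w, x} \<in> edges G" "{x, y} \<in> edges G" "{y, z} \<in> edges G" "{z, w} \<in> edges G" "w \<noteq> y" "x \<noteq> z"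
  shows False
proof -
  obtain a b c d where abc: "a < k" "b < k" "c < k" "d < k" "w = f a" "x = f b" "y = f c" "z = f d"
    using mem by blast
  then have "consecutive k a b" "consecutive k b c" "consecutive k c d" "consecutive k d a" "a \<noteq> c" "b \<noteq> d"
    using f assms by (auto simp: embeds_cycle_iff)
  then show False using abc k by (simp add: consecutive_cases) linarith
qed

text \<open>Turns a count of neighbours in a hole into the sum of truth values that occurs in \<open>fits\<close>.\<close>
lemma card_set_Int: "distinct xs \<Longrightarrow> card (set xs \<inter> S) = (\<Sum>x\<leftarrow>xs. of_bool (x \<in> S))"
proof -
  assume "distinct xs"
  then have "(\<Sum>x\<leftarrow>xs. of_bool (x \<in> S)) = (\<Sum>x\<in>set xs. of_bool (x \<in> S) :: nat)"
    by (rule sum_list_distinct_conv_sum_set)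
  also have "\<dots> = card (set xs \<inter> S)" by (simp add: sum.If_cases of_bool_def Int_def)
  finally show ?thesis by simp
qed

lemma less_4_cases: "(a::nat) < 4 \<longleftrightarrow> a = 0 \<or> a = 1 \<or> a = 2 \<or> a = 3"
  by auto

definition layer_of :: "(nat \<times> nat) set \<Rightarrow> nat \<Rightarrow> layer" where
  "layer_of S i = ((i, 0) \<in> S, (i, 1) \<in> S, (i, 2) \<in> S, (i, 3) \<in> S)"

lemma ring_layers_distinct:
  assumes "3 \<le> l" "i < l"
  shows "Suc i mod l < l" "Suc (Suc i) mod l < l" "Suc i mod l \<noteq> i" "Suc (Suc i) mod l \<noteq> i"
    "Suc i mod l \<noteq> Suc (Suc i) mod l"
  using assms by (auto simp: mod_Suc split: if_splits)

lemma ring_edge_from_layer: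
  assumes l: "3 \<le> l" and i: "i < l"
  shows "{(Suc i mod l, a), (j, b)} \<in> edges (ring_graph l) \<longleftrightarrow> a < 4 \<and> b < 4 \<and>
      (j = Suc i mod l \<and> inner a b \<or> j = Suc (Suc i) mod l \<and> up a b \<or> j = i \<and> up b a)"
proof -
  define u where "u = Suc i mod l"
  define t where "t = Suc (Suc i) mod l"
  have "Suc u mod l = t" by (simp add: u_def t_def mod_Suc_eq)
  moreover have "u = Suc j mod l \<longleftrightarrow> j = i" if "j < l" for j
    using that i by (auto simp: u_def mod_Suc split: if_splits)
  moreover have "u < l" "t < l" "u \<noteq> t" "u \<noteq> i" "t \<noteq> i"
    unfolding u_def t_def using ring_layers_distinct[OF l i] by auto
  ultimately have "{(u, a), (j, b)} \<in> edges (ring_graph l) \<longleftrightarrow> a < 4 \<and> b < 4 \<and>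
      (j = u \<and> inner a b \<or> j = t \<and> up a b \<or> j = i \<and> up b a)"
    using i by (auto simp: ring_edge_iff ring_adj_def inner_def)
  then show ?thesis by (simp add: u_def t_def)
qed

text \<open>The local conditions hold because a vertex of a hole has two neighbours on it
  (\<open>cycle_neighbours\<close>), and a hole with at least five vertices contains neither a triangle nor a
  cycle of length 4.\<close>
lemma cycle_fits:
  assumes f: "embeds f (cycle_graph k) (ring_graph l)" and k: "5 \<le> k" and l: "3 \<le> l" and i: "i < l"
  defines "S \<equiv> f ` {..<k}"
  shows "fits (layer_of S i) (layer_of S (Suc i mod l)) (layer_of S (Suc (Suc i) mod l))"
proof -
  define u where "u = Suc i mod l"
  define t where "t = Suc (Suc i) mod l"
  have ne: "u \<noteq> t" "u \<noteq> i" "t \<noteq> i" unfolding u_def t_def using ring_layers_distinct[OF l i] by auto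
  have deg: "card {w \<in> S. {v, w} \<in> edges (ring_graph l)} = 2" if "v \<in> S" for v
    using cycle_neighbours[OF f _ that[unfolded S_def]] k by (simp add: S_def)
  have e: "{(u, a), (j, b)} \<in> edges (ring_graph l) \<longleftrightarrow> a < 4 \<and> b < 4 \<and>
      (j = u \<and> inner a b \<or> j = t \<and> up a b \<or> j = i \<and> up b a)" for a j b
    unfolding u_def t_def by (rule ring_edge_from_layer[OF l i])
  have split: "{w \<in> S. {(u, a), w} \<in> edges (ring_graph l)} =
      (Pair i ` {b. b < 4 \<and> up b a} \<union> Pair u ` {b. b < 4 \<and> inner a b} \<union> Pair t ` {b. b < 4 \<and> up a b}) \<inter> S"
    if "a < 4" for a
    using that by (auto simp: e)
  have sets: "{b. b < 4 \<and> up b 0} = {1, 2, 3}" "{b. b < 4 \<and> inner 0 b} = {1, 2, 3}" "{b. b < 4 \<and> up 0 b} = {1, 3}"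
    "{b. b < 4 \<and> up b 1} = {0, 2, 3}" "{b. b < 4 \<and> inner 1 b} = {0, 2, 3}" "{b. b < 4 \<and> up 1 b} = {0, 2}"
    "{b. b < 4 \<and> up b 2} = {1, 3}" "{b. b < 4 \<and> inner 2 b} = {0, 1}" "{b. b < 4 \<and> up 2 b} = {0, 1, 3}"
    "{b. b < 4 \<and> up b 3} = {0, 2}" "{b. b < 4 \<and> inner 3 b} = {0, 1}" "{b. b < 4 \<and> up 3 b} = {0, 1, 2}"
    by (auto simp: up_def inner_def less_4_cases)
  have N: "{w \<in> S. {(u, 0), w} \<in> edges (ring_graph l)} =
      {(i, 1), (i, 2), (i, 3), (u, 1), (u, 2), (u, 3), (t, 1), (t, 3)} \<inter> S"
    "{w \<in> S. {(u, 1), w} \<in> edges (ring_graph l)} =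
      {(i, 0), (i, 2), (i, 3), (u, 0), (u, 2), (u, 3), (t, 0), (t, 2)} \<inter> S"
    "{w \<in> S. {(u, 2), w} \<in> edges (ring_graph l)} =
      {(i, 1), (i, 3), (u, 0), (u, 1), (t, 0), (t, 1), (t, 3)} \<inter> S"
    "{w \<in> S. {(u, 3), w} \<in> edges (ring_graph l)} =
      {(i, 0), (i, 2), (u, 0), (u, 1), (t, 0), (t, 1), (t, 2)} \<inter> S"
    using split[of 0] split[of 1] split[of 2] split[of 3] unfolding sets by (simp_all add: insert_commute)
  have tri: "\<not> ((u, 0) \<in> S \<and> (u, 1) \<in> S \<and> (u, x) \<in> S)" if "x = 2 \<or> x = 3" for x
    using cycle_no_triangle[OF f, folded S_def, of "(u, 0)" "(u, 1)" "(u, x)"] k that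
    by (auto simp: e inner_def)
  have sq: "\<not> ((u, x) \<in> S \<and> (u, 2) \<in> S \<and> (u, 3) \<in> S \<and> (t, x) \<in> S)" if "x = 0 \<or> x = 1" for x
  proof
    assume mem: "(u, x) \<in> S \<and> (u, 2) \<in> S \<and> (u, 3) \<in> S \<and> (t, x) \<in> S"
    have "{(u, x), (u, 2)} \<in> edges (ring_graph l)" "{(u, 2), (t, x)} \<in> edges (ring_graph l)"
      "{(u, 3), (t, x)} \<in> edges (ring_graph l)" "{(u, 3), (u, x)} \<in> edges (ring_graph l)"
      using that by (auto simp: e inner_def up_def)
    then show False
      using cycle_no_square[OF f k, folded S_def, of "(u, x)" "(u, 2)" "(t, x)" "(u, 3)"] mem ne
      by (simp add: insert_commute)
  qed
  have count: "card ({(i, 1), (i, 2), (i, 3), (u, 1), (u, 2), (u, 3), (t, 1), (t, 3)} \<inter> S) = 2" if "(u, 0) \<in> S"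
    using deg[OF that] N(1) by simp
  have count1: "card ({(i, 0), (i, 2), (i, 3), (u, 0), (u, 2), (u, 3), (t, 0), (t, 2)} \<inter> S) = 2" if "(u, 1) \<in> S"
    using deg[OF that] N(2) by simp
  have count2: "card ({(i, 1), (i, 3), (u, 0), (u, 1), (t, 0), (t, 1), (t, 3)} \<inter> S) = 2" if "(u, 2) \<in> S"
    using deg[OF that] N(3) by simp
  have count3: "card ({(i, 0), (i, 2), (u, 0), (u, 1), (t, 0), (t, 1), (t, 2)} \<inter> S) = 2" if "(u, 3) \<in> S"
    using deg[OF that] N(4) by simp
  have "fits (layer_of S i) (layer_of S u) (layer_of S t)"
    unfolding layer_of_def fits.simps
  proof (intro conjI impI)
    show "\<not> ((u, 0) \<in> S \<and> (u, 1) \<in> S \<and> (u, 2) \<in> S)" "\<not> ((u, 0) \<in> S \<and> (u, 1) \<in> S \<and> (u, 3) \<in> S)"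
      using tri by blast+
    show "\<not> ((u, 0) \<in> S \<and> (u, 2) \<in> S \<and> (u, 3) \<in> S \<and> (t, 0) \<in> S)"
      "\<not> ((u, 1) \<in> S \<and> (u, 2) \<in> S \<and> (u, 3) \<in> S \<and> (t, 1) \<in> S)"
      using sq by blast+
  next
    assume "(u, 0) \<in> S"
    from count[OF this] have "card (set [(i, 1), (i, 2), (i, 3), (u, 1), (u, 2), (u, 3), (t, 1), (t, 3)] \<inter> S) = 2" by simp
    then have "(\<Sum>x\<leftarrow>[(i, 1), (i, 2), (i, 3), (u, 1), (u, 2), (u, 3), (t, 1), (t, 3)]. of_bool (x \<in> S)) = (2 :: nat)"
      using ne by (subst card_set_Int[symmetric]) simp_all
    then show "of_bool ((i, 1) \<in> S) + of_bool ((i, 2) \<in> S) + of_bool ((i, 3) \<in> S) +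
      of_bool ((u, 1) \<in> S) + of_bool ((u, 2) \<in> S) + of_bool ((u, 3) \<in> S) + of_bool ((t, 1) \<in> S) +
      of_bool ((t, 3) \<in> S) = (2 :: nat)"
      by (simp only: list.map sum_list.Cons sum_list.Nil add.assoc add_0_right)
  next
    assume "(u, 1) \<in> S"
    from count1[OF this] have "card (set [(i, 0), (i, 2), (i, 3), (u, 0), (u, 2), (u, 3), (t, 0), (t, 2)] \<inter> S) = 2" by simp
    then have "(\<Sum>x\<leftarrow>[(i, 0), (i, 2), (i, 3), (u, 0), (u, 2), (u, 3), (t, 0), (t, 2)]. of_bool (x \<in> S)) = (2 :: nat)"
      using ne by (subst card_set_Int[symmetric]) simp_all
    then show "of_bool ((i, 0) \<in> S) + of_bool ((i, 2) \<in> S) + of_bool ((i, 3) \<in> S) +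
      of_bool ((u, 0) \<in> S) + of_bool ((u, 2) \<in> S) + of_bool ((u, 3) \<in> S) + of_bool ((t, 0) \<in> S) +
      of_bool ((t, 2) \<in> S) = (2 :: nat)"
      by (simp only: list.map sum_list.Cons sum_list.Nil add.assoc add_0_right)
  next
    assume "(u, 2) \<in> S"
    from count2[OF this] have "card (set [(i, 1), (i, 3), (u, 0), (u, 1), (t, 0), (t, 1), (t, 3)] \<inter> S) = 2" by simp
    then have "(\<Sum>x\<leftarrow>[(i, 1), (i, 3), (u, 0), (u, 1), (t, 0), (t, 1), (t, 3)]. of_bool (x \<in> S)) = (2 :: nat)"
      using ne by (subst card_set_Int[symmetric]) simp_all
    then show "of_bool ((i, 1) \<in> S) + of_bool ((i, 3) \<in> S) + of_bool ((u, 0) \<in> S) +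
      of_bool ((u, 1) \<in> S) + of_bool ((t, 0) \<in> S) + of_bool ((t, 1) \<in> S) + of_bool ((t, 3) \<in> S) = (2 :: nat)"
      by (simp only: list.map sum_list.Cons sum_list.Nil add.assoc add_0_right)
  next
    assume "(u, 3) \<in> S"
    from count3[OF this] have "card (set [(i, 0), (i, 2), (u, 0), (u, 1), (t, 0), (t, 1), (t, 2)] \<inter> S) = 2" by simp
    then have "(\<Sum>x\<leftarrow>[(i, 0), (i, 2), (u, 0), (u, 1), (t, 0), (t, 1), (t, 2)]. of_bool (x \<in> S)) = (2 :: nat)"
      using ne by (subst card_set_Int[symmetric]) simp_all
    then show "of_bool ((i, 0) \<in> S) + of_bool ((i, 2) \<in> S) + of_bool ((u, 0) \<in> S) +
      of_bool ((u, 1) \<in> S) + of_bool ((t, 0) \<in> S) + of_bool ((t, 1) \<in> S) + of_bool ((t, 2) \<in> S) = (2 :: nat)"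
      by (simp only: list.map sum_list.Cons sum_list.Nil add.assoc add_0_right)
  qed
  then show ?thesis by (simp add: u_def t_def)
qed

lemma no_cycle_in_ring:
  assumes l: "5 \<le> l"
  shows "\<not> embeds f (cycle_graph (2 * l - 2)) (ring_graph l)"
proof
  let ?k = "2 * l - 2"
  assume f: "embeds f (cycle_graph ?k) (ring_graph l)"
  define S where "S = f ` {..<?k}"
  have S: "S \<subseteq> {..<l} \<times> {..<4}" "card S = ?k"
    using f by (auto simp: S_def embeds_cycle_iff verts_ring card_image)
  define L where "L i = layer_of S (i mod l)" for i
  have per: "L i = L (i mod l)" for i by (simp add: L_def)
  have fit: "fits (L i) (L (Suc i)) (L (Suc (Suc i)))" for i
  proof -
    have "i mod l < l" using l by simp
    from cycle_fits[OF f _ _ this] show ?thesis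
      using l by (simp add: L_def S_def mod_Suc_eq mod_Suc_Suc_eq)
  qed
  have "size_layer (layer_of S i) = card {a. a < 4 \<and> (i, a) \<in> S}" for i
  proof -
    have "size_layer (layer_of S i) = (\<Sum>a\<leftarrow>[0, 1, 2, 3]. of_bool (a \<in> {a. (i, a) \<in> S}))"
      by (simp add: layer_of_def)
    also have "\<dots> = card (set [0, 1, 2, 3] \<inter> {a. (i, a) \<in> S})" by (subst card_set_Int) simp_all
    also have "set [0, 1, 2, 3] \<inter> {a. (i, a) \<in> S} = {a. a < 4 \<and> (i, a) \<in> S}" by (auto simp: less_4_cases)
    finally show ?thesis .
  qed
  then have "(\<Sum>i<l. size_layer (L i)) = (\<Sum>i<l. card {a. a < 4 \<and> (i, a) \<in> S})"
    by (simp add: L_def)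
  also have "\<dots> = card (Sigma {..<l} (\<lambda>i. {a. a < 4 \<and> (i, a) \<in> S}))" by simp
  also have "Sigma {..<l} (\<lambda>i. {a. a < 4 \<and> (i, a) \<in> S}) = S" using S(1) by auto
  finally have "(\<Sum>i<l. size_layer (L i)) = 2 * l - 2" using S(2) by simp
  then show False by (rule no_closed_layer_sequence[OF l per fit])
qed

section \<open>Holes in rings after deletion of an edge\<close>

text \<open>With the layers in increasing order, the adjacency modulo \<open>l\<close> reduces to three cases; the
  last one is the seam between the last layer and layer 0.\<close>
lemma ring_edge_le:
  assumes l: "3 \<le> l" and ij: "i \<le> j" "j < l" and ab: "a < 4" "b < 4"
  shows "{(i, a), (j, b)} \<in> edges (ring_graph l) \<longleftrightarrow>
    i = j \<and> inner a b \<or> j = Suc i \<and> up a b \<or> i = 0 \<and> Suc j = l \<and> up b a"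
proof -
  have "j = Suc i mod l \<longleftrightarrow> j = Suc i" "i = Suc j mod l \<longleftrightarrow> i = 0 \<and> Suc j = l"
    using l ij by (auto simp: mod_Suc split: if_splits)
  then show ?thesis using ij ab by (auto simp: ring_edge_iff ring_adj_def inner_def)
qed

lemma ring_hole:
  assumes k: "2 \<le> k" and mem: "\<And>i. i < k \<Longrightarrow> f i \<in> {..<l} \<times> {..<4}"
    and step: "\<And>i j. i < j \<Longrightarrow> j < k \<Longrightarrow> f i \<noteq> f j \<and>
      ({f i, f j} \<in> edges (ring_graph l) \<and> {f i, f j} \<noteq> e \<longleftrightarrow> j = Suc i \<or> i = 0 \<and> Suc j = k)"
  shows "embeds f (cycle_graph k) (delete_edge (ring_graph l) e)"
proof (rule embeds_cycleI)
  show "inj_on f {..<k}" using step by (intro linorder_inj_onI') auto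
  show "f ` {..<k} \<subseteq> verts (delete_edge (ring_graph l) e)"
    unfolding verts_delete_edge verts_ring using mem by blast
qed (use k step in \<open>simp_all add: simple_delete_edge simple_ring\<close>)

text \<open>Adjacency without the seam, which is enough for vertices in the first four layers.\<close>
definition near_layer :: "nat \<times> nat \<Rightarrow> nat \<times> nat \<Rightarrow> bool" where
  "near_layer p q \<longleftrightarrow> fst p = fst q \<and> inner (snd p) (snd q) \<or> fst q = Suc (fst p) \<and> up (snd p) (snd q)
     \<or> fst p = Suc (fst q) \<and> up (snd q) (snd p)"

text \<open>The path \<open>P\<close> from \<open>(0, 0)\<close> to \<open>(3, 2)\<close> in the first four layers is induced once the edge
  \<open>{x, y}\<close> is deleted. In layer 3 it has otherwise at most \<open>(3, 0)\<close>, which is adjacent to neither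
  0 nor 2 in layer 4, and in layer 0 at most \<open>(0, 2)\<close>, which is adjacent to neither 0 nor 2 in the
  last layer. So \<open>P\<close> interacts with the rest of a ring only at its ends.\<close>
definition valid_start :: "(nat \<times> nat) list \<Rightarrow> nat \<times> nat \<Rightarrow> nat \<times> nat \<Rightarrow> bool" where
  "valid_start P x y \<longleftrightarrow> length P = 6 \<and> distinct P \<and> (\<forall>p\<in>set P. fst p < 4 \<and> snd p < 4) \<and>
     P ! 0 = (0, 0) \<and> P ! 5 = (3, 2) \<and> x \<in> set P \<and> y \<in> set P \<and>
     (\<forall>i\<in>set [0..<6]. (fst (P ! i) = 0 \<longrightarrow> i = 0 \<or> P ! i = (0, 2)) \<and> (fst (P ! i) = 3 \<longrightarrow> i = 5 \<or> P ! i = (3, 0))) \<and>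
     (\<forall>j\<in>set [0..<6]. \<forall>i\<in>set [0..<j]. (near_layer (P ! i) (P ! j) \<and> {P ! i, P ! j} \<noteq> {x, y}) = (j = Suc i))"

text \<open>One path for each of six kinds of edges.\<close>
lemma starts_valid:
  "\<forall>(P, x, y)\<in>set
     [([(0,0), (1,1), (2,2), (3,0), (2,3), (3,2)], (3,0), (3,2)),
      ([(0,0), (1,3), (2,0), (1,2), (2,3), (3,2)], (2,0), (2,3)),
      ([(0,0), (0,2), (1,1), (2,2), (3,0), (3,2)], (0,0), (1,1)),
      ([(0,0), (0,2), (1,3), (2,2), (3,0), (3,2)], (0,0), (1,3)),
      ([(0,0), (1,3), (2,2), (2,0), (2,3), (3,2)], (1,3), (2,0)),
      ([(0,0), (1,3), (2,0), (2,2), (3,0), (3,2)], (1,3), (2,2))]. valid_start P x y"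
  by code_simp

text \<open>Continues \<open>P\<close> by \<open>(4, 0), (4, 2), (5, 0), (5, 2), \<dots>\<close>. In the last layer \<open>l - 1\<close> this ends
  with \<open>(l - 1, 2)\<close>, which is adjacent to \<open>(0, 0)\<close>.\<close>
definition strand :: "(nat \<times> nat) list \<Rightarrow> nat \<Rightarrow> nat \<times> nat" where
  "strand P j = (if j < 6 then P ! j else (4 + (j - 6) div 2, if even j then 0 else 2))"

lemma strand_cases:
  assumes "6 \<le> j"
  obtains m where "j = 6 + 2 * m" "strand P j = (4 + m, 0)"
  | m where "j = 7 + 2 * m" "strand P j = (4 + m, 2)"
proof (cases "even j")
  case True
  then obtain n where "j = 2 * n" by (rule evenE)
  then show ?thesis using assms by (intro that(1)[of "n - 3"]) (auto simp: strand_def)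
next
  case False
  then obtain n where "j = 2 * n + 1" by (rule oddE)
  then show ?thesis using assms by (intro that(2)[of "n - 3"]) (auto simp: strand_def)
qed

lemma single_strand_hole:
  assumes l: "5 \<le> l" and P: "valid_start P x y"
  shows "embeds (strand P) (cycle_graph (2 * l - 2)) (delete_edge (ring_graph l) {x, y})"
proof (rule ring_hole)
  have len: "length P = 6" and dist: "distinct P"
    and bound: "\<And>i. i < 6 \<Longrightarrow> fst (P ! i) < 4 \<and> snd (P ! i) < 4"
    and ends: "P ! 0 = (0, 0)" "P ! 5 = (3, 2)" and xy: "x \<in> set P" "y \<in> set P"
    and first: "\<And>i. i < 6 \<Longrightarrow> fst (P ! i) = 0 \<Longrightarrow> i = 0 \<or> P ! i = (0, 2)"
    and last: "\<And>i. i < 6 \<Longrightarrow> fst (P ! i) = 3 \<Longrightarrow> i = 5 \<or> P ! i = (3, 0)"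
    and inside: "\<And>i j. i < j \<Longrightarrow> j < 6 \<Longrightarrow> near_layer (P ! i) (P ! j) \<and> {P ! i, P ! j} \<noteq> {x, y} \<longleftrightarrow> j = Suc i"
    using P by (auto simp: valid_start_def all_set_conv_all_nth)
  have low: "fst x < 4" "fst y < 4" using xy P by (auto simp: valid_start_def)
  show "2 \<le> 2 * l - 2" using l by simp
  show "strand P i \<in> {..<l} \<times> {..<4}" if "i < 2 * l - 2" for i
  proof (cases "i < 6")
    case True
    then show ?thesis using bound[OF True] l by (cases "P ! i") (simp add: strand_def)
  next
    case False
    then have "6 \<le> i" by simp
    then show ?thesis using that by (cases i rule: strand_cases[of _ P]) auto
  qed
  fix i j assume ij: "i < j" "j < 2 * l - 2"
  let ?E = "\<lambda>p q. {p, q} \<in> edges (ring_graph l)"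
  show "strand P i \<noteq> strand P j \<and>
     (?E (strand P i) (strand P j) \<and> {strand P i, strand P j} \<noteq> {x, y} \<longleftrightarrow> j = Suc i \<or> i = 0 \<and> Suc j = 2 * l - 2)"
  proof (cases "j < 6")
    case True
    have ne: "P ! i \<noteq> P ! j" using dist len True ij by (simp add: nth_eq_iff_index_eq)
    obtain a b c d where ab: "P ! i = (a, b)" "P ! j = (c, d)" by fastforce
    then have "?E (P ! i) (P ! j) \<longleftrightarrow> near_layer (P ! i) (P ! j)"
      using ne bound[of i] bound[of j] True ij l ring_edge_le[of l a c b d] ring_edge_le[of l c a d b]
      by (cases "a \<le> c") (auto simp: near_layer_def insert_commute inner_def)
    then show ?thesis using ne inside[OF ij(1) True] True ij l by (auto simp: strand_def)
  next
    case False
    then have j6: "6 \<le> j" by simp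
    then obtain m c where m: "strand P j = (4 + m, c)" "j = 6 + 2 * m \<and> c = 0 \<or> j = 7 + 2 * m \<and> c = 2"
      by (cases j rule: strand_cases[of _ P]) auto
    then have ml: "4 + m < l" "c < 4" using ij by auto
    have noxy: "{strand P i, strand P j} \<noteq> {x, y}" using low m(1) by (auto simp: doubleton_eq_iff)
    show ?thesis
    proof (cases "i < 6")
      case True
      obtain a b where ab: "P ! i = (a, b)" by fastforce
      have ab4: "a < 4" "b < 4" using bound[OF True] ab by simp_all
      have E: "?E (strand P i) (strand P j) \<longleftrightarrow> a = 3 \<and> m = 0 \<and> up b c \<or> a = 0 \<and> m + 5 = l \<and> up c b"
        using ring_edge_le[of l a "4 + m" b c] l ab4 ml True ab m(1) by (auto simp: strand_def)
      have corner: "a = 3 \<Longrightarrow> i = 5 \<or> b = 0" "a = 0 \<Longrightarrow> i = 0 \<or> b = 2"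
        "i = 5 \<Longrightarrow> a = 3 \<and> b = 2" "i = 0 \<Longrightarrow> a = 0 \<and> b = 0"
        using first[OF True] last[OF True] ab ends by auto
      \<comment> \<open>The only adjacencies between \<open>P\<close> and its continuation are
         \<open>(3, 2)\<close> with \<open>(4, 0)\<close> and \<open>(0, 0)\<close> with \<open>(l - 1, 2)\<close>.\<close>
      have "(a = 3 \<and> m = 0 \<and> up b c \<or> a = 0 \<and> m + 5 = l \<and> up c b) \<longleftrightarrow> j = Suc i \<or> i = 0 \<and> Suc j = 2 * l - 2"
      proof -
        have c02: "c = 0 \<or> c = 2" using m(2) by auto
        consider "i = 5" "a = 3" "b = 2" | "i = 0" "a = 0" "b = 0" | "i \<noteq> 5" "i \<noteq> 0" "a = 3" "b = 0"
          | "i \<noteq> 5" "i \<noteq> 0" "a = 0" "b = 2" | "i \<noteq> 5" "i \<noteq> 0" "a \<noteq> 0" "a \<noteq> 3"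
          using corner by (cases "a = 3"; cases "a = 0"; cases "i = 5"; cases "i = 0") auto
        then show ?thesis
          by cases (use m(2) c02 True j6 l ml(1) in \<open>simp_all add: up_def, arith+\<close>)
      qed
      moreover have "strand P i \<noteq> strand P j" using ab4 ab m(1) True by (auto simp: strand_def)
      ultimately show ?thesis using E noxy by blast
    next
      case False
      then have "6 \<le> i" by simp
      then obtain n d where n: "strand P i = (4 + n, d)" "i = 6 + 2 * n \<and> d = 0 \<or> i = 7 + 2 * n \<and> d = 2"
        by (cases i rule: strand_cases[of _ P]) auto
      have nm: "n \<le> m" using n m(2) ij by auto
      have "?E (strand P i) (strand P j) \<longleftrightarrow> n = m \<and> inner d c \<or> m = Suc n \<and> up d c"
        using ring_edge_le[of l "4 + n" "4 + m" d c] l nm ml n m(1) by auto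
      also have "\<dots> \<longleftrightarrow> j = Suc i"
        using n(2) m(2)
        by (elim disjE conjE) (use ij in \<open>simp_all add: inner_def up_def, arith+\<close>)
      finally have E: "?E (strand P i) (strand P j) \<longleftrightarrow> j = Suc i" .
      have "strand P i \<noteq> strand P j"
        unfolding n(1) m(1) using n(2) m(2) by (elim disjE conjE) (use ij in simp_all)
      moreover have "i \<noteq> 0" using \<open>6 \<le> i\<close> by simp
      ultimately show ?thesis using noxy E by blast
    qed
  qed
qed

text \<open>Two disjoint strands that run through the layers side by side. They start at the labels 0
  and 1 in layer 0 and alternate between the labels 3 and 2 afterwards. Since 2 and 3 are not
  adjacent within a layer, and from one layer to the next equal labels are not adjacent, nor is 0
  to 2 or 1 to 3, the only edge between the strands is the one in layer 0.\<close>
definition left :: "nat \<Rightarrow> nat" where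
  "left i = (if i = 0 then 0 else if odd i then 3 else 2)"

definition right :: "nat \<Rightarrow> nat" where
  "right i = (if i = 0 then 1 else if odd i then 2 else 3)"

lemma strands_less_4: "left i < 4" "right i < 4"
  by (simp_all add: left_def right_def)

lemma two_strand_edges:
  assumes l: "5 \<le> l" and ij: "i \<le> l - 3" "j \<le> l - 3"
  shows "i < j \<Longrightarrow> {(i, left i), (j, left j)} \<in> edges (ring_graph l) \<longleftrightarrow> j = Suc i"
    "i < j \<Longrightarrow> {(i, right i), (j, right j)} \<in> edges (ring_graph l) \<longleftrightarrow> j = Suc i"
    "{(i, left i), (j, right j)} \<in> edges (ring_graph l) \<longleftrightarrow> i = 0 \<and> j = 0"
proof -
  have e: "{(i, a), (j, b)} \<in> edges (ring_graph l) \<longleftrightarrow>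
      i = j \<and> inner a b \<or> j = Suc i \<and> up a b" if "i \<le> j" "j \<le> l - 3" "a < 4" "b < 4" for i j a b
    using ring_edge_le[of l i j a b] that l by auto
  show "{(i, left i), (j, left j)} \<in> edges (ring_graph l) \<longleftrightarrow> j = Suc i" if "i < j"
    using that ij e[of i j "left i" "left j"] strands_less_4 by (auto simp: left_def up_def)
  show "{(i, right i), (j, right j)} \<in> edges (ring_graph l) \<longleftrightarrow> j = Suc i" if "i < j"
    using that ij e[of i j "right i" "right j"] strands_less_4 by (auto simp: right_def up_def)
  show "{(i, left i), (j, right j)} \<in> edges (ring_graph l) \<longleftrightarrow> i = 0 \<and> j = 0"
  proof (cases "i \<le> j")
    case True
    then show ?thesis using ij e[of i j "left i" "right j"] strands_less_4
      by (auto simp: left_def right_def up_def inner_def)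
  next
    case False
    then show ?thesis using ij e[of j i "right j" "left i"] strands_less_4
      by (auto simp: left_def right_def up_def inner_def insert_commute)
  qed
qed

text \<open>Up the left strand to layer \<open>n\<close>, over \<open>(n + 1, 0)\<close>, which is adjacent to both labels 2 and 3
  below it, and back down the right strand. As \<open>n + 3\<close> is the number of layers, the remaining
  vertex \<open>(n + 2, 2)\<close> is in the last layer; it is adjacent to both \<open>(0, 0)\<close> and \<open>(0, 1)\<close>, whose
  edge has to be deleted.\<close>
definition loop_01 :: "nat \<Rightarrow> nat \<Rightarrow> nat \<times> nat" where
  "loop_01 n j = (if j \<le> n then (j, left j) else if j = n + 1 then (n + 1, 0)
     else if j \<le> 2 * n + 2 then (2 * n + 2 - j, right (2 * n + 2 - j)) else (n + 2, 2))"

lemma hole_01: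
  assumes n: "2 \<le> n"
  shows "embeds (loop_01 n) (cycle_graph (2 * n + 4)) (delete_edge (ring_graph (n + 3)) {(0, 0), (0, 1)})"
proof (rule ring_hole)
  let ?l = "n + 3"
  let ?E = "\<lambda>p q. {p, q} \<in> edges (ring_graph ?l)"
  have "5 \<le> ?l" using n by simp
  note two = two_strand_edges[OF this, simplified]
  have X: "?E (i, a) (n + 1, 0) \<longleftrightarrow> i = n \<and> up a 0" if "i \<le> n" "a < 4" for i a
    using ring_edge_le[of ?l i "n + 1" a 0] that n by auto
  have Y: "?E (i, a) (n + 2, 2) \<longleftrightarrow> i = 0 \<and> up 2 a" if "i \<le> n" "a < 4" for i a
    using ring_edge_le[of ?l i "n + 2" a 2] that n by auto
  have XY: "\<not> ?E (n + 1, 0) (n + 2, 2)"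
    using ring_edge_le[of ?l "n + 1" "n + 2" 0 2] n by (auto simp: up_def inner_def)
  show "loop_01 n i \<in> {..<?l} \<times> {..<4}" if "i < 2 * n + 4" for i
    using that strands_less_4 by (auto simp: loop_01_def)
  fix i j assume ij: "i < j" "j < 2 * n + 4"
  have ups: "up (left n) 0" "up (right n) 0" "up 2 (left 0)" "up 2 (right 0)"
    using n by (auto simp: left_def right_def up_def)
  have lr: "left i \<noteq> right i" for i by (simp add: left_def right_def)
  have e: "{(a, left a), (b, right b)} = {(0, 0), (0, 1)} \<longleftrightarrow> a = 0 \<and> b = 0"
    "{(a, left a), (b, left b)} \<noteq> {(0, 0), (0, 1)}" "{(a, right a), (b, right b)} \<noteq> {(0, 0), (0, 1)}" for a b
    by (auto simp: doubleton_eq_iff left_def right_def split: if_splits)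
  have V: "j \<le> n \<Longrightarrow> loop_01 n j = (j, left j)" "loop_01 n (n + 1) = (n + 1, 0)"
    "b \<le> n \<Longrightarrow> loop_01 n (2 * n + 2 - b) = (b, right b)" "loop_01 n (2 * n + 3) = (n + 2, 2)" for j b
    by (auto simp: loop_01_def)
  consider "j \<le> n" | "i \<le> n" "j = n + 1" | b where "i \<le> n" "j = 2 * n + 2 - b" "b \<le> n"
    | "i \<le> n" "j = 2 * n + 3" | b where "i = n + 1" "j = 2 * n + 2 - b" "b \<le> n" | "i = n + 1" "j = 2 * n + 3"
    | a b where "i = 2 * n + 2 - a" "j = 2 * n + 2 - b" "b < a" "a \<le> n"
    | a where "i = 2 * n + 2 - a" "a \<le> n" "j = 2 * n + 3"
  proof -
    show ?thesis
    proof (cases "j \<le> n \<or> j = n + 1 \<or> j = 2 * n + 3")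
      case True
      then show ?thesis using ij that(1,2,4,6) that(8)[of "2 * n + 2 - i"] by fastforce
    next
      case False
      define b where "b = 2 * n + 2 - j"
      have b: "j = 2 * n + 2 - b" "b \<le> n" using False ij by (auto simp: b_def)
      then show ?thesis using ij False that(3)[of b] that(5)[of b] that(7)[of "2 * n + 2 - i" b] by fastforce
    qed
  qed
  then show "loop_01 n i \<noteq> loop_01 n j \<and>
      (?E (loop_01 n i) (loop_01 n j) \<and> {loop_01 n i, loop_01 n j} \<noteq> {(0, 0), (0, 1)} \<longleftrightarrow>
        j = Suc i \<or> i = 0 \<and> Suc j = 2 * n + 4)"
  proof cases
    case 1
    have v: "loop_01 n i = (i, left i)" "loop_01 n j = (j, left j)" using V(1) 1 ij by simp_all
    have "?E (i, left i) (j, left j) \<longleftrightarrow> j = Suc i" using two(1)[of i j] 1 ij by simp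
    moreover have "(i, left i) \<noteq> (j, left j)" "Suc j \<noteq> 2 * n + 4" using 1 ij by simp_all
    ultimately show ?thesis unfolding v using e(2)[of i j] by blast
  next
    case 2
    have v: "loop_01 n i = (i, left i)" "loop_01 n j = (n + 1, 0)" using V(1,2) 2 by simp_all
    have "?E (i, left i) (n + 1, 0) \<longleftrightarrow> i = n"
      using X[OF 2(1) strands_less_4(1)] ups(1) by blast
    moreover have "(i, left i) \<noteq> (n + 1, 0)" "Suc j \<noteq> 2 * n + 4" "i = n \<longleftrightarrow> j = Suc i" using 2 n by auto
    moreover have "{(i, left i), (n + 1, 0)} \<noteq> {(0, 0), (0, 1)}" by (auto simp: doubleton_eq_iff)
    ultimately show ?thesis unfolding v by blast
  next
    case (3 b)
    have v: "loop_01 n i = (i, left i)" "loop_01 n j = (b, right b)" using V(1,3) 3 by simp_all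
    have "\<not> (?E (i, left i) (b, right b) \<and> {(i, left i), (b, right b)} \<noteq> {(0, 0), (0, 1)})"
      using two(3)[of i b] e(1)[of i b] 3(1,3) by metis
    moreover have "(i, left i) \<noteq> (b, right b)" using lr by auto
    moreover have "j \<noteq> Suc i" "Suc j \<noteq> 2 * n + 4" using 3 by auto
    ultimately show ?thesis unfolding v by metis
  next
    case 4
    have v: "loop_01 n i = (i, left i)" "loop_01 n j = (n + 2, 2)" using V(1,4) 4 by simp_all
    have "?E (i, left i) (n + 2, 2) \<longleftrightarrow> i = 0"
      using Y[OF 4(1) strands_less_4(1)] ups(3) by blast
    moreover have "(i, left i) \<noteq> (n + 2, 2)" "Suc j = 2 * n + 4" "j \<noteq> Suc i" using 4 n by auto
    moreover have "{(i, left i), (n + 2, 2)} \<noteq> {(0, 0), (0, 1)}" by (auto simp: doubleton_eq_iff)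
    ultimately show ?thesis unfolding v by blast
  next
    case (5 b)
    have v: "loop_01 n i = (n + 1, 0)" "loop_01 n j = (b, right b)" using V(2,3) 5 by simp_all
    have "?E (n + 1, 0) (b, right b) \<longleftrightarrow> b = n"
      unfolding insert_commute[of "(n + 1, 0)"] using X[OF 5(3) strands_less_4(2)] ups(2) by blast
    moreover have "(n + 1, 0) \<noteq> (b, right b)" "i \<noteq> 0" "b = n \<longleftrightarrow> j = Suc i" using 5 by auto
    moreover have "{(n + 1, 0), (b, right b)} \<noteq> {(0, 0), (0, 1)}" by (auto simp: doubleton_eq_iff)
    ultimately show ?thesis unfolding v by blast
  next
    case 6
    have v: "loop_01 n i = (n + 1, 0)" "loop_01 n j = (n + 2, 2)" using V(2,4) 6 by simp_all
    have "(n + 1, 0::nat) \<noteq> (n + 2, 2)" "i \<noteq> 0" "j \<noteq> Suc i" using 6 n by auto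
    then show ?thesis unfolding v using XY by blast
  next
    case (7 a b)
    have v: "loop_01 n i = (a, right a)" "loop_01 n j = (b, right b)" using V(3) 7 by simp_all
    have "?E (a, right a) (b, right b) \<longleftrightarrow> a = Suc b"
      unfolding insert_commute[of "(a, right a)"] using 7 two(2)[of b a] by simp
    moreover have "(a, right a) \<noteq> (b, right b)" "i \<noteq> 0" "a = Suc b \<longleftrightarrow> j = Suc i" using 7 by auto
    ultimately show ?thesis unfolding v using e(3)[of a b] by blast
  next
    case (8 a)
    have v: "loop_01 n i = (a, right a)" "loop_01 n j = (n + 2, 2)" using V(3,4) 8 by simp_all
    have "?E (a, right a) (n + 2, 2) \<longleftrightarrow> a = 0"
      using Y[OF 8(2) strands_less_4(2)] ups(4) by blast
    moreover have "(a, right a) \<noteq> (n + 2, 2)" "i \<noteq> 0" "a = 0 \<longleftrightarrow> j = Suc i" using 8 n by auto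
    moreover have "{(a, right a), (n + 2, 2)} \<noteq> {(0, 0), (0, 1)}" by (auto simp: doubleton_eq_iff)
    ultimately show ?thesis unfolding v by blast
  qed
qed (use n in simp)

text \<open>The two strands are joined by their edge in layer 0 and, at the other end, by the edge
  between 0 and 3 in layer \<open>n + 1\<close>. The parity of \<open>n\<close> decides which strand has label 3 in layer
  \<open>n\<close>; this strand continues to 0, and the one with label 2 continues to 3. The edge from the
  label 2 to 0 is then the only chord.\<close>
definition loop_20 :: "nat \<Rightarrow> nat \<Rightarrow> nat \<times> nat" where
  "loop_20 n j = (if j \<le> n then (j, left j) else if j = n + 1 then (n + 1, if odd n then 0 else 3)
     else if j = n + 2 then (n + 1, if odd n then 3 else 0) else (2 * n + 3 - j, right (2 * n + 3 - j)))"

lemma hole_20: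
  assumes n: "2 \<le> n"
  shows "embeds (loop_20 n) (cycle_graph (2 * n + 4)) (delete_edge (ring_graph (n + 3)) {(n, 2), (n + 1, 0)})"
proof (rule ring_hole)
  let ?l = "n + 3" and ?e = "{(n, 2), (n + 1, 0)} :: (nat \<times> nat) set"
  let ?x1 = "if odd n then 0 else 3 :: nat" and ?x2 = "if odd n then 3 else 0 :: nat"
  let ?E = "\<lambda>p q. {p, q} \<in> edges (ring_graph ?l)"
  have "5 \<le> ?l" using n by simp
  note two = two_strand_edges[OF this, simplified]
  have X: "?E (i, a) (n + 1, c) \<longleftrightarrow> i = n \<and> up a c" if "i \<le> n" "a < 4" "c < 4" for i a c
    using ring_edge_le[of ?l i "n + 1" a c] that n by auto
  have x4: "?x1 < 4" "?x2 < 4" by simp_all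
  have XX: "?E (n + 1, ?x1) (n + 1, ?x2)"
    using ring_edge_le[of ?l "n + 1" "n + 1" ?x1 ?x2] n by (simp add: inner_def)
  show "loop_20 n i \<in> {..<?l} \<times> {..<4}" if "i < 2 * n + 4" for i
    using that strands_less_4 by (auto simp: loop_20_def)
  fix i j assume ij: "i < j" "j < 2 * n + 4"
  have ups: "up (left n) ?x1" "up (left n) ?x2 \<longleftrightarrow> left n = 2" "up (right n) ?x1 \<longleftrightarrow> right n = 2" "up (right n) ?x2"
    "left n = 2 \<longleftrightarrow> even n" "right n = 2 \<longleftrightarrow> odd n"
    using n by (auto simp: left_def right_def up_def)
  have lr: "left i \<noteq> right i" for i by (simp add: left_def right_def)
  have V: "j \<le> n \<Longrightarrow> loop_20 n j = (j, left j)" "loop_20 n (n + 1) = (n + 1, ?x1)" "loop_20 n (n + 2) = (n + 1, ?x2)"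
    "b \<le> n \<Longrightarrow> loop_20 n (2 * n + 3 - b) = (b, right b)" for j b
    by (auto simp: loop_20_def)
  consider "j \<le> n" | "i \<le> n" "j = n + 1" | "i \<le> n" "j = n + 2" | b where "i \<le> n" "j = 2 * n + 3 - b" "b \<le> n"
    | "i = n + 1" "j = n + 2" | b where "i = n + 1" "j = 2 * n + 3 - b" "b \<le> n"
    | b where "i = n + 2" "j = 2 * n + 3 - b" "b \<le> n"
    | a b where "i = 2 * n + 3 - a" "j = 2 * n + 3 - b" "b < a" "a \<le> n"
  proof -
    show ?thesis
    proof (cases "j \<le> n + 2")
      case True
      then consider "j \<le> n" | "j = n + 1" | "j = n + 2" by linarith
      then show ?thesis using ij that(1,2,3,5) by cases linarith+
    next
      case False
      define b where "b = 2 * n + 3 - j"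
      have b: "j = 2 * n + 3 - b" "b \<le> n" using False ij by (auto simp: b_def)
      consider "i \<le> n" | "i = n + 1" | "i = n + 2" | "n + 2 < i" by linarith
      then show ?thesis
      proof cases
        case 4
        then show ?thesis using b ij by (intro that(8)[of "2 * n + 3 - i" b]) auto
      qed (use b that(4,6,7) in blast)+
    qed
  qed
  then show "loop_20 n i \<noteq> loop_20 n j \<and>
      (?E (loop_20 n i) (loop_20 n j) \<and> {loop_20 n i, loop_20 n j} \<noteq> ?e \<longleftrightarrow>
        j = Suc i \<or> i = 0 \<and> Suc j = 2 * n + 4)"
  proof cases
    case 1
    have v: "loop_20 n i = (i, left i)" "loop_20 n j = (j, left j)" using V(1) 1 ij by simp_all
    have "?E (i, left i) (j, left j) \<longleftrightarrow> j = Suc i" using two(1)[of i j] 1 ij by simp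
    moreover have "(i, left i) \<noteq> (j, left j)" "Suc j \<noteq> 2 * n + 4" using 1 ij by simp_all
    moreover have "{(i, left i), (j, left j)} \<noteq> ?e" using 1 ij by (auto simp: doubleton_eq_iff)
    ultimately show ?thesis unfolding v by blast
  next
    case 2
    have v: "loop_20 n i = (i, left i)" "loop_20 n j = (n + 1, ?x1)" using V(1,2) 2 by simp_all
    have "?E (i, left i) (n + 1, ?x1) \<longleftrightarrow> i = n"
      using X[OF 2(1) strands_less_4(1) x4(1)] ups(1) by blast
    moreover have "(i, left i) \<noteq> (n + 1, ?x1)" "Suc j \<noteq> 2 * n + 4" "i = n \<longleftrightarrow> j = Suc i" using 2 n by auto
    moreover have "{(i, left i), (n + 1, ?x1)} \<noteq> ?e" if "i = n"
      unfolding that using ups(5) by (auto simp: doubleton_eq_iff)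
    ultimately show ?thesis unfolding v by blast
  next
    case 3
    have v: "loop_20 n i = (i, left i)" "loop_20 n j = (n + 1, ?x2)" using V(1,3) 3 by simp_all
    have "?E (i, left i) (n + 1, ?x2) \<longleftrightarrow> i = n \<and> left n = 2"
      using X[OF 3(1) strands_less_4(1) x4(2)] ups(2) by blast
    moreover have "{(i, left i), (n + 1, ?x2)} = ?e" if "i = n" "left n = 2"
      using that ups(5) by simp
    moreover have "(i, left i) \<noteq> (n + 1, ?x2)" "Suc j \<noteq> 2 * n + 4" "j \<noteq> Suc i" using 3 n by auto
    ultimately show ?thesis unfolding v by blast
  next
    case (4 b)
    have v: "loop_20 n i = (i, left i)" "loop_20 n j = (b, right b)" using V(1,4) 4 by simp_all
    have "?E (i, left i) (b, right b) \<longleftrightarrow> i = 0 \<and> b = 0" using two(3)[of i b] 4 by simp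
    moreover have "(i, left i) \<noteq> (b, right b)" using lr by auto
    moreover have "{(i, left i), (b, right b)} \<noteq> ?e" using 4 by (auto simp: doubleton_eq_iff)
    moreover have "j \<noteq> Suc i" "b = 0 \<longleftrightarrow> Suc j = 2 * n + 4" using 4 by auto
    ultimately show ?thesis unfolding v by blast
  next
    case 5
    have v: "loop_20 n i = (n + 1, ?x1)" "loop_20 n j = (n + 1, ?x2)" using V(2,3) 5 by simp_all
    have "{(n + 1, ?x1), (n + 1, ?x2)} \<noteq> ?e" by (auto simp: doubleton_eq_iff)
    moreover have "(n + 1, ?x1) \<noteq> (n + 1, ?x2)" "j = Suc i" using 5 by simp_all
    ultimately show ?thesis unfolding v using XX by blast
  next
    case (6 b)
    have v: "loop_20 n i = (n + 1, ?x1)" "loop_20 n j = (b, right b)" using V(2,4) 6 by simp_all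
    have "?E (n + 1, ?x1) (b, right b) \<longleftrightarrow> b = n \<and> right n = 2"
      unfolding insert_commute[of "(n + 1, ?x1)"]
      using X[OF 6(3) strands_less_4(2) x4(1)] ups(3) by blast
    moreover have "{(n + 1, ?x1), (b, right b)} = ?e" if "b = n" "right n = 2"
      using that ups(6) by (simp add: insert_commute)
    moreover have "(n + 1, ?x1) \<noteq> (b, right b)" "i \<noteq> 0" "j \<noteq> Suc i" using 6 by auto
    ultimately show ?thesis unfolding v by blast
  next
    case (7 b)
    have v: "loop_20 n i = (n + 1, ?x2)" "loop_20 n j = (b, right b)" using V(3,4) 7 by simp_all
    have "?E (n + 1, ?x2) (b, right b) \<longleftrightarrow> b = n"
      unfolding insert_commute[of "(n + 1, ?x2)"]
      using X[OF 7(3) strands_less_4(2) x4(2)] ups(4) by blast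
    moreover have "{(n + 1, ?x2), (b, right b)} \<noteq> ?e" if "b = n"
      unfolding that using ups(6) by (auto simp: doubleton_eq_iff)
    moreover have "(n + 1, ?x2) \<noteq> (b, right b)" "i \<noteq> 0" "b = n \<longleftrightarrow> j = Suc i" using 7 by auto
    ultimately show ?thesis unfolding v by blast
  next
    case (8 a b)
    have v: "loop_20 n i = (a, right a)" "loop_20 n j = (b, right b)" using V(4) 8 by simp_all
    have "?E (a, right a) (b, right b) \<longleftrightarrow> a = Suc b"
      unfolding insert_commute[of "(a, right a)"] using 8 two(2)[of b a] by simp
    moreover have "(a, right a) \<noteq> (b, right b)" "i \<noteq> 0" "a = Suc b \<longleftrightarrow> j = Suc i" using 8 by auto
    moreover have "{(a, right a), (b, right b)} \<noteq> ?e" using 8 by (auto simp: doubleton_eq_iff)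
    ultimately show ?thesis unfolding v by blast
  qed
qed (use n in simp)

text \<open>Rotations of the ring, and the exchange of 0 with 1 and of 2 with 3 in all layers, are
  automorphisms.\<close>
definition rotate_layers :: "nat \<Rightarrow> nat \<Rightarrow> nat \<times> nat \<Rightarrow> nat \<times> nat" where
  "rotate_layers l c p = ((fst p + c) mod l, snd p)"

definition swap_labels :: "nat \<times> nat \<Rightarrow> nat \<times> nat" where
  "swap_labels p = (fst p, [1, 0, 3, 2] ! snd p)"

lemma add_mod_inj:
  fixes i j l c :: nat
  assumes "i < l" "j < l" "(i + c) mod l = (j + c) mod l"
  shows "i = j"
proof -
  have "j = i" if "i \<le> j" "j < l" "(i + c) mod l = (j + c) mod l" for i j :: nat
  proof -
    have "l dvd j - i" using that mod_eq_dvd_iff_nat[of "i + c" "j + c" l] by simp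
    then show ?thesis using that nat_dvd_not_less[of "j - i" l] by linarith
  qed
  then show ?thesis using assms by (metis nat_le_linear)
qed

lemma embeds_rotate_layers: "embeds (rotate_layers l c) (ring_graph l) (ring_graph l)"
proof -
  have suc: "(j + c) mod l = Suc ((i + c) mod l) mod l \<longleftrightarrow> j = Suc i mod l" if "i < l" "j < l" for i j
  proof -
    have "Suc ((i + c) mod l) mod l = (Suc i mod l + c) mod l" by (simp add: mod_Suc_eq mod_add_left_eq)
    then show ?thesis using add_mod_inj[of j l "Suc i mod l" c] that by auto
  qed
  have inj: "(i + c) mod l = (j + c) mod l \<longleftrightarrow> i = j" if "i < l" "j < l" for i j
    using add_mod_inj[OF that] by auto
  have "{rotate_layers l c p, rotate_layers l c q} \<in> edges (ring_graph l) \<longleftrightarrow> {p, q} \<in> edges (ring_graph l)"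
    if "p \<in> {..<l} \<times> {..<4}" "q \<in> {..<l} \<times> {..<4}" for p q
  proof -
    obtain i a j b where pq: "p = (i, a)" "q = (j, b)" by fastforce
    have "i < l" "j < l" using that pq by auto
    then show ?thesis
      unfolding ring_edge_iff pq rotate_layers_def ring_adj_def fst_conv snd_conv
      using that pq by (simp add: suc inj)
  qed
  moreover have "inj_on (rotate_layers l c) ({..<l} \<times> {..<4})"
    by (rule inj_onI) (auto simp: rotate_layers_def dest: add_mod_inj)
  moreover have "rotate_layers l c ` ({..<l} \<times> {..<4}) \<subseteq> {..<l} \<times> {..<4}"
    by (auto simp: rotate_layers_def)
  ultimately show ?thesis unfolding embeds_def verts_ring by blast
qed

lemma embeds_swap_labels: "embeds swap_labels (ring_graph l) (ring_graph l)"
proof -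
  have labels: "\<forall>a\<in>set [0..<4]. \<forall>b\<in>set [0..<4]. let \<sigma> = (!) [1, 0, 3, 2 :: nat] in
     \<sigma> a < 4 \<and> (\<sigma> a = \<sigma> b \<longleftrightarrow> a = b) \<and> inner (\<sigma> a) (\<sigma> b) = inner a b \<and> up (\<sigma> a) (\<sigma> b) = up a b"
    by code_simp
  have "{swap_labels p, swap_labels q} \<in> edges (ring_graph l) \<longleftrightarrow> {p, q} \<in> edges (ring_graph l)"
    if "p \<in> {..<l} \<times> {..<4}" "q \<in> {..<l} \<times> {..<4}" for p q
  proof -
    obtain i a j b where pq: "p = (i, a)" "q = (j, b)" by fastforce
    have "a \<in> set [0..<4]" "b \<in> set [0..<4]" using that pq by auto
    from bspec[OF bspec[OF labels this(1)] this(2)] bspec[OF bspec[OF labels this(2)] this(1)]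
    show ?thesis
      unfolding ring_edge_iff pq swap_labels_def ring_adj_def fst_conv snd_conv Let_def
      using that pq by (simp only: mem_Sigma_iff lessThan_iff prod.inject)
  qed
  moreover have "inj_on swap_labels ({..<l} \<times> {..<4})"
  proof (rule inj_onI)
    fix p q assume "p \<in> {..<l} \<times> {..<4::nat}" "q \<in> {..<l} \<times> {..<4::nat}" "swap_labels p = swap_labels q"
    then have "snd p \<in> set [0..<4]" "snd q \<in> set [0..<4]" "fst p = fst q"
      "[1, 0, 3, 2] ! snd p = [1, 0, 3, 2 :: nat] ! snd q" by (auto simp: swap_labels_def)
    moreover from bspec[OF bspec[OF labels this(1)] this(2)] this(4) have "snd p = snd q"
      unfolding Let_def by blast
    ultimately show "p = q" by (simp add: prod_eq_iff)
  qed
  moreover have "swap_labels ` ({..<l} \<times> {..<4}) \<subseteq> {..<l} \<times> {..<4}"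
  proof
    fix q assume "q \<in> swap_labels ` ({..<l} \<times> {..<4})"
    then obtain p where p: "p \<in> {..<l} \<times> {..<4}" "q = swap_labels p" by blast
    then have "snd p \<in> set [0..<4]" by auto
    then have "[1, 0, 3, 2] ! snd p < (4::nat)" using labels unfolding Let_def by blast
    then show "q \<in> {..<l} \<times> {..<4}" using p by (auto simp: swap_labels_def)
  qed
  ultimately show ?thesis unfolding embeds_def verts_ring by blast
qed

definition breakable :: "nat \<Rightarrow> (nat \<times> nat) set \<Rightarrow> bool" where
  "breakable l e \<longleftrightarrow> (\<exists>f. embeds f (cycle_graph (2 * l - 2)) (delete_edge (ring_graph l) e))"

lemma breakable_rotate:
  assumes "breakable l {(i, a), (i', b)}" "i < l" "i' < l" "a < 4" "b < 4"
  shows "breakable l {((i + c) mod l, a), ((i' + c) mod l, b)}"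
  using assms embeds_delete_edge_image[OF _ embeds_rotate_layers, of _ _ l "{(i, a), (i', b)}" _ c]
  by (auto simp: breakable_def verts_ring rotate_layers_def)

lemma breakable_swap:
  assumes "breakable l {(i, a), (i', b)}" "i < l" "i' < l" "a < 4" "b < 4"
  shows "breakable l {(i, [1, 0, 3, 2] ! a), (i', [1, 0, 3, 2] ! b)}"
  using assms embeds_delete_edge_image[OF _ embeds_swap_labels, of _ _ l "{(i, a), (i', b)}"]
  by (auto simp: breakable_def verts_ring swap_labels_def)

lemma breakable_to_any_layer:
  assumes "breakable l {(i, a), (Suc i mod l, b)}" "i < l" "j < l" "a < 4" "b < 4"
  shows "breakable l {(j, a), (Suc j mod l, b)}"
proof -
  have "(i + (l - i + j)) mod l = j" using assms by simp
  moreover from this have "(Suc i mod l + (l - i + j)) mod l = Suc j mod l"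
    by (metis add_Suc mod_Suc_eq mod_add_left_eq)
  moreover have "Suc i mod l < l" using assms by simp
  ultimately show ?thesis using breakable_rotate[OF assms(1,2) _ assms(4,5), of "l - i + j"] by simp
qed

lemma breakable_same_layer:
  assumes "breakable l {(i, a), (i, b)}" "i < l" "j < l" "a < 4" "b < 4"
  shows "breakable l {(j, a), (j, b)}"
proof -
  have "(i + (l - i + j)) mod l = j" using assms by simp
  then show ?thesis using breakable_rotate[OF assms(1,2,2,4,5), of "l - i + j"] by simp
qed

text \<open>Up to rotation there are five edges within layers and ten between layers. The exchange of
  labels fixes the edge between 0 and 1 in a layer and pairs up all others. This leaves eight
  kinds: six are covered by \<open>starts_valid\<close> and two by the loops.\<close>
lemma breakable_edges:
  assumes l: "5 \<le> l" and j: "j < l"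
  shows "a < 4 \<Longrightarrow> b < 4 \<Longrightarrow> inner a b \<Longrightarrow> breakable l {(j, a), (j, b)}"
    "a < 4 \<Longrightarrow> b < 4 \<Longrightarrow> up a b \<Longrightarrow> breakable l {(j, a), (Suc j mod l, b)}"
proof -
  obtain n where n: "l = n + 3" "2 \<le> n" using l by (metis add.commute add_le_cancel_right le_Suc_ex
    add_leD2 numeral_Bit1 numeral_code(2) one_add_one add.assoc nat_le_iff_add)
  have single: "breakable l {x, y}" if "valid_start P x y" for P x y
    using single_strand_hole[OF l that] by (auto simp: breakable_def)
  have base: "breakable l {(3, 0), (3, 2)}" "breakable l {(2, 0), (2, 3)}" "breakable l {(0, 0), (1, 1)}"
    "breakable l {(0, 0), (1, 3)}" "breakable l {(1, 3), (2, 0)}" "breakable l {(1, 3), (2, 2)}"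
    using starts_valid single by (simp_all, blast+)
  have k: "2 * l - 2 = 2 * n + 4" using n by simp
  have base': "breakable l {(0, 0), (0, 1)}" "breakable l {(n, 2), (n + 1, 0)}"
    unfolding breakable_def k unfolding n(1) using hole_01[OF n(2)] hole_20[OF n(2)] by blast+
  have small: "0 < l" "1 < l" "2 < l" "3 < l" "n < l" "Suc 0 mod l = 1" "Suc 1 mod l = 2" "Suc n mod l = n + 1"
    using l n by auto
  have in01: "breakable l {(i, 0), (i, 1)}" and in02: "breakable l {(i, 0), (i, 2)}" and in03: "breakable l {(i, 0), (i, 3)}"
    if "i < l" for i
    using breakable_same_layer[OF base'(1) small(1) that] breakable_same_layer[OF base(1) small(4) that]
      breakable_same_layer[OF base(2) small(3) that] by simp_all
  have in13: "breakable l {(i, 1), (i, 3)}" and in12: "breakable l {(i, 1), (i, 2)}" if "i < l" for i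
    using breakable_swap[OF in02[OF that] that that] breakable_swap[OF in03[OF that] that that] by simp_all
  have up01: "breakable l {(i, 0), (Suc i mod l, 1)}" and up03: "breakable l {(i, 0), (Suc i mod l, 3)}"
    and up30: "breakable l {(i, 3), (Suc i mod l, 0)}" and up32: "breakable l {(i, 3), (Suc i mod l, 2)}"
    and up20: "breakable l {(i, 2), (Suc i mod l, 0)}" if "i < l" for i
    using breakable_to_any_layer[of l 0 0 1 i] breakable_to_any_layer[of l 0 0 3 i]
      breakable_to_any_layer[of l 1 3 0 i] breakable_to_any_layer[of l 1 3 2 i]
      breakable_to_any_layer[of l n 2 0 i] base base' small that by (simp_all add: numeral_2_eq_2)
  have S: "Suc i mod l < l" for i using small by simp
  have up10: "breakable l {(i, 1), (Suc i mod l, 0)}" and up12: "breakable l {(i, 1), (Suc i mod l, 2)}"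
    and up21: "breakable l {(i, 2), (Suc i mod l, 1)}" and up23: "breakable l {(i, 2), (Suc i mod l, 3)}"
    and up31: "breakable l {(i, 3), (Suc i mod l, 1)}" if "i < l" for i
    using breakable_swap[OF up01[OF that] that S] breakable_swap[OF up03[OF that] that S]
      breakable_swap[OF up30[OF that] that S] breakable_swap[OF up32[OF that] that S]
      breakable_swap[OF up20[OF that] that S] by simp_all
  show "breakable l {(j, a), (j, b)}" if "a < 4" "b < 4" "inner a b"
    using that in01[OF j] in02[OF j] in03[OF j] in12[OF j] in13[OF j]
    unfolding less_4_cases by (elim disjE) (simp_all add: inner_def insert_commute)
  show "breakable l {(j, a), (Suc j mod l, b)}" if "a < 4" "b < 4" "up a b"
    using that up01[OF j] up03[OF j] up10[OF j] up12[OF j] up20[OF j] up21[OF j] up23[OF j] up30[OF j]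
      up31[OF j] up32[OF j]
    unfolding less_4_cases by (elim disjE) (simp_all add: up_def)
qed

lemma ring_saturated:
  assumes l: "5 \<le> l"
  shows "deletion_saturated (cycle_graph (2 * l - 2)) (ring_graph l)"
  unfolding deletion_saturated_iff
proof (intro conjI ballI)
  show "simple_graph (ring_graph l)" by (rule simple_ring)
  show "\<nexists>f. embeds f (cycle_graph (2 * l - 2)) (ring_graph l)" using no_cycle_in_ring[OF l] by blast
  have "{(0, 0), (0, 1)} \<in> edges (ring_graph l)"
    using l by (simp add: ring_edge_iff ring_adj_def inner_def)
  then show "edges (ring_graph l) \<noteq> {}" by blast
  fix e assume "e \<in> edges (ring_graph l)"
  then obtain p q where pq: "e = {p, q}" "p \<in> {..<l} \<times> {..<4}" "q \<in> {..<l} \<times> {..<4}" "ring_adj l p q"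
    unfolding ring_graph_def by (rule edges_graph_onE)
  obtain i a j b where ij: "p = (i, a)" "q = (j, b)" by fastforce
  have bounds: "i < l" "j < l" "a < 4" "b < 4" using pq ij by auto
  from pq(4) consider "i = j" "inner a b" | "j = Suc i mod l" "up a b" | "i = Suc j mod l" "up b a"
    by (auto simp: ring_adj_def ij)
  then have "breakable l e"
  proof cases
    case 1
    then show ?thesis using breakable_edges(1)[OF l bounds(1,3,4)] pq(1) ij by simp
  next
    case 2
    then show ?thesis using breakable_edges(2)[OF l bounds(1,3,4)] pq(1) ij by simp
  next
    case 3
    then show ?thesis using breakable_edges(2)[OF l bounds(2,4,3)] pq(1) ij by (simp add: insert_commute)
  qed
  then show "\<exists>f. embeds f (cycle_graph (2 * l - 2)) (delete_edge (ring_graph l) e)"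
    by (simp add: breakable_def)
qed

theorem corollary4p3:
  fixes H :: "'a graph"
  assumes "simple_graph H"
    and "triangle_free H"
    and "\<exists>!C. subgraph C H \<and> is_cycle C"
  shows "deletion_normal H"
proof -
  obtain C where C: "subgraph C H" "is_cycle C" "\<And>D. subgraph D H \<Longrightarrow> is_cycle D \<Longrightarrow> D = C"
    using assms(3) by blast
  have uni: "unicyclic H C" using assms(1) C by unfold_locales
  then interpret unicyclic H C .
  obtain k c where k: "3 \<le> k" and c: "embeds c (cycle_graph k) H" "c ` {..<k} = verts C"
    by (rule obtain_cycle)
  have "k \<noteq> 3" using assms(2) c(1) not_free_iff_embeds unfolding triangle_free_def by blast
  note normal = deletion_normal_of_cycle_saturated[OF uni c k]
  consider "k = 4" | "k = 6" | s where "2 \<le> s" "k = 2 * s + 1" | l where "5 \<le> l" "k = 2 * l - 2"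
  proof -
    show ?thesis
    proof (cases "even k")
      case True
      then obtain n where n: "k = 2 * n" by (rule evenE)
      then show ?thesis using k that(1,2) that(4)[of "n + 1"] by (cases "n = 2"; cases "n = 3") auto
    next
      case False
      then obtain n where "k = 2 * n + 1" by (rule oddE)
      then show ?thesis using k \<open>k \<noteq> 3\<close> that(3)[of n] by auto
    qed
  qed
  then show ?thesis
  proof cases
    case 1
    then show ?thesis using normal C4_saturated by blast
  next
    case 2
    then show ?thesis using normal C6_saturated by blast
  next
    case 3
    then show ?thesis using normal rook_saturated by blast
  next
    case 4
    then show ?thesis using normal ring_saturated by blast
  qed
qed

end
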